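(* Let $\{A^{(t_k)}\}_{k=1}^m$ be observed from the size-$n$ sparse time-varying graphon model with graphon $f$ and sparsity factor $\rho_n$, with the snapshots at different time points independent. Assume: (1) Hölder smoothness in time with parameters $(\beta,L_1)$; (2) the piecewise Lipschitz condition with constants $(\delta,J,L_2)$; (3) the local polynomial regularity conditions LP1–LP3 (all three spelled out in the context). Suppose $\rho_n\ge\sqrt{\frac{\log (nm)}{nm}}$. Let $\hat P^{(t)}$ be the two-stage estimator (defined in the context) with bandwidths $$ (h_1^\star,h_2^\star) \asymp \begin{cases} \Bigl(\bigl(\tfrac{\log (nm)}{\rho_n^{2}nm}\bigr)^{1/(2\beta+1)},\;\rho_n^{1/(2\beta+1)}\bigl(\tfrac{\log (nm)}{nm}\bigr)^{\beta/(2\beta+1)}\Bigr), & \text{if } n\rho_n \gtrsim \sqrt{n\,m^{\beta/(\beta+1)}\log (nm)},\\[8pt] \Bigl(\bigl(\tfrac{\log (nm)}{\rho_n m}\bigr)^{1/(2\beta+1)},\;1/n\Bigr), & \text{if } n\rho_n \lesssim \sqrt{n\,m^{\beta/(\beta+1)}\log (nm)}, \end{cases} $$ and let $\bar P^{(t)}=\sum_{k=1}^m w_k(t;h_3)\,\hat P^{(t_k)}$ be the three-stage estimator, where $w_k(t;h_3)$ are the local polynomial weights with bandwidth $h_3$ set to $$ h_3^\star= \begin{cases} \rho_n^{\frac{-2}{2\beta+1}}\bigl(\tfrac{\log (nm)}{nm}\bigr)^{1/(2\beta+1)}, & n\rho_n\gtrsim\sqrt{n\,m^{\beta/(\beta+1)}\log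 (nm)},\\[6pt] \rho_n^{\frac{-2}{2\beta+1}}\bigl(\tfrac{\log (nm)}{m}\bigr)^{2/(2\beta+1)}, & n\rho_n\lesssim\sqrt{n\,m^{\beta/(\beta+1)}\log (nm)}. \end{cases} $$ Then there exist constants $C,\tilde C>0$ such that, for sufficiently large $n,m$, $$ \sup_{t\in[0,1]}\frac1n\|\bar P^{(t)}-P^{(t)}\|_{2,\infty}^2\le \begin{cases} C\rho_n^{\frac{2\beta+2}{2\beta+1}}\bigl(\tfrac{\log (nm)}{nm}\bigr)^{\beta/(2\beta+1)}, & n\rho_n\gtrsim\sqrt{n\,m^{\beta/(\beta+1)}\log (nm)},\\[6pt] C\rho_n^{\frac{2\beta+2}{2\beta+1}}\bigl(\tfrac{\log (nm)}{m}\bigr)^{2\beta/(2\beta+1)}, & n\rho_n\lesssim\sqrt{n\,m^{\beta/(\beta+1)}\log (nm)}, \end{cases} $$ with probability at least $1-2(nm)^{-(\tilde C+\gamma)}$ for some $\gamma>0$.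
   Context: Notation. For a matrix $B\in\mathbb R^{n\times n}$, $\|B\|_{2,\infty}=\max_{1\le i\le n}\|B_{i\cdot}\|_2$ (maximum Euclidean row norm). $a\gtrsim b$ (resp. $a\lesssim b$) means $a\ge cb$ (resp. $a\le cb$) for a constant $c>0$, and $a\asymp b$ means both. Sparse time-varying graphon model. $f:[0,1]^3\to[0,1]$ is measurable with $f(x,y,t)=f(y,x,t)$ and $\max f=1$; $\rho_n\in(0,1)$ is a scalar; $\xi_1,\dots,\xi_n$ are i.i.d. $\mathrm{Uniform}[0,1]$. For each $t\in[0,1]$, $P^{(t)}_{ij}=\rho_n f(\xi_i,\xi_j,t)$ for $1\le i,j\le n$. Given the $P^{(t)}$, the adjacency matrices $A^{(t)}$ are symmetric with independent entries $A^{(t)}_{ij}\sim\mathrm{Bernoulli}(P^{(t)}_{ij})$, $A^{(t)}_{ij}=A^{(t)}_{ji}$ (the same description is used for diagonal entries). The networks are observed at fixed times $t_1,\dots,t_m\in[0,1]$, and the snapshots at different time points are independent (given $\xi_1,\dots,\xi_n$). Assumption 1 (Hölder smoothness). For parameters $\beta>0$, $L_1>0$ and $\ell=\lfloor\beta\rfloor$: for each fixed $(\xi_i,\xi_j)\in[0,1]^2$ the function $t\mapsto f(\xi_i,\xi_j,t)$ is $\ell$ times differentiable on $[0,1]$ and $|f^{(\ell)}(\xi_i,\xi_j,t)-f^{(\ell)}(\xi_i,\xi_j,t')|\le L_1|t-t'|^{\beta-\ell}$ for all $t,t'\in[0,1]$ (derivatives in $t$). Assumption 2 (piecewise Lipschitz).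 There exist $\delta>0$, an integer $J\ge1$ and a partition $0=x_0<x_1<\dots<x_J=1$ with $\min_{0\le s\le J-1}(x_{s+1}-x_s)>\delta$ such that for all $0\le k,l\le J-1$, all $t\in[0,1]$, all $u,u_1,u_2\in[x_k,x_{k+1})$ and $v,v_1,v_2\in[x_l,x_{l+1})$: $|f(u_1,v,t)-f(u_2,v,t)|\le L_2|u_1-u_2|$ and $|f(u,v_1,t)-f(u,v_2,t)|\le L_2|v_1-v_2|$. Local polynomial weights. With $U(u)=(1,u,\dots,u^\ell)^\top$, kernel $K$ and bandwidth $h>0$, let $B_{mt}=\frac1{mh}\sum_{k=1}^m U\bigl(\frac{t_k-t}{h}\bigr)U\bigl(\frac{t_k-t}{h}\bigr)^\top K\bigl(\frac{t_k-t}{h}\bigr)$ and $w_k(t;h)=\frac1{mh}U(0)^\top B_{mt}^{-1}U\bigl(\frac{t_k-t}{h}\bigr)K\bigl(\frac{t_k-t}{h}\bigr)$. Assumption 3 (LP1–LP3). (LP1) There exist $\lambda_0>0$ and a positive integer $m_0$ such that for all $m\ge m_0$ and $t\in[0,1]$ the smallest eigenvalue satisfies $\lambda_{\min}(B_{mt})\ge\lambda_0$, for each bandwidth in use ($h=h_1$ and $h=h_3$). (LP2) There exists $a_0>0$ such that for any interval $I\subseteq[0,1]$ and all $m\ge1$, $\frac1m\sum_{k=1}^m\mathbf 1\{t_k\in I\}\le a_0\max(|I|,1/m)$, where $|I|$ is the length of $I$. (LP3) $K$ has compact support within $[-1,1]$ and there is $K_{\max}<\infty$ with $|K(u)|\le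 K_{\max}$ for all $u\in\mathbb R$. Two-stage estimator. Step 1: $\tilde P^{(t)}_{ij}=\sum_{k=1}^m w_k(t;h_1)A^{(t_k)}_{ij}$. Step 2: define $\tilde d_t(i,i')=\sqrt{\max_{l\ne i,i'}|\langle\tilde P^{(t)}_{i\cdot}-\tilde P^{(t)}_{i'\cdot},\tilde P^{(t)}_{l\cdot}\rangle|/n}$; let $q_{i,t}(h_2)$ be the (lower) $h_2$-quantile of $\{\tilde d_t(i,k)\}_{k=1}^n$; the neighborhood is $\mathcal N_i^{(t)}=\{i':\tilde d_t(i,i')\le q_{i,t}(h_2)\}$; and $\hat P^{(t)}_{ij}=\frac1{|\mathcal N_i^{(t)}|}\sum_{i'\in\mathcal N_i^{(t)}}\tilde P^{(t)}_{i'j}$ for $1\le i,j\le n$. The choice $h_2^\star\asymp1/n$ is understood as bypassing the neighborhood step, i.e. $\mathcal N_i^{(t)}=\{i\}$ and $\hat P^{(t)}=\tilde P^{(t)}$. *)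

theory Defs
  imports
    "HOL-Probability.Probability"
    "Jordan_Normal_Form.Char_Poly"
    "Jordan_Normal_Form.Gauss_Jordan_Elimination"
begin

text \<open>
  Nodes are indexed by \<open>{1..n}\<close> and observation times by \<open>{1..m}\<close>; an \<open>n \<times> n\<close> matrix whose size
  varies is a function \<open>nat \<Rightarrow> nat \<Rightarrow> real\<close> that is only used on \<open>{1..n} \<times> {1..n}\<close>.  The fixed-size
  matrices of the local polynomial weights are matrices of \<open>Jordan_Normal_Form\<close>, with indices
  starting at 0.
\<close>

section \<open>Graphons and their regularity\<close>

definition time_varying_graphon :: "(real \<Rightarrow> real \<Rightarrow> real \<Rightarrow> real) \<Rightarrow> bool" where
  "time_varying_graphon f \<longleftrightarrow>
     (\<lambda>(x, y, t). f x y t)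
       \<in> borel_measurable (restrict_space borel ({0..1} \<times> {0..1} \<times> {0..1})) \<and>
     (\<forall>x\<in>{0..1}. \<forall>y\<in>{0..1}. \<forall>t\<in>{0..1}. 0 \<le> f x y t \<and> f x y t \<le> 1 \<and> f x y t = f y x t) \<and>
     (\<exists>x\<in>{0..1}. \<exists>y\<in>{0..1}. \<exists>t\<in>{0..1}. f x y t = 1)"

text \<open>
  \<open>D k\<close> is the \<open>k\<close>-th derivative in time, one-sided at the end points of \<open>[0,1]\<close>.
  For integral \<open>\<beta>\<close> the exponent \<open>\<beta> - \<ell>\<close> is 0; the convention \<open>0 powr 0 = 0\<close> does no harm,
  because for \<open>t = t'\<close> the left-hand side is 0 as well.
\<close>

definition holder_in_time :: "real \<Rightarrow> real \<Rightarrow> (real \<Rightarrow> real \<Rightarrow> real \<Rightarrow> real) \<Rightarrow> bool" where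
  "holder_in_time \<beta> L f \<longleftrightarrow>
     (\<forall>x\<in>{0..1}. \<forall>y\<in>{0..1}. \<exists>D :: nat \<Rightarrow> real \<Rightarrow> real.
        (\<forall>t\<in>{0..1}. D 0 t = f x y t) \<and>
        (\<forall>k<nat \<lfloor>\<beta>\<rfloor>. \<forall>t\<in>{0..1}. (D k has_real_derivative D (Suc k) t) (at t within {0..1})) \<and>
        (\<forall>t\<in>{0..1}. \<forall>t'\<in>{0..1}.
           \<bar>D (nat \<lfloor>\<beta>\<rfloor>) t - D (nat \<lfloor>\<beta>\<rfloor>) t'\<bar> \<le> L * \<bar>t - t'\<bar> powr (\<beta> - real (nat \<lfloor>\<beta>\<rfloor>))))"

definition piecewise_lipschitz ::
  "real \<Rightarrow> nat \<Rightarrow> real \<Rightarrow> (real \<Rightarrow> real \<Rightarrow> real \<Rightarrow> real) \<Rightarrow> bool" where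
  "piecewise_lipschitz \<delta> J L f \<longleftrightarrow>
     (\<exists>x :: nat \<Rightarrow> real. x 0 = 0 \<and> x J = 1 \<and>
        (\<forall>s<J. x s < x (Suc s) \<and> \<delta> < x (Suc s) - x s) \<and>
        (\<forall>k<J. \<forall>l<J. \<forall>t\<in>{0..1}.
           (\<forall>u1\<in>{x k..<x (Suc k)}. \<forall>u2\<in>{x k..<x (Suc k)}. \<forall>v\<in>{x l..<x (Suc l)}.
              \<bar>f u1 v t - f u2 v t\<bar> \<le> L * \<bar>u1 - u2\<bar>) \<and>
           (\<forall>u\<in>{x k..<x (Suc k)}. \<forall>v1\<in>{x l..<x (Suc l)}. \<forall>v2\<in>{x l..<x (Suc l)}.
              \<bar>f u v1 t - f u v2 t\<bar> \<le> L * \<bar>v1 - v2\<bar>)))"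

section \<open>The sparse time-varying graphon model\<close>

definition latent_algebra :: "'a measure \<Rightarrow> nat \<Rightarrow> (nat \<Rightarrow> 'a \<Rightarrow> real) \<Rightarrow> 'a measure" where
  "latent_algebra M n \<xi> =
     vimage_algebra (space M) (\<lambda>\<omega>. \<lambda>i\<in>{1..n}. \<xi> i \<omega>) (PiM {1..n} (\<lambda>_. borel))"

definition edge_slots :: "nat \<Rightarrow> nat \<Rightarrow> (nat \<times> nat \<times> nat) set" where
  "edge_slots n m = {(k, i, j). k \<in> {1..m} \<and> i \<in> {1..n} \<and> j \<in> {1..n} \<and> i \<le> j}"

definition edge_event ::
  "'a measure \<Rightarrow> (nat \<Rightarrow> nat \<Rightarrow> nat \<Rightarrow> 'a \<Rightarrow> real) \<Rightarrow> nat \<times> nat \<times> nat \<Rightarrow> 'a set" where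
  "edge_event M A = (\<lambda>(k, i, j). {\<omega> \<in> space M. A k i j \<omega> = 1})"

definition edge_prob ::
  "(real \<Rightarrow> real \<Rightarrow> real \<Rightarrow> real) \<Rightarrow> real \<Rightarrow> (nat \<Rightarrow> 'a \<Rightarrow> real) \<Rightarrow> 'a \<Rightarrow> real \<Rightarrow> nat \<Rightarrow> nat \<Rightarrow> real" where
  "edge_prob f \<rho> \<xi> \<omega> t i j = \<rho> * f (\<xi> i \<omega>) (\<xi> j \<omega>) t"

text \<open>
  \<open>T k\<close> is the \<open>k\<close>-th observation time and \<open>A k\<close> the adjacency matrix observed then.
  The last two assumptions are conditional on the latent positions: every slot \<open>(k, i, j)\<close> with
  \<open>i \<le> j\<close> is Bernoulli, and all slots, within and across snapshots, are independent (the
  conditional counterpart of \<open>indep_events\<close>).  The latent positions take values in \<open>[0,1]\<close>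
  everywhere, since \<open>f\<close> is only constrained there.
\<close>

locale sparse_graphon_sample = prob_space M
  for M :: "'a measure" +
  fixes n m :: nat
    and f :: "real \<Rightarrow> real \<Rightarrow> real \<Rightarrow> real"
    and \<rho> :: real
    and T :: "nat \<Rightarrow> real"
    and \<xi> :: "nat \<Rightarrow> 'a \<Rightarrow> real"
    and A :: "nat \<Rightarrow> nat \<Rightarrow> nat \<Rightarrow> 'a \<Rightarrow> real"
  assumes latent_indep: "indep_vars (\<lambda>_. borel) \<xi> {1..n}"
    and latent_uniform: "\<And>i. i \<in> {1..n} \<Longrightarrow> distr M borel (\<xi> i) = uniform_measure lborel {0..1}"
    and latent_range: "\<And>i \<omega>. i \<in> {1..n} \<Longrightarrow> \<omega> \<in> space M \<Longrightarrow> \<xi> i \<omega> \<in> {0..1}"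
    and adj_measurable:
      "\<And>k i j. k \<in> {1..m} \<Longrightarrow> i \<in> {1..n} \<Longrightarrow> j \<in> {1..n} \<Longrightarrow> A k i j \<in> borel_measurable M"
    and adj_binary:
      "\<And>k i j \<omega>. k \<in> {1..m} \<Longrightarrow> i \<in> {1..n} \<Longrightarrow> j \<in> {1..n} \<Longrightarrow> \<omega> \<in> space M \<Longrightarrow>
        A k i j \<omega> \<in> {0, 1}"
    and adj_sym:
      "\<And>k i j \<omega>. k \<in> {1..m} \<Longrightarrow> i \<in> {1..n} \<Longrightarrow> j \<in> {1..n} \<Longrightarrow> \<omega> \<in> space M \<Longrightarrow>
        A k i j \<omega> = A k j i \<omega>"
    and adj_bernoulli:
      "\<And>k i j. (k, i, j) \<in> edge_slots n m \<Longrightarrow>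
        AE \<omega> in M. real_cond_exp M (latent_algebra M n \<xi>)
            (indicator (edge_event M A (k, i, j))) \<omega> = edge_prob f \<rho> \<xi> \<omega> (T k) i j"
    and adj_cond_indep:
      "\<And>S. S \<subseteq> edge_slots n m \<Longrightarrow> S \<noteq> {} \<Longrightarrow>
        AE \<omega> in M. real_cond_exp M (latent_algebra M n \<xi>)
            (indicator (\<Inter>e\<in>S. edge_event M A e)) \<omega> =
          (\<Prod>e\<in>S. real_cond_exp M (latent_algebra M n \<xi>) (indicator (edge_event M A e)) \<omega>)"

section \<open>Local polynomial weights\<close>

definition poly_vec :: "nat \<Rightarrow> real \<Rightarrow> real Matrix.vec" where
  "poly_vec l u = Matrix.vec (Suc l) (\<lambda>i. u ^ i)"

definition lp_matrix ::
  "(real \<Rightarrow> real) \<Rightarrow> nat \<Rightarrow> nat \<Rightarrow> (nat \<Rightarrow> real) \<Rightarrow> real \<Rightarrow> real \<Rightarrow> real Matrix.mat" where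
  "lp_matrix K l m T h t = Matrix.mat (Suc l) (Suc l) (\<lambda>(i, j).
     1 / (real m * h) *
     (\<Sum>k=1..m. vec_index (poly_vec l ((T k - t) / h)) i * vec_index (poly_vec l ((T k - t) / h)) j *
        K ((T k - t) / h)))"

text \<open>The partial inverse \<open>mat_inverse\<close> is unspecified under \<open>the\<close> for singular matrices.\<close>

definition lp_weight ::
  "(real \<Rightarrow> real) \<Rightarrow> nat \<Rightarrow> nat \<Rightarrow> (nat \<Rightarrow> real) \<Rightarrow> real \<Rightarrow> real \<Rightarrow> nat \<Rightarrow> real" where
  "lp_weight K l m T h t k =
     1 / (real m * h) *
     scalar_prod (poly_vec l 0)
       (the (mat_inverse (lp_matrix K l m T h t)) *\<^sub>v poly_vec l ((T k - t) / h)) *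
     K ((T k - t) / h)"

text \<open>Only used for symmetric matrices, whose eigenvalues are all real.\<close>

definition min_eigenvalue :: "real Matrix.mat \<Rightarrow> real" where
  "min_eigenvalue B = Min {e. eigenvalue B e}"

definition LP1 ::
  "(real \<Rightarrow> real) \<Rightarrow> nat \<Rightarrow> real \<Rightarrow> nat \<Rightarrow> nat \<Rightarrow> (nat \<Rightarrow> real) \<Rightarrow> real \<Rightarrow> bool" where
  "LP1 K l lam0 m0 m T h \<longleftrightarrow>
     (m0 \<le> m \<longrightarrow> (\<forall>t\<in>{0..1}. lam0 \<le> min_eigenvalue (lp_matrix K l m T h t)))"

definition LP2 :: "real \<Rightarrow> (nat \<Rightarrow> nat \<Rightarrow> real) \<Rightarrow> bool" where
  "LP2 a0 T \<longleftrightarrow>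
     (\<forall>m\<ge>1. \<forall>I. is_interval I \<and> I \<subseteq> {0..1} \<longrightarrow>
        1 / real m * (\<Sum>k=1..m. indicator I (T m k)) \<le> a0 * max (measure lborel I) (1 / real m))"

definition LP3 :: "real \<Rightarrow> (real \<Rightarrow> real) \<Rightarrow> bool" where
  "LP3 Kmax K \<longleftrightarrow> (\<forall>u. u \<notin> {-1..1} \<longrightarrow> K u = 0) \<and> (\<forall>u. \<bar>K u\<bar> \<le> Kmax)"

section \<open>The estimators\<close>

text \<open>Local polynomial smoothing of the snapshots \<open>X 1, \<dots>, X m\<close>; used in the first and third stage.\<close>

definition lp_smooth ::
  "(real \<Rightarrow> real) \<Rightarrow> nat \<Rightarrow> nat \<Rightarrow> (nat \<Rightarrow> real) \<Rightarrow> real \<Rightarrow> (nat \<Rightarrow> nat \<Rightarrow> nat \<Rightarrow> real) \<Rightarrow>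
   real \<Rightarrow> nat \<Rightarrow> nat \<Rightarrow> real" where
  "lp_smooth K l m T h X t i j = (\<Sum>k=1..m. lp_weight K l m T h t k * X k i j)"

definition node_dist :: "nat \<Rightarrow> (nat \<Rightarrow> nat \<Rightarrow> real) \<Rightarrow> nat \<Rightarrow> nat \<Rightarrow> real" where
  "node_dist n P i i' =
     sqrt (Max ((\<lambda>l. \<bar>\<Sum>j=1..n. (P i j - P i' j) * P l j\<bar>) ` ({1..n} - {i, i'})) / real n)"

definition lower_quantile :: "nat \<Rightarrow> real \<Rightarrow> (nat \<Rightarrow> real) \<Rightarrow> real" where
  "lower_quantile n h d = Inf {x. h * real n \<le> real (card {k\<in>{1..n}. d k \<le> x})}"

text \<open>
  The second-stage bandwidth is an option: \<open>None\<close> encodes the choice of order \<open>1/n\<close>, by convention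
  the one that bypasses the neighborhood step.
\<close>

definition neighborhood ::
  "nat \<Rightarrow> real option \<Rightarrow> (nat \<Rightarrow> nat \<Rightarrow> real) \<Rightarrow> nat \<Rightarrow> nat set" where
  "neighborhood n h2 P i =
     (case h2 of
        None \<Rightarrow> {i}
      | Some h \<Rightarrow> {i'\<in>{1..n}. node_dist n P i i' \<le> lower_quantile n h (node_dist n P i)})"

definition two_stage_estimator ::
  "(real \<Rightarrow> real) \<Rightarrow> nat \<Rightarrow> nat \<Rightarrow> nat \<Rightarrow> (nat \<Rightarrow> real) \<Rightarrow> real \<Rightarrow> real option \<Rightarrow>
   (nat \<Rightarrow> nat \<Rightarrow> nat \<Rightarrow> real) \<Rightarrow> real \<Rightarrow> nat \<Rightarrow> nat \<Rightarrow> real" where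
  "two_stage_estimator K l n m T h1 h2 A t i j =
     (let P = lp_smooth K l m T h1 A t; N = neighborhood n h2 P i
      in (\<Sum>i'\<in>N. P i' j) / real (card N))"

definition three_stage_estimator ::
  "(real \<Rightarrow> real) \<Rightarrow> nat \<Rightarrow> nat \<Rightarrow> nat \<Rightarrow> (nat \<Rightarrow> real) \<Rightarrow> real \<Rightarrow> real option \<Rightarrow> real \<Rightarrow>
   (nat \<Rightarrow> nat \<Rightarrow> nat \<Rightarrow> real) \<Rightarrow> real \<Rightarrow> nat \<Rightarrow> nat \<Rightarrow> real" where
  "three_stage_estimator K l n m T h1 h2 h3 A =
     lp_smooth K l m T h3 (\<lambda>k. two_stage_estimator K l n m T h1 h2 A (T k))"

section \<open>Error and regimes\<close>

definition norm_2_inf :: "nat \<Rightarrow> (nat \<Rightarrow> nat \<Rightarrow> real) \<Rightarrow> real" where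
  "norm_2_inf n B = Max ((\<lambda>i. L2_set (B i) {1..n}) ` {1..n})"

text \<open>The supremum is taken in the extended reals, so that it is meaningful without boundedness.\<close>

definition sup_error ::
  "nat \<Rightarrow> (real \<Rightarrow> nat \<Rightarrow> nat \<Rightarrow> real) \<Rightarrow> (real \<Rightarrow> nat \<Rightarrow> nat \<Rightarrow> real) \<Rightarrow> ereal" where
  "sup_error n Q P =
     (SUP t\<in>{0..1}. ereal (1 / real n * (norm_2_inf n (\<lambda>i j. Q t i j - P t i j))\<^sup>2))"

text \<open>\<open>a \<asymp> b\<close> with explicit constants.\<close>

definition same_order :: "real \<Rightarrow> real \<Rightarrow> real \<Rightarrow> real \<Rightarrow> bool" where
  "same_order c c' a b \<longleftrightarrow> c * b \<le> a \<and> a \<le> c' * b"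

definition degree_threshold :: "real \<Rightarrow> nat \<Rightarrow> nat \<Rightarrow> real" where
  "degree_threshold \<beta> n m =
     sqrt (real n * real m powr (\<beta> / (\<beta> + 1)) * ln (real n * real m))"

end

theory Submission
  imports Defs
begin

text \<open>
  Positive definiteness of the design matrices makes the local polynomial weights a reproducing
  system of total mass \<open>O(1)\<close> with entries \<open>O(1/(m h))\<close>, so that the supremum over \<open>t\<close> in the third
  stage reduces deterministically to the error of the second stage at the \<open>m\<close> observation times.
  There the first-stage matrix is its conditional mean (the signal) plus noise that is a weighted sum
  of centred Bernoulli variables.  With \<open>L = ln (n m)\<close>, Bernstein's inequality controls every entry of
  the noise up to \<open>\<rho> h\<^sup>\<beta>\<close>, which settles the regime without neighborhoods.

  In the dense regime put \<open>h = (L/(\<rho>\<^sup>2 n m))\<^bsup>1/(2 \<beta> + 1)\<^esup>\<close> and \<open>R = \<rho>\<^sup>2 h\<^sup>\<beta>\<close>.  Density amounts to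
  \<open>L/n = O(R)\<close>, and then all inner products of a noise row with a signal row or with another noise
  row are \<open>O(n R)\<close>.  Hence the node distance recovers the inner products of signal rows up to
  \<open>O(n R)\<close>.  Since every latent position has many others close to it, rows at small node distance
  are close in \<open>L\<^sup>2\<close>, and averaging over the neighborhood divides the squared noise by its size.
\<close>

section \<open>The local polynomial weights\<close>

text \<open>Conditioning on the latent positions becomes finite arithmetic: the set \<open>a\<close>
  of present edges takes finitely many values with explicit product weights, so every tail bound
  concerns the finite sum \<open>bern_ex\<close>. For fixed \<open>a\<close> the estimator,
  data-driven neighborhoods included, is deterministic; only the edge probabilities still depend on
  the sample point.

  The delicate quantity is the inner product of two noise rows. By symmetry rows \<open>i\<close>
  and \<open>l\<close> share the edge between them, and a product of a row with itself can be much
  larger than a mixed one. So products are bounded for \<open>i \<noteq> l\<close>, given a bound on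
  the energy of row \<open>l\<close>, and the diagonal is paid for by the size of the neighborhood.
  The node distance in turn leaves out \<open>l = i\<close> and \<open>l = i'\<close>; to reach the
  squared distance of two signal rows, such an \<open>l\<close> is replaced by another node of its
  cell.

  Density absorbs the errors that do not shrink with the bandwidth: the two shared entries and the
  fluctuation of the row energy. It also gives cells of width of order \<rho> h^\<beta> enough nodes
  for a union bound over all cells.\<close>

lemma linear_coeff_zero:
  fixes a g :: real
  assumes "\<And>s. 0 \<le> 2 * s * a + s\<^sup>2 * g"
  shows "a = 0"
proof (rule ccontr)
  assume a: "a \<noteq> 0"
  \<comment> \<open>Minimising the quadratic would ask for \<open>s = - a / g\<close>. The larger
    positive number \<open>\<bar>g\<bar> + 1\<close> avoids a case distinction on the sign of
    \<open>g\<close>, and the quadratic term then cancels half of the linear one.\<close>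
  define s where "s = - a / (\<bar>g\<bar> + 1)"
  have p: "\<bar>g\<bar> + 1 > 0" by linarith
  have sa: "s * (\<bar>g\<bar> + 1) = - a" using p by (simp add: s_def)
  have "0 \<le> (2 * s * a + s\<^sup>2 * g)" by (rule assms)
  also have "\<dots> \<le> 2 * s * a + s\<^sup>2 * (\<bar>g\<bar> + 1)" by (simp add: mult_left_mono)
  also have "\<dots> = 2 * s * a + s * (s * (\<bar>g\<bar> + 1))" by (simp add: power2_eq_square)
  also have "\<dots> = s * a" unfolding sa by simp
  also have "\<dots> = - (a\<^sup>2 / (\<bar>g\<bar> + 1))" by (simp add: s_def power2_eq_square)
  also have "\<dots> < 0" using a p by (simp add: divide_pos_pos)
  finally show False by simp
qed

lemma sum_mult_delta:
  fixes a :: "nat \<Rightarrow> real"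
  assumes "k < d"
  shows "(\<Sum>j<d. a j * (if j = k then s else 0)) = a k * s"
proof -
  have "(\<Sum>j<d. a j * (if j = k then s else 0)) = (\<Sum>j<d. if j = k then a j * s else 0)"
    by (rule sum.cong) auto
  then show ?thesis using assms by simp
qed

text \<open>A minimiser of the quadratic form on the unit sphere is an eigenvector for the minimal
  value. \<open>LP1\<close> speaks of eigenvalues, whereas the weights need a lower bound of the
  form. One eigenvalue that bounds the form from below leads from the former to the latter, without
  a spectral decomposition.\<close>

lemma symmetric_min_eigenvector:
  fixes b :: "nat \<Rightarrow> nat \<Rightarrow> real"
  assumes d: "0 < d" and sym: "\<And>i j. i < d \<Longrightarrow> j < d \<Longrightarrow> b i j = b j i"
  shows "\<exists>\<mu> v. (\<exists>i<d. v i \<noteq> 0) \<and> (\<forall>i<d. (\<Sum>j<d. b i j * v j) = \<mu> * v i) \<and>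
    (\<forall>w. \<mu> * (\<Sum>i<d. (w i)\<^sup>2) \<le> (\<Sum>i<d. \<Sum>j<d. b i j * w i * w j))"
proof -
  define q :: "(nat \<Rightarrow> real) \<Rightarrow> real" where "q = (\<lambda>w. \<Sum>i<d. \<Sum>j<d. b i j * w i * w j)"
  define nn :: "(nat \<Rightarrow> real) \<Rightarrow> real" where "nn = (\<lambda>w. \<Sum>i<d. (w i)\<^sup>2)"
  \<comment> \<open>The dimension is a variable, so the sphere is placed in
    \<open>nat \<Rightarrow> real\<close> with the product topology. Freezing the coordinates from
    \<open>d\<close> on at 0 makes the box compact by Tychonoff's theorem, and every unit vector,
    extended by zeros, lies in it.\<close>
  define box :: "(nat \<Rightarrow> real) set" where "box = PiE UNIV (\<lambda>i. if i < d then {-1..1} else {0})"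
  have "compactin (product_topology (\<lambda>i. euclidean) UNIV) box"
    unfolding box_def by (subst compactin_PiE) auto
  then have cbox: "compact box"
    by (simp add: euclidean_product_topology)
  have cq: "continuous_on UNIV q" unfolding q_def by (intro continuous_intros) auto
  have cn: "continuous_on UNIV nn" unfolding nn_def by (intro continuous_intros) auto
  have "closed {v. nn v = 1}"
    by (rule closed_Collect_eq[OF cn]) simp
  then have cS: "compact (box \<inter> {v. nn v = 1})" by (rule compact_Int_closed[OF cbox])
  have ne: "x \<in> X \<Longrightarrow> X \<noteq> {}" for x and X :: "(nat \<Rightarrow> real) set" by auto
  have n0: "nn (\<lambda>i. if i = 0 then 1 else 0) = 1"
    using sum_mult_delta[OF d, of "\<lambda>i. if i = 0 then 1 else 0" 1]
    by (simp add: nn_def power2_eq_square)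
  have "(\<lambda>i. if i = 0 then 1 else 0) \<in> box \<inter> {v. nn v = 1}"
    using n0 d by (auto simp: box_def)
  then have "box \<inter> {v. nn v = 1} \<noteq> {}" by (rule ne)
  from continuous_attains_inf[OF cS this continuous_on_subset[OF cq subset_UNIV]]
  obtain v where "v \<in> box \<inter> {v. nn v = 1}" "\<forall>w\<in>box \<inter> {v. nn v = 1}. q v \<le> q w"
    by (elim bexE)
  then have v: "v \<in> box" "nn v = 1"
    and vmin: "\<And>w. w \<in> box \<Longrightarrow> nn w = 1 \<Longrightarrow> q v \<le> q w"
    by auto
  define \<mu> where "\<mu> = q v"
  have lower: "\<mu> * nn w \<le> q w" for w
  proof (cases "nn w = 0")
    case True
    then have "\<forall>i<d. w i = 0" by (auto simp: nn_def sum_nonneg_eq_0_iff)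
    then show ?thesis using True by (simp add: q_def)
  next
    case False
    then have pos: "nn w > 0" using sum_nonneg[of "{..<d}" "\<lambda>i. (w i)\<^sup>2"] by (simp add: nn_def)
    define r where "r = sqrt (nn w)"
    have r: "r > 0" "r\<^sup>2 = nn w" using pos by (auto simp: r_def)
    define u where "u = (\<lambda>i. if i < d then w i / r else 0)"
    have "nn u = nn w / r\<^sup>2"
      by (simp add: nn_def u_def power_divide sum_divide_distrib)
    then have nu: "nn u = 1" using r pos by simp
    have le: "\<bar>u i\<bar> \<le> 1" if "i < d" for i
    proof -
      have "(u i)\<^sup>2 \<le> nn u" unfolding nn_def by (rule member_le_sum) (use that in auto)
      then show ?thesis using nu by (simp add: abs_square_le_1)
    qed
    have "u i \<in> (if i < d then {-1..1} else {0})" for i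
      using le[of i, unfolded abs_le_iff] by (cases "i < d") (auto simp: u_def)
    then have "u \<in> box" unfolding box_def by (intro PiE_I) auto
    then have "\<mu> \<le> q u" using vmin nu by (simp add: \<mu>_def)
    also have "q u = q w / r\<^sup>2"
      by (simp add: q_def u_def sum_divide_distrib power2_eq_square)
    finally show ?thesis using r pos by (simp add: field_simps)
  qed
  \<comment> \<open>\<open>c\<close> is \<open>b\<close> minus \<open>\<mu>\<close> times the
    identity: its form is nonnegative everywhere and zero at \<open>v\<close>. Perturbing
    \<open>v\<close> along the \<open>k\<close>-th coordinate thus has vanishing first-order term,
    and this term is twice the \<open>k\<close>-th entry of \<open>c\<close> applied to
    \<open>v\<close>.\<close>
  define c where "c = (\<lambda>i j. b i j - (if i = j then \<mu> else 0))"
  have cv: "(\<Sum>j<d. c i j * w j) = (\<Sum>j<d. b i j * w j) - \<mu> * w i" if "i < d" for i w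
  proof -
    have "(\<Sum>j<d. c i j * w j) = (\<Sum>j<d. b i j * w j) - (\<Sum>j<d. w j * (if j = i then \<mu> else 0))"
      unfolding sum_subtractf[symmetric] by (rule sum.cong) (auto simp: c_def algebra_simps)
    then show ?thesis using sum_mult_delta[OF that, of w \<mu>] by simp
  qed
  have g: "(\<Sum>i<d. \<Sum>j<d. c i j * w i * w j) = q w - \<mu> * nn w" for w
  proof -
    have "(\<Sum>i<d. \<Sum>j<d. c i j * w i * w j) = (\<Sum>i<d. w i * (\<Sum>j<d. c i j * w j))"
      by (simp add: sum_distrib_left mult_ac)
    also have "\<dots> = (\<Sum>i<d. w i * ((\<Sum>j<d. b i j * w j) - \<mu> * w i))"
      by (simp add: cv)
    also have "\<dots> = q w - \<mu> * nn w"
      by (simp add: q_def nn_def right_diff_distrib sum_subtractf sum_distrib_left power2_eq_square mult_ac)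
    finally show ?thesis .
  qed
  have eig: "(\<Sum>j<d. b k j * v j) = \<mu> * v k" if k: "k < d" for k
  proof -
    have "0 \<le> 2 * s * (\<Sum>j<d. c k j * v j) + s\<^sup>2 * c k k" for s
    proof -
      define e where "e = (\<lambda>i. if i = k then s else 0)"
      have "0 \<le> (\<Sum>i<d. \<Sum>j<d. c i j * (v i + e i) * (v j + e j))"
        using lower[of "\<lambda>i. v i + e i"] g[of "\<lambda>i. v i + e i"] by simp
      also have "\<dots> = (\<Sum>i<d. \<Sum>j<d. c i j * v i * v j) + (\<Sum>i<d. \<Sum>j<d. c i j * v i * e j)
         + (\<Sum>i<d. \<Sum>j<d. c i j * e i * v j) + (\<Sum>i<d. \<Sum>j<d. c i j * e i * e j)"
        by (simp add: algebra_simps sum.distrib)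
      also have "(\<Sum>i<d. \<Sum>j<d. c i j * v i * v j) = 0"
        using g[of v] v by (simp add: \<mu>_def)
      also have "(\<Sum>i<d. \<Sum>j<d. c i j * v i * e j) = (\<Sum>i<d. c i k * v i * s)"
        unfolding e_def by (simp only: sum_mult_delta[OF k])
      also have "\<dots> = s * (\<Sum>i<d. c k i * v i)"
        using k sym by (auto simp: sum_distrib_left c_def algebra_simps intro!: sum.cong)
      also have "(\<Sum>i<d. \<Sum>j<d. c i j * e i * v j) = (\<Sum>j<d. \<Sum>i<d. c i j * v j * e i)"
        by (subst sum.swap) (simp add: mult_ac)
      also have "\<dots> = s * (\<Sum>i<d. c k i * v i)"
        unfolding e_def by (simp only: sum_mult_delta[OF k]) (simp add: sum_distrib_left mult_ac)
      also have "(\<Sum>i<d. \<Sum>j<d. c i j * e i * e j) = (\<Sum>i<d. c i k * e i * s)"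
        unfolding e_def by (simp only: sum_mult_delta[OF k])
      also have "\<dots> = (\<Sum>i<d. c i k * s * e i)" by (simp add: mult_ac)
      also have "\<dots> = s\<^sup>2 * c k k"
        unfolding e_def by (simp only: sum_mult_delta[OF k]) (simp add: power2_eq_square)
      finally show ?thesis by (simp add: algebra_simps)
    qed
    then have "(\<Sum>j<d. c k j * v j) = 0" by (rule linear_coeff_zero)
    then show ?thesis using cv[OF k, of v] by simp
  qed
  have "\<exists>i<d. v i \<noteq> 0"
  proof (rule ccontr)
    assume "\<not> ?thesis"
    then have "nn v = 0" by (simp add: nn_def)
    then show False using v by simp
  qed
  then show ?thesis using eig lower[unfolded q_def nn_def]
    by (intro exI[of _ \<mu>] exI[of _ v] conjI) auto
qed

lemma lp_matrix_carrier: "lp_matrix K l m T h t \<in> carrier_mat (Suc l) (Suc l)"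
  by (simp add: lp_matrix_def)

lemma lp_matrix_index:
  assumes "i < Suc l" "j < Suc l"
  shows "lp_matrix K l m T h t $$ (i, j) =
    1 / (real m * h) * (\<Sum>k=1..m. ((T k - t) / h) ^ i * ((T k - t) / h) ^ j * K ((T k - t) / h))"
  using assms by (simp add: lp_matrix_def poly_vec_def)

text \<open>\<open>min_eigenvalue\<close> is a \<open>Min\<close>, which is informative because the
  spectrum is the finite root set of the characteristic polynomial. The eigenvalue obtained by
  minimisation belongs to this set and is therefore at least \<open>lam0\<close>.\<close>

lemma lp_matrix_rayleigh:
  assumes LP1: "LP1 K l lam0 m0 m T h" and m: "m0 \<le> m" and t: "t \<in> {0..1}"
  shows "lam0 * (\<Sum>i<Suc l. (w i)\<^sup>2) \<le>
    (\<Sum>i<Suc l. \<Sum>j<Suc l. lp_matrix K l m T h t $$ (i, j) * w i * w j)"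
proof -
  define B where "B = lp_matrix K l m T h t"
  have B: "B \<in> carrier_mat (Suc l) (Suc l)" by (simp add: B_def lp_matrix_carrier)
  have sym: "B $$ (i, j) = B $$ (j, i)" if "i < Suc l" "j < Suc l" for i j
    using that by (simp add: B_def lp_matrix_index mult_ac)
  obtain \<mu> v where v: "\<exists>i<Suc l. v i \<noteq> 0" "\<forall>i<Suc l. (\<Sum>j<Suc l. B $$ (i, j) * v j) = \<mu> * v i"
    and low: "\<And>w. \<mu> * (\<Sum>i<Suc l. (w i)\<^sup>2) \<le> (\<Sum>i<Suc l. \<Sum>j<Suc l. B $$ (i, j) * w i * w j)"
    using symmetric_min_eigenvector[of "Suc l" "\<lambda>i j. B $$ (i, j)", OF _ sym] by auto
  define x where "x = Matrix.vec (Suc l) v"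
  have "eigenvector B x \<mu>"
    unfolding eigenvector_def
  proof (intro conjI)
    show "x \<in> carrier_vec (dim_row B)" using B by (simp add: x_def)
    show "x \<noteq> 0\<^sub>v (dim_row B)"
    proof
      assume "x = 0\<^sub>v (dim_row B)"
      then have "vec_index x i = 0" if "i < Suc l" for i using B that by simp
      then show False using v(1) by (auto simp: x_def)
    qed
    show "B *\<^sub>v x = \<mu> \<cdot>\<^sub>v x"
    proof (rule eq_vecI)
      fix i assume "i < dim_vec (\<mu> \<cdot>\<^sub>v x)"
      then have i: "i < Suc l" by (simp add: x_def)
      have "vec_index (B *\<^sub>v x) i = (\<Sum>j<Suc l. B $$ (i, j) * v j)"
        using i B by (simp add: scalar_prod_def x_def atLeast0LessThan del: sum.lessThan_Suc)
      also have "\<dots> = \<mu> * v i" using v(2) i by simp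
      finally show "vec_index (B *\<^sub>v x) i = vec_index (\<mu> \<cdot>\<^sub>v x) i" using i by (simp add: x_def)
    qed (use B in \<open>simp add: x_def\<close>)
  qed
  then have ev: "eigenvalue B \<mu>" by (auto simp: eigenvalue_def)
  have "char_poly B \<noteq> 0" using degree_monic_char_poly[OF B] by auto
  then have "finite {e. eigenvalue B e}"
    by (simp add: eigenvalue_root_char_poly[OF B] poly_roots_finite)
  then have "min_eigenvalue B \<le> \<mu>" unfolding min_eigenvalue_def using ev by simp
  moreover have "lam0 \<le> min_eigenvalue B" using LP1 m t by (simp add: LP1_def B_def)
  ultimately have "lam0 * (\<Sum>i<Suc l. (w i)\<^sup>2) \<le> \<mu> * (\<Sum>i<Suc l. (w i)\<^sup>2)"
    by (intro mult_right_mono sum_nonneg) auto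
  with low[of w] show ?thesis unfolding B_def by linarith
qed

text \<open>A kernel vector would annihilate the quadratic form, against its positive lower bound.
  This gives \<open>the (mat_inverse B)\<close> in the weights its meaning.\<close>

lemma lp_matrix_inverse:
  assumes LP1: "LP1 K l lam0 m0 m T h" and m: "m0 \<le> m" and t: "t \<in> {0..1}" and lam0: "0 < lam0"
  defines "B \<equiv> lp_matrix K l m T h t"
  shows "B * the (mat_inverse B) = 1\<^sub>m (Suc l)" "the (mat_inverse B) * B = 1\<^sub>m (Suc l)"
    "the (mat_inverse B) \<in> carrier_mat (Suc l) (Suc l)"
proof -
  have B: "B \<in> carrier_mat (Suc l) (Suc l)" by (simp add: B_def lp_matrix_carrier)
  have "det B \<noteq> 0"
  proof
    assume "det B = 0"
    then obtain v where v: "v \<in> carrier_vec (Suc l)" "v \<noteq> 0\<^sub>v (Suc l)" "B *\<^sub>v v = 0\<^sub>v (Suc l)"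
      using det_0_iff_vec_prod_zero[OF B] by blast
    have z: "(\<Sum>j<Suc l. B $$ (i, j) * vec_index v j) = 0" if i: "i < Suc l" for i
    proof -
      have "vec_index (B *\<^sub>v v) i = (\<Sum>j<Suc l. B $$ (i, j) * vec_index v j)"
        using i B v(1) by (simp add: scalar_prod_def atLeast0LessThan del: sum.lessThan_Suc)
      then show ?thesis using v(3) i by simp
    qed
    have "lam0 * (\<Sum>i<Suc l. (vec_index v i)\<^sup>2) \<le>
      (\<Sum>i<Suc l. \<Sum>j<Suc l. B $$ (i, j) * vec_index v i * vec_index v j)"
      unfolding B_def by (rule lp_matrix_rayleigh[OF LP1 m t])
    also have "\<dots> = (\<Sum>i<Suc l. vec_index v i * (\<Sum>j<Suc l. B $$ (i, j) * vec_index v j))"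
      by (simp only: sum_distrib_left mult_ac)
    also have "\<dots> = 0" using z by (intro sum.neutral) auto
    finally have "(\<Sum>i<Suc l. (vec_index v i)\<^sup>2) \<le> 0" using lam0 by (simp add: mult_le_0_iff)
    then have "(\<Sum>i<Suc l. (vec_index v i)\<^sup>2) = 0" by (meson order_antisym sum_nonneg zero_le_power2)
    then have "\<forall>i<Suc l. vec_index v i = 0"
        by (simp only: sum_nonneg_eq_0_iff finite_lessThan zero_le_power2 power_eq_0_iff) auto
    then have "v = 0\<^sub>v (Suc l)" using v(1) by (intro eq_vecI) auto
    with v(2) show False by simp
  qed
  then have "B \<in> Units (ring_mat TYPE(real) (Suc l) ())" by (rule det_non_zero_imp_unit[OF B])
  then have "mat_inverse B \<noteq> None" using mat_inverse(1)[OF B, where b = "()"] by blast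
  then obtain C where "mat_inverse B = Some C" by auto
  with mat_inverse(2)[OF B this]
  show "B * the (mat_inverse B) = 1\<^sub>m (Suc l)" "the (mat_inverse B) * B = 1\<^sub>m (Suc l)"
    "the (mat_inverse B) \<in> carrier_mat (Suc l) (Suc l)" by auto
qed

lemma lp_weight_eq:
  assumes C: "the (mat_inverse (lp_matrix K l m T h t)) \<in> carrier_mat (Suc l) (Suc l)"
  shows "lp_weight K l m T h t k = 1 / (real m * h) *
    (\<Sum>i<Suc l. the (mat_inverse (lp_matrix K l m T h t)) $$ (0, i) * ((T k - t) / h) ^ i) *
    K ((T k - t) / h)"
proof -
  define C' where "C' = the (mat_inverse (lp_matrix K l m T h t))"
  define y where "y = C' *\<^sub>v poly_vec l ((T k - t) / h)"
  have C': "C' \<in> carrier_mat (Suc l) (Suc l)" using C by (simp add: C'_def)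
  have "scalar_prod (poly_vec l 0) y = (\<Sum>i<Suc l. vec_index y i * (if i = 0 then 1 else 0))"
    using C' by (simp add: scalar_prod_def y_def poly_vec_def atLeast0LessThan power_0_left mult.commute
        del: sum.lessThan_Suc cong: if_cong)
  also have "\<dots> = vec_index y 0" using sum_mult_delta[of 0 "Suc l" "vec_index y" 1] by simp
  also have "\<dots> = (\<Sum>i<Suc l. C' $$ (0, i) * ((T k - t) / h) ^ i)"
    using C' by (simp add: y_def scalar_prod_def poly_vec_def atLeast0LessThan del: sum.lessThan_Suc)
  finally show ?thesis unfolding lp_weight_def C'_def y_def by simp
qed

text \<open>This is row 0 of the identity "inverse times design matrix": averaging the
  \<open>j\<close>-th power against the weights rebuilds the \<open>j\<close>-th column of the
  design matrix. Hence smoothing reproduces the value at \<open>t\<close> of every polynomial of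
  degree at most \<open>l\<close>.\<close>

lemma lp_weight_moment:
  assumes "LP1 K l lam0 m0 m T h" "m0 \<le> m" "t \<in> {0..1}" "0 < lam0" and j: "j \<le> l"
  shows "(\<Sum>k=1..m. lp_weight K l m T h t k * ((T k - t) / h) ^ j) = (if j = 0 then 1 else 0)"
proof -
  define B where "B = lp_matrix K l m T h t"
  define C where "C = the (mat_inverse B)"
  note inv = lp_matrix_inverse[OF assms(1-4), folded B_def, folded C_def]
  have B: "B \<in> carrier_mat (Suc l) (Suc l)" by (simp add: B_def lp_matrix_carrier)
  have "(\<Sum>k=1..m. lp_weight K l m T h t k * ((T k - t) / h) ^ j) =
     (\<Sum>k=1..m. \<Sum>i<Suc l. C $$ (0, i) * (1 / (real m * h) *
        (((T k - t) / h) ^ i * ((T k - t) / h) ^ j * K ((T k - t) / h))))"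
    by (simp only: lp_weight_eq[OF inv(3)[unfolded C_def B_def], folded B_def, folded C_def]
        sum_distrib_left sum_distrib_right mult_ac)
  also have "\<dots> = (\<Sum>i<Suc l. C $$ (0, i) * (1 / (real m * h) *
     (\<Sum>k=1..m. ((T k - t) / h) ^ i * ((T k - t) / h) ^ j * K ((T k - t) / h))))"
    by (subst sum.swap) (simp only: sum_distrib_left)
  also have "\<dots> = (\<Sum>i<Suc l. C $$ (0, i) * B $$ (i, j))"
    unfolding B_def using j by (intro sum.cong refl, subst lp_matrix_index) auto
  also have "\<dots> = (C * B) $$ (0, j)"
    using B inv(3) j by (simp add: scalar_prod_def atLeast0LessThan del: sum.lessThan_Suc)
  also have "\<dots> = (if j = 0 then 1 else 0)" unfolding inv(2) using j by auto
  finally show ?thesis .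
qed

text \<open>Let \<open>x\<close> be the inverse matrix applied to the vector U of powers of
  \<open>u\<close>. Positive definiteness and Cauchy-Schwarz give
  \<open>lam0 |x|^2 \<le> |x| |U|\<close>, and |U|^2 is at most \<open>l + 1\<close> when
  \<open>\<bar>u\<bar> \<le> 1\<close>; for other \<open>u\<close> the kernel vanishes.\<close>

lemma lp_weight_bound:
  assumes "LP1 K l lam0 m0 m T h" "m0 \<le> m" "t \<in> {0..1}" "0 < lam0" and K: "LP3 Kmax K" and h: "0 < h"
  shows "\<bar>lp_weight K l m T h t k\<bar> \<le> Kmax * real (Suc l) / lam0 / (real m * h)"
proof -
  define B where "B = lp_matrix K l m T h t"
  define C where "C = the (mat_inverse B)"
  define u where "u = (T k - t) / h"
  define x where "x = (\<lambda>i. \<Sum>j<Suc l. C $$ (i, j) * u ^ j)"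
  note inv = lp_matrix_inverse[OF assms(1-4), folded B_def, folded C_def]
  have B: "B \<in> carrier_mat (Suc l) (Suc l)" by (simp add: B_def lp_matrix_carrier)
  have Kmax: "0 \<le> Kmax" "\<bar>K u\<bar> \<le> Kmax" using K abs_ge_zero[of "K u"] order_trans unfolding LP3_def by blast+
  have w: "lp_weight K l m T h t k = 1 / (real m * h) * x 0 * K u"
    unfolding lp_weight_eq[OF inv(3)[unfolded C_def B_def], folded B_def, folded C_def] x_def u_def by simp
  show ?thesis
  proof (cases "\<bar>u\<bar> \<le> 1")
    case False
    then have "K u = 0" using K by (auto simp: LP3_def abs_le_iff)
    then show ?thesis using w Kmax assms(4) h by simp
  next
    case True
    define s where "s = (\<Sum>i<Suc l. (x i)\<^sup>2)"
    have Bx: "(\<Sum>j<Suc l. B $$ (i, j) * x j) = u ^ i" if i: "i < Suc l" for i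
    proof -
      have "(\<Sum>j<Suc l. B $$ (i, j) * x j) = (\<Sum>j'<Suc l. (\<Sum>j<Suc l. B $$ (i, j) * C $$ (j, j')) * u ^ j')"
        unfolding x_def sum_distrib_left sum_distrib_right by (subst sum.swap) (simp only: mult_ac)
      also have "\<dots> = (\<Sum>j'<Suc l. (B * C) $$ (i, j') * u ^ j')"
        using B inv(3) i by (simp add: scalar_prod_def atLeast0LessThan del: sum.lessThan_Suc)
      also have "\<dots> = (\<Sum>j'<Suc l. u ^ j' * (if j' = i then 1 else 0))"
        unfolding inv(1) using i by (intro sum.cong) auto
      also have "\<dots> = u ^ i" using sum_mult_delta[OF i, of "(^) u" 1] by simp
      finally show ?thesis .
    qed
    have "lam0 * s \<le> (\<Sum>i<Suc l. \<Sum>j<Suc l. B $$ (i, j) * x i * x j)"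
      unfolding s_def B_def by (rule lp_matrix_rayleigh[OF assms(1-3)])
    also have "\<dots> = (\<Sum>i<Suc l. x i * (\<Sum>j<Suc l. B $$ (i, j) * x j))"
      by (simp only: sum_distrib_left mult_ac)
    also have "\<dots> = (\<Sum>i<Suc l. x i * u ^ i)" using Bx by (intro sum.cong) auto
    finally have 1: "lam0 * s \<le> (\<Sum>i<Suc l. x i * u ^ i)" .
    have s0: "0 \<le> s" unfolding s_def by (intro sum_nonneg) simp
    have "(lam0 * s)\<^sup>2 \<le> (\<Sum>i<Suc l. x i * u ^ i)\<^sup>2"
      by (rule power_mono[OF 1]) (use s0 assms(4) in simp)
    also have "\<dots> \<le> s * (\<Sum>i<Suc l. (u ^ i)\<^sup>2)"
      unfolding s_def by (rule Cauchy_Schwarz_ineq_sum)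
    also have "(\<Sum>i<Suc l. (u ^ i)\<^sup>2) \<le> (\<Sum>i<Suc l. 1)"
      by (rule sum_mono) (use True in \<open>simp add: power_le_one abs_square_le_1 power_abs\<close>)
    finally have 2: "(lam0 * s)\<^sup>2 \<le> s * real (Suc l)" using s0 by (simp add: mult_left_mono)
    have 3: "lam0\<^sup>2 * s \<le> (real (Suc l))\<^sup>2"
    proof (cases "s = 0")
      case False
      then have "s * (lam0\<^sup>2 * s) \<le> s * real (Suc l)" using 2 by (simp add: power2_eq_square mult_ac)
      then have "lam0\<^sup>2 * s \<le> real (Suc l)" using False s0 by simp
      also have "\<dots> \<le> (real (Suc l))\<^sup>2" by (simp add: power2_eq_square)
      finally show ?thesis .
    qed simp
    have "(x 0)\<^sup>2 \<le> s" unfolding s_def by (rule member_le_sum) auto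
    then have "(lam0 * x 0)\<^sup>2 \<le> lam0\<^sup>2 * s" by (simp add: power_mult_distrib mult_left_mono)
    with 3 have "(lam0 * x 0)\<^sup>2 \<le> (real (Suc l))\<^sup>2" by linarith
    then have "\<bar>lam0 * x 0\<bar> \<le> real (Suc l)" unfolding abs_le_square_iff[symmetric] abs_of_nat .
    then have x0: "\<bar>x 0\<bar> \<le> real (Suc l) / lam0" using assms(4) by (simp add: abs_mult field_simps)
    have "\<bar>lp_weight K l m T h t k\<bar> = 1 / (real m * h) * (\<bar>x 0\<bar> * \<bar>K u\<bar>)"
      using h by (simp add: w abs_mult)
    also have "\<dots> \<le> 1 / (real m * h) * (real (Suc l) / lam0 * Kmax)"
      using h x0 Kmax assms(4) by (intro mult_left_mono mult_mono) auto
    finally show ?thesis by (simp add: mult_ac)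
  qed
qed

lemma lp_weight_support:
  assumes "LP3 Kmax K" "0 < h" "h < \<bar>T k - t\<bar>"
  shows "lp_weight K l m T h t k = 0"
proof -
  have "1 < \<bar>(T k - t) / h\<bar>" using assms by simp
  then have "(T k - t) / h \<notin> {-1..1}" by (simp only: atLeastAtMost_iff abs_le_iff) linarith
  then have "K ((T k - t) / h) = 0" using assms(1) unfolding LP3_def by blast
  then show ?thesis by (simp add: lp_weight_def)
qed

text \<open>Otherwise all weights vanish, although the moment of order 0 says that they sum to
  one.\<close>

lemma lp_window_nonempty:
  assumes "LP1 K l lam0 m0 m T h" "m0 \<le> m" "t \<in> {0..1}" "0 < lam0" "LP3 Kmax K" "0 < h"
  shows "\<exists>k\<in>{1..m}. \<bar>T k - t\<bar> \<le> h"
proof (rule ccontr)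
  assume a: "\<not> ?thesis"
  then have "(\<Sum>k=1..m. lp_weight K l m T h t k * ((T k - t) / h) ^ 0) = 0"
    using lp_weight_support[OF assms(5,6)] by (intro sum.neutral) force
  then show False using lp_weight_moment[OF assms(1-4), of 0] by simp
qed

text \<open>Testing positive definiteness on the first unit vector leaves the entry
  \<open>(0, 0)\<close>, which is at most \<open>Kmax / h\<close>. In the regime without
  neighborhoods this is what keeps the bandwidth bounded.\<close>

lemma lp_bandwidth_le:
  assumes "LP1 K l lam0 m0 m T h" "m0 \<le> m" "0 < m" "0 < lam0" "LP3 Kmax K" "0 < h"
  shows "h \<le> Kmax / lam0"
proof -
  have "lam0 * (\<Sum>i<Suc l. (if i = 0 then 1 else 0)\<^sup>2) \<le>
    (\<Sum>i<Suc l. \<Sum>j<Suc l. lp_matrix K l m T h 0 $$ (i, j) * (if i = 0 then 1 else 0) * (if j = 0 then 1 else 0))"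
    by (rule lp_matrix_rayleigh[OF assms(1,2)]) simp
  also have "(\<Sum>i<Suc l. \<Sum>j<Suc l. lp_matrix K l m T h 0 $$ (i, j) * (if i = 0 then 1 else 0) * (if j =
      0 then 1 else 0)) = lp_matrix K l m T h 0 $$ (0, 0)"
    by (simp only: sum_mult_delta[of 0 "Suc l"] zero_less_Suc mult_1_right)
  also have "(\<Sum>i<Suc l. (if i = 0 then 1 else 0::real)\<^sup>2) = 1"
    using sum_mult_delta[of 0 "Suc l" "\<lambda>i. if i = 0 then 1 else 0" 1]
    by (simp add: power2_eq_square del: sum.lessThan_Suc)
  also have "lp_matrix K l m T h 0 $$ (0, 0) = 1 / (real m * h) * (\<Sum>k=1..m. K ((T k - 0) / h))"
    by (subst lp_matrix_index) auto
  also have "\<dots> \<le> 1 / (real m * h) * (\<Sum>k=1..m. Kmax)"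
    using assms(5,6) by (intro mult_left_mono sum_mono) (auto simp: LP3_def abs_le_iff)
  also have "\<dots> = Kmax / h" using assms(3) by simp
  finally show ?thesis using assms(4,6) by (simp add: field_simps)
qed

lemma fmeasurable_lborel_Icc: "{a..b::real} \<in> fmeasurable lborel"
  by (simp add: fmeasurable_def emeasure_lborel_Icc_eq)

text \<open>Every \<open>t\<close> has an observation within \<open>h\<close>, so \<open>m\<close>
  intervals of length \<open>2 * h\<close> cover the unit interval. Consequently the
  \<open>1 / m\<close> in \<open>LP2\<close> is at most the window length
  \<open>2 * h\<close>.\<close>

lemma lp_bandwidth_ge:
  assumes "LP1 K l lam0 m0 m T h" "m0 \<le> m" "0 < lam0" "LP3 Kmax K" "0 < h"
  shows "1 \<le> 2 * (real m * h)"
proof -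
  have "{0..1} \<subseteq> (\<Union>k\<in>{1..m}. {T k - h..T k + h})"
  proof
    fix t :: real assume "t \<in> {0..1}"
    from lp_window_nonempty[OF assms(1,2) this assms(3-5)]
    obtain k where "k \<in> {1..m}" "\<bar>T k - t\<bar> \<le> h" by blast
    then show "t \<in> (\<Union>k\<in>{1..m}. {T k - h..T k + h})" by (intro UN_I[of k]) auto
  qed
  moreover have "(\<Union>k\<in>{1..m}. {T k - h..T k + h}) \<in> fmeasurable lborel"
    by (intro fmeasurable.finite_UN) (auto intro: fmeasurable_lborel_Icc)
  ultimately have "measure lborel {0..1::real} \<le> measure lborel (\<Union>k\<in>{1..m}. {T k - h..T k + h})"
    by (intro measure_mono_fmeasurable) auto
  also have "\<dots> \<le> (\<Sum>k\<in>{1..m}. measure lborel {T k - h..T k + h})"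
    by (intro measure_UNION_le) auto
  also have "\<dots> = 2 * (real m * h)" using assms(5) by simp
  finally show ?thesis by simp
qed

text \<open>The window around \<open>t\<close> contains at most \<open>2 * a0 * (m * h)\<close>
  observation times, and each of them has a weight of order \<open>1 / (m * h)\<close>.\<close>

lemma lp_weight_sum_bound:
  assumes "LP1 K l lam0 m0 m (T m) h" "m0 \<le> m" "t \<in> {0..1}" "0 < lam0" "LP3 Kmax K" "0 < h" "0 < m"
    and LP2: "LP2 a0 T" "0 < a0" and T: "\<And>k. k \<in> {1..m} \<Longrightarrow> T m k \<in> {0..1}"
  shows "(\<Sum>k=1..m. \<bar>lp_weight K l m (T m) h t k\<bar>) \<le> 2 * a0 * (Kmax * real (Suc l) / lam0)"
proof -
  define c where "c = Kmax * real (Suc l) / lam0"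
  \<comment> \<open>\<open>LP2\<close> counts only in subintervals of the unit interval; the
    intersection loses nothing because the observation times lie there.\<close>
  define I where "I = {t - h..t + h} \<inter> {0..1}"
  have "0 \<le> Kmax" using assms(5) order_trans[OF abs_ge_zero] unfolding LP3_def by blast
  then have c0: "0 \<le> c" using assms(4) by (simp add: c_def)
  have mh: "1 \<le> 2 * (real m * h)" by (rule lp_bandwidth_ge[OF assms(1,2,4-6)])
  have I: "is_interval I" "I \<subseteq> {0..1}" unfolding I_def by (auto intro: is_interval_Int is_interval_cc)
  have "measure lborel I \<le> measure lborel {t - h..t + h}"
    unfolding I_def by (intro measure_mono_fmeasurable fmeasurable_lborel_Icc) auto
  then have mI: "measure lborel I \<le> 2 * h" using assms(6) by simp
  have "1 / real m * (\<Sum>k=1..m. indicator I (T m k)) \<le> a0 * max (measure lborel I) (1 / real m)"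
    using LP2(1) I assms(7) unfolding LP2_def by auto
  also have "\<dots> \<le> a0 * (2 * h)"
    using LP2(2) mI mh assms(7) by (intro mult_left_mono) (auto simp: field_simps)
  finally have cnt: "(\<Sum>k=1..m. indicator I (T m k)) \<le> 2 * a0 * (real m * h)"
    using assms(7) by (simp add: field_simps)
  have "(\<Sum>k=1..m. \<bar>lp_weight K l m (T m) h t k\<bar>) \<le> (\<Sum>k=1..m. c / (real m * h) * indicator I (T m k))"
  proof (rule sum_mono)
    fix k assume k: "k \<in> {1..m}"
    show "\<bar>lp_weight K l m (T m) h t k\<bar> \<le> c / (real m * h) * indicator I (T m k)"
    proof (cases "T m k \<in> I")
      case True
      then show ?thesis using lp_weight_bound[OF assms(1-6), of k] by (simp add: c_def)
    next
      case False
      then have "h < \<bar>T m k - t\<bar>" using T[OF k] by (auto simp: I_def)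
      then show ?thesis using lp_weight_support[OF assms(5,6)] c0 assms(6) by simp
    qed
  qed
  also have "\<dots> = c / (real m * h) * (\<Sum>k=1..m. indicator I (T m k))" by (simp only: sum_distrib_left)
  also have "\<dots> \<le> c / (real m * h) * (2 * a0 * (real m * h))"
    by (rule mult_left_mono[OF cnt]) (use c0 assms(6) in simp)
  also have "\<dots> = 2 * a0 * c" using assms(6,7) by simp
  finally show ?thesis by (simp add: c_def)
qed

section \<open>Taylor expansion in time and the bias of smoothing\<close>

lemma taylor_polynomial_derivative:
  fixes c :: "nat \<Rightarrow> real"
  shows "((\<lambda>z. \<Sum>i\<le>Suc j. c i * (z - t) ^ i / fact i) has_real_derivative
    (\<Sum>i\<le>j. c (Suc i) * (z - t) ^ i / fact i)) (at z within S)"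
proof -
  have "((\<lambda>z. c 0 + (\<Sum>i\<le>j. c (Suc i) * (z - t) ^ Suc i / fact (Suc i))) has_real_derivative
    0 + (\<Sum>i\<le>j. c (Suc i) * (z - t) ^ i / fact i)) (at z within S)"
  proof (intro DERIV_add DERIV_const DERIV_sum)
    fix i
    have "((\<lambda>z. z - t) has_real_derivative 1) (at z within S)"
      by (auto intro!: derivative_eq_intros)
    from DERIV_power[OF this, of "Suc i"]
    have "((\<lambda>z. (z - t) ^ Suc i) has_real_derivative real (Suc i) * (z - t) ^ i) (at z within S)"
      by (simp only: mult_1_left diff_Suc_1 diff_Suc_1' One_nat_def diff_Suc_Suc diff_zero)
    then have "((\<lambda>z. c (Suc i) * (z - t) ^ Suc i / fact (Suc i)) has_real_derivative
      c (Suc i) * (real (Suc i) * (z - t) ^ i) / fact (Suc i)) (at z within S)"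
      by (intro DERIV_cdivide DERIV_cmult)
    moreover have "c (Suc i) * (real (Suc i) * (z - t) ^ i) / fact (Suc i) =
        c (Suc i) * (z - t) ^ i / fact i"
      unfolding fact_Suc of_nat_mult by (simp del: of_nat_Suc)
    ultimately show "((\<lambda>z. c (Suc i) * (z - t) ^ Suc i / fact (Suc i)) has_real_derivative
      c (Suc i) * (z - t) ^ i / fact i) (at z within S)"
      by simp
  qed
  then show ?thesis by (simp only: sum.atMost_Suc_shift) simp
qed

text \<open>Descending induction from the top derivative: the Taylor remainder of one derivative
  vanishes at \<open>t\<close> and has the remainder of the next derivative as its own derivative,
  so the mean value inequality gains one power of \<open>\<bar>s - t\<bar>\<close>. The inner bound
  is used uniformly on the segment, which keeps the constant \<open>L\<close> without
  factorials.\<close>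

lemma holder_taylor:
  fixes D :: "nat \<Rightarrow> real \<Rightarrow> real"
  assumes \<beta>: "0 < \<beta>" and L: "0 \<le> L"
    and deriv: "\<And>k t. k < nat \<lfloor>\<beta>\<rfloor> \<Longrightarrow> t \<in> {0..1} \<Longrightarrow> (D k has_real_derivative D (Suc k) t) (at t within {0..1})"
    and top: "\<And>t t'. t \<in> {0..1} \<Longrightarrow> t' \<in> {0..1} \<Longrightarrow>
      \<bar>D (nat \<lfloor>\<beta>\<rfloor>) t - D (nat \<lfloor>\<beta>\<rfloor>) t'\<bar> \<le> L * \<bar>t - t'\<bar> powr (\<beta> - real (nat \<lfloor>\<beta>\<rfloor>))"
    and s: "s \<in> {0..1}" and t: "t \<in> {0..1}"
  shows "\<bar>D 0 s - (\<Sum>i\<le>nat \<lfloor>\<beta>\<rfloor>. D i t * (s - t) ^ i / fact i)\<bar> \<le> L * \<bar>s - t\<bar> powr \<beta>"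
proof -
  define l where "l = nat \<lfloor>\<beta>\<rfloor>"
  have l: "real l \<le> \<beta>" unfolding l_def using \<beta> by (simp add: of_nat_nat)
  have "j \<le> l \<Longrightarrow> \<forall>s\<in>{0..1}. \<bar>D (l - j) s - (\<Sum>i\<le>j. D (l - j + i) t * (s - t) ^ i / fact i)\<bar>
    \<le> L * \<bar>s - t\<bar> powr (\<beta> - real l + real j)" for j
  proof (induction j)
    case 0
    then show ?case using top t by (simp add: l_def)
  next
    case (Suc j)
    define k where "k = l - Suc j"
    have k: "k < l" "l - j = Suc k" using Suc.prems by (auto simp: k_def)
    define g where "g = (\<lambda>z. D k z - (\<Sum>i\<le>Suc j. D (k + i) t * (z - t) ^ i / fact i))"
    define g' where "g' = (\<lambda>z. D (Suc k) z - (\<Sum>i\<le>j. D (k + Suc i) t * (z - t) ^ i / fact i))"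
    have der: "(g has_real_derivative g' z) (at z within {0..1})" if "z \<in> {0..1}" for z
      unfolding g_def g'_def
      by (intro DERIV_diff taylor_polynomial_derivative[of "\<lambda>i. D (k + i) t"] deriv)
        (use k that in \<open>auto simp: l_def\<close>)
    have bound: "\<bar>g' z\<bar> \<le> L * \<bar>z - t\<bar> powr (\<beta> - real l + real j)" if "z \<in> {0..1}" for z
      using Suc that k by (simp add: g'_def)
    have "\<bar>g s\<bar> \<le> L * \<bar>s - t\<bar> powr (\<beta> - real l + real (Suc j))" if s: "s \<in> {0..1}" for s
    proof -
      have sub: "closed_segment s t \<subseteq> {0..1}"
        using s t by (auto simp: closed_segment_eq_real_ivl split: if_splits)
      have "norm (g s - g t) \<le> (L * \<bar>s - t\<bar> powr (\<beta> - real l + real j)) * norm (s - t)"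
      proof (rule field_differentiable_bound[of "closed_segment s t" g g'])
        fix z assume z: "z \<in> closed_segment s t"
        then show "(g has_real_derivative g' z) (at z within closed_segment s t)"
          using DERIV_subset[OF der[of z] sub] sub by auto
        have "\<bar>z - t\<bar> \<le> \<bar>s - t\<bar>"
          using z by (auto simp: closed_segment_eq_real_ivl split: if_splits)
        then have "\<bar>z - t\<bar> powr (\<beta> - real l + real j) \<le> \<bar>s - t\<bar> powr (\<beta> - real l + real j)"
          using l by (intro powr_mono2) auto
        then show "norm (g' z) \<le> L * \<bar>s - t\<bar> powr (\<beta> - real l + real j)"
          using order_trans[OF bound[of z] mult_left_mono[OF _ L]] z sub by auto
      qed auto
      moreover have "g t = 0" by (simp add: g_def sum.atMost_Suc_shift del: sum.atMost_Suc)
      moreover have "\<bar>s - t\<bar> powr (\<beta> - real l + real j) * \<bar>s - t\<bar> = \<bar>s - t\<bar> powr (\<beta> - real l +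
          real (Suc j))"
        by (cases "s = t") (simp_all add: powr_add mult_ac)
      ultimately show ?thesis by (simp add: mult.assoc)
    qed
    then show ?case by (simp add: g_def k_def del: sum.atMost_Suc)
  qed
  from this[of l] s show ?thesis by (simp add: l_def)
qed

lemma holder_in_time_taylor:
  assumes "0 < \<beta>" "0 \<le> L" "holder_in_time \<beta> L f" "x \<in> {0..1}" "y \<in> {0..1}"
  shows "\<exists>D. (\<forall>s\<in>{0..1}. \<forall>t\<in>{0..1}.
      \<bar>f x y s - (\<Sum>i\<le>nat \<lfloor>\<beta>\<rfloor>. D i t * (s - t) ^ i / fact i)\<bar> \<le> L * \<bar>s - t\<bar> powr \<beta>) \<and>
    (\<forall>t\<in>{0..1}. D 0 t = f x y t)"
proof -
  obtain D where D: "\<forall>t\<in>{0..1}. D 0 t = f x y t"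
    "\<forall>k<nat \<lfloor>\<beta>\<rfloor>. \<forall>t\<in>{0..1}. (D k has_real_derivative D (Suc k) t) (at t within {0..1})"
    "\<forall>t\<in>{0..1}. \<forall>t'\<in>{0..1}. \<bar>D (nat \<lfloor>\<beta>\<rfloor>) t - D (nat \<lfloor>\<beta>\<rfloor>) t'\<bar>
      \<le> L * \<bar>t - t'\<bar> powr (\<beta> - real (nat \<lfloor>\<beta>\<rfloor>))"
    using bspec[OF bspec[OF assms(3)[unfolded holder_in_time_def] assms(4)] assms(5)] by (elim exE conjE)
  have "\<bar>f x y s - (\<Sum>i\<le>nat \<lfloor>\<beta>\<rfloor>. D i t * (s - t) ^ i / fact i)\<bar> \<le> L * \<bar>s - t\<bar> powr \<beta>"
    if "s \<in> {0..1}" "t \<in> {0..1}" for s t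
    using holder_taylor[OF assms(1,2), of D s t] D that by auto
  with D(1) show ?thesis by (intro exI[of _ D]) auto
qed

text \<open>The Taylor bound treats \<beta> below 1 and the differentiable cases alike. Continuity
  serves to reduce the supremum over \<open>t\<close> to countably many conditions.\<close>

lemma holder_in_time_continuous:
  assumes "0 < \<beta>" "0 \<le> L" "holder_in_time \<beta> L f" "x \<in> {0..1}" "y \<in> {0..1}"
  shows "continuous_on {0..1} (f x y)"
proof -
  obtain D :: "nat \<Rightarrow> real \<Rightarrow> real" where D0: "\<forall>s\<in>{0..1}. \<forall>t\<in>{0..1}.
      \<bar>f x y s - (\<Sum>i\<le>nat \<lfloor>\<beta>\<rfloor>. D i t * (s - t) ^ i / fact i)\<bar> \<le> L * \<bar>s - t\<bar> powr \<beta>"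
    "\<forall>t\<in>{0..1}. D 0 t = f x y t"
    using holder_in_time_taylor[OF assms] by (elim exE conjE)
  note D = D0[rule_format]
  have "(f x y \<longlongrightarrow> f x y t) (at t within {0..1})" if t: "t \<in> {0..1}" for t
  proof -
    define p where "p = (\<lambda>s. \<Sum>i\<le>nat \<lfloor>\<beta>\<rfloor>. D i t * (s - t) ^ i / fact i)"
    have "isCont p t" unfolding p_def by (intro continuous_intros) auto
    moreover have "p t = f x y t"
      using D(2)[OF t] by (cases "nat \<lfloor>\<beta>\<rfloor>") (simp_all add: p_def sum.atMost_Suc_shift del: sum.atMost_Suc)
    ultimately have p: "(p \<longlongrightarrow> f x y t) (at t within {0..1})"
      unfolding isCont_def by (metis tendsto_within_subset subset_UNIV)
    have "((\<lambda>s. L * \<bar>s - t\<bar> powr \<beta>) \<longlongrightarrow> L * \<bar>t - t\<bar> powr \<beta>) (at t within {0..1})"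
      using assms(1) by (intro tendsto_intros) (auto intro: tendsto_eq_intros)
    then have "((\<lambda>s. L * \<bar>s - t\<bar> powr \<beta>) \<longlongrightarrow> 0) (at t within {0..1})" by simp
    moreover have "\<forall>\<^sub>F s in at t within {0..1}. norm (f x y s - p s) \<le> L * \<bar>s - t\<bar> powr \<beta>"
      unfolding eventually_at_filter using D(1) t by (auto simp: p_def)
    ultimately have "((\<lambda>s. f x y s - p s) \<longlongrightarrow> 0) (at t within {0..1})"
      by (rule Lim_null_comparison[rotated])
    from tendsto_add[OF this p] show ?thesis by simp
  qed
  then show ?thesis by (simp add: continuous_on_def)
qed

text \<open>The moment conditions reproduce the Taylor polynomial at \<open>t\<close> exactly, so
  only the remainder is averaged, and the support condition confines it to times within
  \<open>h\<close> of \<open>t\<close>.\<close>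

lemma local_polynomial_bias:
  assumes "0 < \<beta>" "0 \<le> L" "holder_in_time \<beta> L f" "x \<in> {0..1}" "y \<in> {0..1}"
    and T: "\<And>k. k \<in> {1..m} \<Longrightarrow> T k \<in> {0..1}" and t: "t \<in> {0..1}" and h: "0 < h"
    and moment: "\<And>j. j \<le> nat \<lfloor>\<beta>\<rfloor> \<Longrightarrow>
      (\<Sum>k=1..m. w k * ((T k - t) / h) ^ j) = (if j = 0 then 1 else 0)"
    and support: "\<And>k. k \<in> {1..m} \<Longrightarrow> h < \<bar>T k - t\<bar> \<Longrightarrow> w k = 0"
  shows "\<bar>(\<Sum>k=1..m. w k * f x y (T k)) - f x y t\<bar> \<le> L * h powr \<beta> * (\<Sum>k=1..m. \<bar>w k\<bar>)"
proof -
  obtain D :: "nat \<Rightarrow> real \<Rightarrow> real" where D0: "\<forall>s\<in>{0..1}. \<forall>t\<in>{0..1}.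
      \<bar>f x y s - (\<Sum>i\<le>nat \<lfloor>\<beta>\<rfloor>. D i t * (s - t) ^ i / fact i)\<bar> \<le> L * \<bar>s - t\<bar> powr \<beta>"
    "\<forall>t\<in>{0..1}. D 0 t = f x y t"
    using holder_in_time_taylor[OF assms(1-5)] by (elim exE conjE)
  note D = D0[rule_format]
  define p where "p = (\<lambda>s. \<Sum>i\<le>nat \<lfloor>\<beta>\<rfloor>. D i t * (s - t) ^ i / fact i)"
  have "(\<Sum>k=1..m. w k * p (T k)) =
    (\<Sum>k=1..m. \<Sum>i\<le>nat \<lfloor>\<beta>\<rfloor>. (D i t * h ^ i / fact i) * (w k * ((T k - t) / h) ^ i))"
    unfolding p_def sum_distrib_left using h by (intro sum.cong refl) (simp add: power_divide)
  also have "\<dots> = (\<Sum>i\<le>nat \<lfloor>\<beta>\<rfloor>. (D i t * h ^ i / fact i) * (\<Sum>k=1..m. w k * ((T k - t) / h) ^ i))"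
    by (subst sum.swap) (simp only: sum_distrib_left)
  also have "\<dots> = (\<Sum>i\<le>nat \<lfloor>\<beta>\<rfloor>. if i = 0 then f x y t else 0)"
    using moment D(2)[OF t] by (intro sum.cong) auto
  also have "\<dots> = f x y t" by simp
  finally have p: "(\<Sum>k=1..m. w k * p (T k)) = f x y t" .
  have "\<bar>(\<Sum>k=1..m. w k * f x y (T k)) - f x y t\<bar> = \<bar>\<Sum>k=1..m. w k * (f x y (T k) - p (T k))\<bar>"
    unfolding p[symmetric] by (simp only: right_diff_distrib sum_subtractf)
  also have "\<dots> \<le> (\<Sum>k=1..m. \<bar>w k * (f x y (T k) - p (T k))\<bar>)" by (rule sum_abs)
  also have "\<dots> \<le> (\<Sum>k=1..m. L * h powr \<beta> * \<bar>w k\<bar>)"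
  proof (rule sum_mono)
    fix k assume k: "k \<in> {1..m}"
    show "\<bar>w k * (f x y (T k) - p (T k))\<bar> \<le> L * h powr \<beta> * \<bar>w k\<bar>"
    proof (cases "h < \<bar>T k - t\<bar>")
      case True
      then show ?thesis using support[OF k] by simp
    next
      case False
      have "\<bar>f x y (T k) - p (T k)\<bar> \<le> L * \<bar>T k - t\<bar> powr \<beta>"
        using D(1)[OF T[OF k] t] by (simp add: p_def)
      also have "\<dots> \<le> L * h powr \<beta>"
        using False assms(1,2) by (intro mult_left_mono powr_mono2) auto
      finally show ?thesis by (simp add: abs_mult mult.commute mult_left_mono)
    qed
  qed
  also have "\<dots> = L * h powr \<beta> * (\<Sum>k=1..m. \<bar>w k\<bar>)" by (simp only: sum_distrib_left)
  finally show ?thesis .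
qed

section \<open>The neighborhood step for a fixed signal and noise\<close>

text \<open>The counting function jumps only at values of \<open>d\<close>, so the infimum is the
  minimum of finitely many values and is attained. Positivity of the level excludes thresholds below
  all values, where the count is 0.\<close>

lemma lower_quantile_properties:
  assumes h: "0 < h * real n" and S: "S \<subseteq> {1..n}" "h * real n \<le> real (card S)" "\<And>k. k \<in> S \<Longrightarrow> d k \<le> B"
  shows "lower_quantile n h d \<le> B" "h * real n \<le> real (card {k\<in>{1..n}. d k \<le> lower_quantile n h d})"
proof -
  define X where "X = {x. h * real n \<le> real (card {k\<in>{1..n}. d k \<le> x})}"
  define Y where "Y = X \<inter> d ` {1..n}"
  \<comment> \<open>An admissible threshold can be lowered to the largest value of \<open>d\<close>
    below it without changing the count.\<close>
  have below: "\<exists>y\<in>Y. y \<le> x" if x: "x \<in> X" for x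
  proof -
    define A where "A = {k\<in>{1..n}. d k \<le> x}"
    have "0 < card A" using x h by (auto simp: A_def X_def intro: ccontr)
    then have A: "finite A" "A \<noteq> {}" by (auto simp: card_gt_0_iff)
    define y where "y = Max (d ` A)"
    have "y \<in> d ` A" unfolding y_def using A by (intro Max_in) auto
    then obtain k where k: "k \<in> A" "y = d k" by auto
    have "A \<subseteq> {k\<in>{1..n}. d k \<le> y}" using A by (auto simp: A_def y_def)
    then have "card A \<le> card {k\<in>{1..n}. d k \<le> y}" by (intro card_mono) auto
    then have "y \<in> X" using x by (simp add: X_def A_def)
    then show ?thesis using k by (auto simp: Y_def A_def)
  qed
  have "S \<subseteq> {k\<in>{1..n}. d k \<le> B}" using S by auto
  then have "card S \<le> card {k\<in>{1..n}. d k \<le> B}" by (intro card_mono) auto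
  then have B: "B \<in> X" using S(2) by (simp add: X_def)
  have Y: "finite Y" "Y \<noteq> {}" using below[OF B] by (auto simp: Y_def)
  have min: "Min Y \<in> X" using Min_in[OF Y] by (simp add: Y_def)
  have low: "Min Y \<le> x" if x: "x \<in> X" for x
  proof -
    obtain y where "y \<in> Y" "y \<le> x" using below[OF x] by blast
    then show ?thesis using Min_le[OF Y(1)] order_trans by blast
  qed
  have "lower_quantile n h d = Min Y"
    unfolding lower_quantile_def X_def[symmetric] by (rule cInf_eq_minimum[OF min low])
  then show "lower_quantile n h d \<le> B" "h * real n \<le> real (card {k\<in>{1..n}. d k \<le> lower_quantile n h d})"
    using low[OF B] min by (simp_all add: X_def)
qed

lemma node_dist_inner_le:
  assumes "0 < n" "l \<in> {1..n} - {i, i'}"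
  shows "\<bar>\<Sum>j=1..n. (P i j - P i' j) * P l j\<bar> \<le> real n * (node_dist n P i i')\<^sup>2"
proof -
  define F where "F = (\<lambda>l. \<bar>\<Sum>j=1..n. (P i j - P i' j) * P l j\<bar>)"
  have le: "F l \<le> Max (F ` ({1..n} - {i, i'}))" using assms(2) by (intro Max_ge) auto
  moreover have "0 \<le> F l" by (simp add: F_def)
  ultimately have "0 \<le> Max (F ` ({1..n} - {i, i'}))" by linarith
  then have "real n * (node_dist n P i i')\<^sup>2 = Max (F ` ({1..n} - {i, i'}))"
    using assms(1) by (simp add: node_dist_def F_def)
  with le show ?thesis by (simp add: F_def)
qed

lemma node_dist_le:
  assumes "0 < n" "{1..n} - {i, i'} \<noteq> {}"
    and "\<And>l. l \<in> {1..n} - {i, i'} \<Longrightarrow> \<bar>\<Sum>j=1..n. (P i j - P i' j) * P l j\<bar> \<le> b"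
  shows "node_dist n P i i' \<le> sqrt (b / real n)"
  unfolding node_dist_def using assms by (intro real_sqrt_le_mono divide_right_mono Max.boundedI) auto

lemma sum_square_add3_le:
  fixes a b c :: "nat \<Rightarrow> real"
  shows "(\<Sum>j\<in>V. (a j + b j + c j)\<^sup>2) \<le> 3 * ((\<Sum>j\<in>V. (a j)\<^sup>2) + (\<Sum>j\<in>V. (b j)\<^sup>2) + (\<Sum>j\<in>V. (c j)\<^sup>2))"
proof -
  have "(x + y + z)\<^sup>2 \<le> 3 * (x\<^sup>2 + y\<^sup>2 + z\<^sup>2)" for x y z :: real
  proof -
    have "3 * (x\<^sup>2 + y\<^sup>2 + z\<^sup>2) - (x + y + z)\<^sup>2 = (x - y)\<^sup>2 + (y - z)\<^sup>2 + (x - z)\<^sup>2"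
      by (simp add: power2_eq_square algebra_simps)
    then show ?thesis using zero_le_power2[of "x - y"] zero_le_power2[of "y - z"] zero_le_power2[of "x - z"]
        by linarith
  qed
  then have "(\<Sum>j\<in>V. (a j + b j + c j)\<^sup>2) \<le> (\<Sum>j\<in>V. 3 * ((a j)\<^sup>2 + (b j)\<^sup>2 + (c j)\<^sup>2))"
    by (intro sum_mono) simp
  then show ?thesis by (simp add: sum_distrib_left sum.distrib)
qed

text \<open>Convexity of the square, applied column by column.\<close>

lemma mean_square_le:
  fixes x :: "nat \<Rightarrow> nat \<Rightarrow> real"
  assumes N: "finite N" "N \<noteq> {}" and b: "\<And>i. i \<in> N \<Longrightarrow> (\<Sum>j\<in>V. (x i j)\<^sup>2) \<le> b"
  shows "(\<Sum>j\<in>V. ((\<Sum>i\<in>N. x i j) / real (card N))\<^sup>2) \<le> b"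
proof -
  define c where "c = real (card N)"
  have c: "0 < c" using N by (simp add: c_def card_gt_0_iff)
  have "((\<Sum>i\<in>N. x i j) / c)\<^sup>2 \<le> (\<Sum>i\<in>N. (x i j)\<^sup>2) / c" for j
  proof -
    have "(\<Sum>i\<in>N. x i j * 1)\<^sup>2 \<le> (\<Sum>i\<in>N. (x i j)\<^sup>2) * (\<Sum>i\<in>N. 1\<^sup>2)" by (rule Cauchy_Schwarz_ineq_sum)
    then have "(\<Sum>i\<in>N. x i j)\<^sup>2 \<le> (\<Sum>i\<in>N. (x i j)\<^sup>2) * c" by (simp add: c_def)
    then show ?thesis using c by (simp add: field_simps power2_eq_square)
  qed
  then have "(\<Sum>j\<in>V. ((\<Sum>i\<in>N. x i j) / c)\<^sup>2) \<le> (\<Sum>j\<in>V. (\<Sum>i\<in>N. (x i j)\<^sup>2) / c)" by (intro sum_mono) simp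
  also have "\<dots> = (\<Sum>i\<in>N. (\<Sum>j\<in>V. (x i j)\<^sup>2)) / c"
    by (subst sum.swap) (simp add: sum_divide_distrib)
  also have "\<dots> \<le> (\<Sum>i\<in>N. b) / c" using c b by (intro divide_right_mono sum_mono) auto
  also have "\<dots> = b" using c by (simp add: c_def)
  finally show ?thesis by (simp add: c_def)
qed

text \<open>Of the \<open>card N\<close> squared products only \<open>card N\<close> are diagonal.
  After division by \<open>(card N)\<^sup>2\<close> the diagonal may therefore be larger than the
  mixed products by a factor \<open>card N\<close> and still contribute only
  \<open>\<eta>\<close>.\<close>

lemma mean_square_almost_orthogonal:
  fixes x :: "nat \<Rightarrow> nat \<Rightarrow> real"
  assumes N: "finite N" "N \<noteq> {}" and \<eta>: "0 \<le> \<eta>"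
    and off: "\<And>i l. i \<in> N \<Longrightarrow> l \<in> N \<Longrightarrow> i \<noteq> l \<Longrightarrow> (\<Sum>j\<in>V. x i j * x l j) \<le> \<eta>"
    and diag: "\<And>i. i \<in> N \<Longrightarrow> (\<Sum>j\<in>V. x i j * x i j) \<le> \<eta> * real (card N)"
  shows "(\<Sum>j\<in>V. ((\<Sum>i\<in>N. x i j) / real (card N))\<^sup>2) \<le> 2 * \<eta>"
proof -
  define c where "c = real (card N)"
  have c: "0 < c" using N by (simp add: c_def card_gt_0_iff)
  have "(\<Sum>j\<in>V. ((\<Sum>i\<in>N. x i j) / c)\<^sup>2) = (\<Sum>j\<in>V. \<Sum>i\<in>N. \<Sum>l\<in>N. x i j * x l j) / c\<^sup>2"
    by (simp add: power_divide sum_divide_distrib power2_eq_square sum_product)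
  also have "(\<Sum>j\<in>V. \<Sum>i\<in>N. \<Sum>l\<in>N. x i j * x l j) = (\<Sum>i\<in>N. \<Sum>l\<in>N. \<Sum>j\<in>V. x i j * x l j)"
    by (subst sum.swap, rule sum.cong[OF refl], rule sum.swap)
  also have "\<dots> / c\<^sup>2 \<le> (\<Sum>i\<in>N. \<eta> * c + \<eta> * c) / c\<^sup>2"
  proof (intro divide_right_mono sum_mono)
    fix i assume i: "i \<in> N"
    have "(\<Sum>l\<in>N. \<Sum>j\<in>V. x i j * x l j) = (\<Sum>j\<in>V. x i j * x i j) + (\<Sum>l\<in>N - {i}. \<Sum>j\<in>V. x i j * x l j)"
      using N i by (simp add: sum.remove)
    also have "(\<Sum>l\<in>N - {i}. \<Sum>j\<in>V. x i j * x l j) \<le> (\<Sum>l\<in>N - {i}. \<eta>)"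
      using off[OF i] by (intro sum_mono) auto
    also have "\<dots> \<le> (\<Sum>l\<in>N. \<eta>)" using N \<eta> by (intro sum_mono2) auto
    also have "\<dots> = \<eta> * c" by (simp add: c_def)
    finally show "(\<Sum>l\<in>N. \<Sum>j\<in>V. x i j * x l j) \<le> \<eta> * c + \<eta> * c" using diag[OF i] by (simp add: c_def)
  qed simp
  also have "\<dots> = 2 * \<eta>" using c by (simp add: c_def[symmetric] power2_eq_square)
  finally show ?thesis by (simp add: c_def)
qed

text \<open>Deterministic core of the dense regime. \<open>M\<close> is the conditional mean of the
  first stage, \<open>Z\<close> its noise, and \<open>\<eta>\<close> the common scale n R;
  \<open>\<theta>\<close> is the variation of the signal over a cell and \<open>\<kappa>\<close> the
  bias. The final constant is 3 * (32 + 1 + 2), from the distance of the selected signal rows, the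
  bias and the averaged noise.\<close>

lemma neighborhood_averaging:
  fixes M Z P :: "nat \<Rightarrow> nat \<Rightarrow> real"
  defines "Q \<equiv> \<lambda>i j. M i j + Z i j"
  assumes h: "0 < h * real n" and n: "3 \<le> n" and \<eta>: "0 \<le> \<eta>" and \<mu>: "0 \<le> \<mu>"
    and cross: "\<And>i l. i \<in> {1..n} \<Longrightarrow> l \<in> {1..n} \<Longrightarrow> \<bar>\<Sum>j=1..n. Z i j * M l j\<bar> \<le> \<eta>"
    and noise: "\<And>i l. i \<in> {1..n} \<Longrightarrow> l \<in> {1..n} \<Longrightarrow> i \<noteq> l \<Longrightarrow> \<bar>\<Sum>j=1..n. Z i j * Z l j\<bar> \<le> \<eta>"
    and energy: "\<And>l. l \<in> {1..n} \<Longrightarrow> (\<Sum>j=1..n. Z l j * Z l j) \<le> \<eta> * (h * real n)"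
    and size: "\<And>i j. i \<in> {1..n} \<Longrightarrow> j \<in> {1..n} \<Longrightarrow> \<bar>M i j\<bar> \<le> \<mu>"
    and close: "\<And>i. i \<in> {1..n} \<Longrightarrow> \<exists>S\<subseteq>{1..n}. h * real n \<le> real (card S) \<and> 3 \<le> card S \<and>
      (\<forall>i'\<in>S. \<forall>j\<in>{1..n}. \<bar>M i j - M i' j\<bar> \<le> \<theta>)"
    and \<theta>: "real n * \<theta> * \<mu> \<le> \<eta>"
    and bias: "\<And>i j. i \<in> {1..n} \<Longrightarrow> j \<in> {1..n} \<Longrightarrow> \<bar>M i j - P i j\<bar> \<le> \<kappa>" and \<kappa>: "real n * \<kappa>\<^sup>2 \<le> \<eta>"
    and i: "i \<in> {1..n}"
  shows "(\<Sum>j=1..n. ((\<Sum>i'\<in>neighborhood n (Some h) Q i. Q i' j) /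
    real (card (neighborhood n (Some h) Q i)) - P i j)\<^sup>2) \<le> 105 * \<eta>"
proof -
  define V where "V = {1..n}"
  define N where "N = neighborhood n (Some h) Q i"
  have n0: "0 < n" using n by simp
  \<comment> \<open>Expanding the product leaves six terms besides the signal: four of noise against
    signal and two of noise against noise. The latter are mixed because \<open>l\<close> differs
    from \<open>i\<close> and \<open>i'\<close>.\<close>
  have dev: "\<bar>(\<Sum>j\<in>V. (Q i j - Q i' j) * Q l j) - (\<Sum>j\<in>V. (M i j - M i' j) * M l j)\<bar> \<le> 6 * \<eta>"
    if "i' \<in> V" "l \<in> V" "l \<noteq> i" "l \<noteq> i'" for i' l
  proof -
    have "(\<Sum>j\<in>V. (Q i j - Q i' j) * Q l j) - (\<Sum>j\<in>V. (M i j - M i' j) * M l j) =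
      (\<Sum>j\<in>V. Z i j * M l j) - (\<Sum>j\<in>V. Z i' j * M l j) + (\<Sum>j\<in>V. Z l j * M i j) - (\<Sum>j\<in>V. Z l j * M i' j)
      + (\<Sum>j\<in>V. Z i j * Z l j) - (\<Sum>j\<in>V. Z i' j * Z l j)"
      unfolding Q_def sum_subtractf[symmetric] sum.distrib[symmetric]
      by (rule sum.cong[OF refl]) (simp add: algebra_simps)
    moreover have il: "i \<in> {1..n}" "i' \<in> {1..n}" "l \<in> {1..n}" "i \<noteq> l" "i' \<noteq> l"
      using that i by (auto simp: V_def)
    ultimately show ?thesis
      using cross[OF il(1,3)] cross[OF il(2,3)] cross[OF il(3,1)] cross[OF il(3,2)]
        noise[OF il(1,3,4)] noise[OF il(2,3,5)]
      unfolding V_def by linarith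
  qed
  have small: "\<bar>\<Sum>j\<in>V. (M i1 j - M i2 j) * y j\<bar> \<le> 2 * \<eta>"
    if d: "\<And>j. j \<in> V \<Longrightarrow> \<bar>M i1 j - M i2 j\<bar> \<le> \<theta>" and y: "\<And>j. j \<in> V \<Longrightarrow> \<bar>y j\<bar> \<le> 2 * \<mu>" for i1 i2 y
  proof -
    have "0 \<le> \<theta>" using d[OF i[folded V_def]] by (rule order_trans[OF abs_ge_zero])
    have "\<bar>\<Sum>j\<in>V. (M i1 j - M i2 j) * y j\<bar> \<le> (\<Sum>j\<in>V. \<theta> * (2 * \<mu>))"
      using d y \<open>0 \<le> \<theta>\<close> by (intro order_trans[OF sum_abs] sum_mono) (simp add: abs_mult mult_mono)
    also have "\<dots> = 2 * (real n * \<theta> * \<mu>)" by (simp add: V_def)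
    finally show ?thesis using \<theta> by linarith
  qed
  obtain S where S: "S \<subseteq> V" "h * real n \<le> real (card S)" "3 \<le> card S"
    "\<And>i' j. i' \<in> S \<Longrightarrow> j \<in> V \<Longrightarrow> \<bar>M i j - M i' j\<bar> \<le> \<theta>"
    using close[OF i] unfolding V_def by blast
  \<comment> \<open>Nodes of \<open>S\<close> have signal products at most
    \<open>2 * \<eta>\<close>, and passing to the observed matrix costs \<open>6 * \<eta>\<close>.
    As \<open>S\<close> has at least \<open>h * n\<close> elements, the quantile, and with it the
    distance of every selected node, is at most \<open>B\<close>.\<close>
  define B where "B = sqrt (8 * \<eta> / real n)"
  have distS: "node_dist n Q i i' \<le> B" if i': "i' \<in> S" for i'
    unfolding B_def
  proof (rule node_dist_le[OF n0])
    have "card {i, i'} \<le> 2" by (simp add: card_insert_if)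
    moreover have "card {1..n} \<le> card {i, i'}" if "{1..n} \<subseteq> {i, i'}"
      using that by (intro card_mono) auto
    ultimately show "{1..n} - {i, i'} \<noteq> {}" using n by auto
    fix l assume l: "l \<in> {1..n} - {i, i'}"
    have "\<bar>\<Sum>j\<in>V. (M i j - M i' j) * M l j\<bar> \<le> 2 * \<eta>"
    proof (rule small)
      fix j assume "j \<in> V"
      then show "\<bar>M i j - M i' j\<bar> \<le> \<theta>" using S(4)[OF i'] by simp
      show "\<bar>M l j\<bar> \<le> 2 * \<mu>" using size[of l j] l \<open>j \<in> V\<close> \<mu> by (simp add: V_def)
    qed
    then show "\<bar>\<Sum>j=1..n. (Q i j - Q i' j) * Q l j\<bar> \<le> 8 * \<eta>"
      using dev[of i' l] l i' S(1) unfolding V_def by auto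
  qed
  note quant = lower_quantile_properties[where d = "node_dist n Q i", OF h S(1)[unfolded V_def] S(2) distS]
  have NV: "N \<subseteq> V" unfolding N_def neighborhood_def V_def by auto
  have Ncard: "h * real n \<le> real (card N)" using quant(2) by (simp add: N_def neighborhood_def)
  have finN: "finite N" using NV by (auto simp: V_def intro: finite_subset)
  have neN: "N \<noteq> {}" using Ncard h by auto
  \<comment> \<open>The passage from the observed matrix back to the signal costs another
    \<open>6 * \<eta>\<close> on top of the \<open>8 * \<eta>\<close> from the quantile.\<close>
  have inner: "\<bar>\<Sum>j\<in>V. (M i j - M i' j) * M l j\<bar> \<le> 14 * \<eta>"
    if "i' \<in> N" "l \<in> V" "l \<noteq> i" "l \<noteq> i'" for i' l
  proof -
    have "node_dist n Q i i' \<le> B" using that(1) quant(1) by (simp add: N_def neighborhood_def)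
    moreover have "0 \<le> node_dist n Q i i'"
    proof -
      have "{1..n} - {i, i'} \<noteq> {}" using that by (auto simp: V_def)
      then have "0 \<le> Max ((\<lambda>l. \<bar>\<Sum>j=1..n. (Q i j - Q i' j) * Q l j\<bar>) ` ({1..n} - {i, i'}))"
        by (subst Max_ge_iff) auto
      then show ?thesis by (simp add: node_dist_def)
    qed
    ultimately have "(node_dist n Q i i')\<^sup>2 \<le> B\<^sup>2" by (rule power_mono)
    then have "real n * (node_dist n Q i i')\<^sup>2 \<le> 8 * \<eta>" using n0 \<eta> by (simp add: B_def field_simps)
    then have "\<bar>\<Sum>j\<in>V. (Q i j - Q i' j) * Q l j\<bar> \<le> 8 * \<eta>"
      using node_dist_inner_le[OF n0, of l i i' Q] that unfolding V_def by auto
    then show ?thesis using dev[of i' l] that NV by auto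
  qed
  \<comment> \<open>The node \<open>i1\<close> will be \<open>i\<close> or \<open>i'\<close>,
    exactly the indices left out by the node distance. Its set \<open>S1\<close> has at least three
    members, so one of them differs from both, and substituting that row for row \<open>i1\<close>
    costs \<open>2 * \<eta>\<close>.\<close>
  have half: "\<bar>\<Sum>j\<in>V. (M i j - M i' j) * M i1 j\<bar> \<le> 16 * \<eta>" if i': "i' \<in> N" and i1: "i1 \<in> V" for i' i1
  proof -
    obtain S1 where S1: "S1 \<subseteq> V" "3 \<le> card S1"
      "\<And>l j. l \<in> S1 \<Longrightarrow> j \<in> V \<Longrightarrow> \<bar>M i1 j - M l j\<bar> \<le> \<theta>"
      using close[of i1] i1 unfolding V_def by blast
    have "\<not> S1 \<subseteq> {i, i'}"
    proof
      assume "S1 \<subseteq> {i, i'}"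
      then have "card S1 \<le> card {i, i'}" by (intro card_mono) auto
      also have "\<dots> \<le> 2" by (simp add: card_insert_if)
      finally show False using S1(2) by simp
    qed
    then obtain l where l: "l \<in> S1" "l \<noteq> i" "l \<noteq> i'" by auto
    have "(\<Sum>j\<in>V. (M i j - M i' j) * M i1 j) =
      (\<Sum>j\<in>V. (M i j - M i' j) * M l j) + (\<Sum>j\<in>V. (M i1 j - M l j) * (M i j - M i' j))"
      unfolding sum.distrib[symmetric] by (rule sum.cong[OF refl]) (simp add: algebra_simps)
    moreover have "\<bar>\<Sum>j\<in>V. (M i1 j - M l j) * (M i j - M i' j)\<bar> \<le> 2 * \<eta>"
    proof (rule small)
      fix j assume j: "j \<in> V"
      then show "\<bar>M i1 j - M l j\<bar> \<le> \<theta>" using S1(3)[OF l(1)] by simp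
      show "\<bar>M i j - M i' j\<bar> \<le> 2 * \<mu>"
        using size[of i j] size[of i' j] i i' NV j unfolding V_def by (auto simp: abs_le_iff)
    qed
    moreover have "l \<in> V" using l(1) S1(1) by auto
    ultimately show ?thesis using inner[OF i' \<open>l \<in> V\<close> l(2,3)] by linarith
  qed
  \<comment> \<open>The squared norm of a difference is its product with one row minus its product
    with the other, whence 32 = 16 + 16.\<close>
  have MM: "(\<Sum>j\<in>V. (M i' j - M i j)\<^sup>2) \<le> 32 * \<eta>" if i': "i' \<in> N" for i'
  proof -
    have "(\<Sum>j\<in>V. (M i' j - M i j)\<^sup>2) = (\<Sum>j\<in>V. (M i j - M i' j) * M i j) - (\<Sum>j\<in>V. (M i j - M i' j) * M i' j)"
      unfolding sum_subtractf[symmetric]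
          by (rule sum.cong[OF refl]) (simp add: power2_eq_square algebra_simps)
    moreover have "i \<in> V" "i' \<in> V" using i NV i' by (auto simp: V_def)
    ultimately show ?thesis using half[OF i' \<open>i \<in> V\<close>] half[OF i' \<open>i' \<in> V\<close>] by linarith
  qed
  have "(\<Sum>j\<in>V. ((\<Sum>i'\<in>N. Q i' j) / real (card N) - P i j)\<^sup>2) =
    (\<Sum>j\<in>V. ((\<Sum>i'\<in>N. M i' j - M i j) / real (card N) + (M i j - P i j) + (\<Sum>i'\<in>N. Z i' j) / real (card N))\<^sup>2)"
  proof (rule sum.cong[OF refl])
    fix j
    have "(\<Sum>i'\<in>N. M i' j - M i j) / real (card N) = (\<Sum>i'\<in>N. M i' j) / real (card N) - M i j"
      using neN finN by (simp add: sum_subtractf diff_divide_distrib)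
    then show "((\<Sum>i'\<in>N. Q i' j) / real (card N) - P i j)\<^sup>2 =
      ((\<Sum>i'\<in>N. M i' j - M i j) / real (card N) + (M i j - P i j) + (\<Sum>i'\<in>N. Z i' j) / real (card N))\<^sup>2"
      by (simp add: Q_def sum.distrib add_divide_distrib algebra_simps)
  qed
  also have "\<dots> \<le> 3 * ((\<Sum>j\<in>V. ((\<Sum>i'\<in>N. M i' j - M i j) / real (card N))\<^sup>2) + (\<Sum>j\<in>V. (M i j - P i j)\<^sup>2)
    + (\<Sum>j\<in>V. ((\<Sum>i'\<in>N. Z i' j) / real (card N))\<^sup>2))" by (rule sum_square_add3_le)
  also have "\<dots> \<le> 3 * (32 * \<eta> + \<eta> + 2 * \<eta>)"
  proof (intro mult_left_mono add_mono)
    show "(\<Sum>j\<in>V. ((\<Sum>i'\<in>N. M i' j - M i j) / real (card N))\<^sup>2) \<le> 32 * \<eta>"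
      by (rule mean_square_le[OF finN neN]) (use MM in auto)
    have "(\<Sum>j\<in>V. (M i j - P i j)\<^sup>2) \<le> (\<Sum>j\<in>V. \<kappa>\<^sup>2)"
    proof (rule sum_mono)
      fix j assume "j \<in> V"
      then show "(M i j - P i j)\<^sup>2 \<le> \<kappa>\<^sup>2"
        using bias[OF i, of j] power_mono[OF _ abs_ge_zero, of "M i j - P i j" \<kappa> 2] by (simp add: V_def)
    qed
    then show "(\<Sum>j\<in>V. (M i j - P i j)\<^sup>2) \<le> \<eta>" using \<kappa> by (simp add: V_def)
    show "(\<Sum>j\<in>V. ((\<Sum>i'\<in>N. Z i' j) / real (card N))\<^sup>2) \<le> 2 * \<eta>"
    proof (rule mean_square_almost_orthogonal[OF finN neN \<eta>])
      fix a l assume "a \<in> N" "l \<in> N" "a \<noteq> l"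
      then have "a \<in> {1..n}" "l \<in> {1..n}" using NV by (auto simp: V_def)
      from noise[OF this \<open>a \<noteq> l\<close>] show "(\<Sum>j\<in>V. Z a j * Z l j) \<le> \<eta>"
        unfolding V_def by linarith
    next
      fix a assume "a \<in> N"
      then have "(\<Sum>j\<in>V. Z a j * Z a j) \<le> \<eta> * (h * real n)" using energy[of a] NV unfolding V_def by auto
      also have "\<dots> \<le> \<eta> * real (card N)" using Ncard \<eta> by (rule mult_left_mono)
      finally show "(\<Sum>j\<in>V. Z a j * Z a j) \<le> \<eta> * real (card N)" .
    qed
  qed simp
  also have "\<dots> = 105 * \<eta>" by simp
  finally show ?thesis unfolding V_def N_def .
qed

section \<open>Products of Bernoulli distributions\<close>

text \<open>Expectation of \<open>F\<close> at the random set of successes of independent Bernoulli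
  trials indexed by \<open>S\<close>. As a finite sum it needs no measurability, and conditioning on
  some of the trials is a rearrangement.\<close>

definition bern_ex :: "('e \<Rightarrow> real) \<Rightarrow> 'e set \<Rightarrow> ('e set \<Rightarrow> real) \<Rightarrow> real" where
  "bern_ex p S F = (\<Sum>a\<in>Pow S. (\<Prod>e\<in>S. if e \<in> a then p e else 1 - p e) * F a)"

definition bern_pr :: "('e \<Rightarrow> real) \<Rightarrow> 'e set \<Rightarrow> ('e set \<Rightarrow> bool) \<Rightarrow> real" where
  "bern_pr p S Q = bern_ex p S (\<lambda>a. of_bool (Q a))"

definition centered :: "('e \<Rightarrow> real) \<Rightarrow> 'e set \<Rightarrow> 'e \<Rightarrow> real" where
  "centered p a e = of_bool (e \<in> a) - p e"

lemma bern_ex_empty [simp]: "bern_ex p {} F = F {}"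
  by (simp add: bern_ex_def)

lemma bern_ex_insert:
  assumes "finite S" "e \<notin> S"
  shows "bern_ex p (insert e S) F = p e * bern_ex p S (\<lambda>a. F (insert e a)) + (1 - p e) * bern_ex p S F"
proof -
  define w where "w = (\<lambda>S a. \<Prod>e\<in>S. if e \<in> a then p e else 1 - p e)"
  have inj: "inj_on (insert e) (Pow S)" using assms(2) by (auto simp: inj_on_def)
  have "bern_ex p (insert e S) F = (\<Sum>a\<in>Pow S. w (insert e S) a * F a) +
    (\<Sum>a\<in>insert e ` Pow S. w (insert e S) a * F a)"
    unfolding bern_ex_def Pow_insert w_def
    by (rule sum.union_disjoint) (use assms in auto)
  also have "(\<Sum>a\<in>insert e ` Pow S. w (insert e S) a * F a) =
     (\<Sum>a\<in>Pow S. w (insert e S) (insert e a) * F (insert e a))"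
    using inj by (simp add: sum.reindex)
  also have "\<dots> = (\<Sum>a\<in>Pow S. p e * (w S a * F (insert e a)))"
  proof (rule sum.cong[OF refl])
    fix a assume "a \<in> Pow S"
    have "w S (insert e a) = w S a"
      unfolding w_def by (rule prod.cong) (use assms in auto)
    then show "w (insert e S) (insert e a) * F (insert e a) = p e * (w S a * F (insert e a))"
      using assms by (simp add: w_def)
  qed
  also have "(\<Sum>a\<in>Pow S. w (insert e S) a * F a) = (\<Sum>a\<in>Pow S. (1 - p e) * (w S a * F a))"
    by (rule sum.cong) (use assms in \<open>auto simp: w_def\<close>)
  finally show ?thesis by (simp add: bern_ex_def w_def sum_distrib_left)
qed

lemma bern_ex_add: "bern_ex p S (\<lambda>a. F a + G a) = bern_ex p S F + bern_ex p S G"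
  by (simp add: bern_ex_def distrib_left sum.distrib)

lemma bern_ex_cmult: "bern_ex p S (\<lambda>a. c * F a) = c * bern_ex p S F"
  by (simp add: bern_ex_def sum_distrib_left mult_ac)

lemma bern_ex_cmult_right: "bern_ex p S (\<lambda>a. F a * c) = bern_ex p S F * c"
  using bern_ex_cmult[of p S c F] by (simp add: mult.commute)

lemma bern_ex_cong: "(\<And>a. a \<subseteq> S \<Longrightarrow> F a = G a) \<Longrightarrow> bern_ex p S F = bern_ex p S G"
  by (simp add: bern_ex_def)

lemma bern_ex_const:
  assumes "finite S" shows "bern_ex p S (\<lambda>_. c) = c"
  using assms by (induction S) (simp_all add: bern_ex_insert algebra_simps)

lemma bern_ex_mono:
  assumes "\<And>e. e \<in> S \<Longrightarrow> p e \<in> {0..1}" "\<And>a. a \<subseteq> S \<Longrightarrow> F a \<le> G a"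
  shows "bern_ex p S F \<le> bern_ex p S G"
  unfolding bern_ex_def using assms
  by (intro sum_mono mult_left_mono prod_nonneg) auto

text \<open>Fubini's theorem for two independent groups of trials.\<close>

lemma bern_ex_Un:
  assumes "finite S1" "finite S2" "S1 \<inter> S2 = {}"
  shows "bern_ex p (S1 \<union> S2) F = bern_ex p S2 (\<lambda>a2. bern_ex p S1 (\<lambda>a1. F (a1 \<union> a2)))"
  using assms
proof (induction S1 arbitrary: F)
  case (insert e S1)
  then have "bern_ex p (insert e S1 \<union> S2) F =
    p e * bern_ex p (S1 \<union> S2) (\<lambda>a. F (insert e a)) + (1 - p e) * bern_ex p (S1 \<union> S2) F"
    by (simp add: bern_ex_insert)
  with insert show ?case by (simp add: bern_ex_insert bern_ex_add bern_ex_cmult)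
qed simp

lemma bern_ex_prod:
  assumes "finite S"
  shows "bern_ex p S (\<lambda>a. \<Prod>e\<in>S. g e (e \<in> a)) = (\<Prod>e\<in>S. p e * g e True + (1 - p e) * g e False)"
  using assms
proof (induction S)
  case (insert e S)
  have 1: "bern_ex p S (\<lambda>a. \<Prod>x\<in>insert e S. g x (x \<in> insert e a)) =
    bern_ex p S (\<lambda>a. g e True * (\<Prod>x\<in>S. g x (x \<in> a)))"
  proof (rule bern_ex_cong)
    fix a
    have "(\<Prod>x\<in>S. g x (x \<in> insert e a)) = (\<Prod>x\<in>S. g x (x \<in> a))"
    proof (rule prod.cong[OF refl])
      fix x assume "x \<in> S"
      then have "x \<noteq> e" using insert(2) by auto
      then show "g x (x \<in> insert e a) = g x (x \<in> a)" by simp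
    qed
    then show "(\<Prod>x\<in>insert e S. g x (x \<in> insert e a)) = g e True * (\<Prod>x\<in>S. g x (x \<in> a))"
      using insert by simp
  qed
  have 2: "bern_ex p S (\<lambda>a. \<Prod>x\<in>insert e S. g x (x \<in> a)) =
    bern_ex p S (\<lambda>a. g e False * (\<Prod>x\<in>S. g x (x \<in> a)))"
  proof (rule bern_ex_cong)
    fix a assume "a \<subseteq> S"
    then have "(e \<in> a) = False" using insert(2) by auto
    then show "(\<Prod>x\<in>insert e S. g x (x \<in> a)) = g e False * (\<Prod>x\<in>S. g x (x \<in> a))"
      using insert by simp
  qed
  show ?case
    unfolding bern_ex_insert[OF insert(1,2)] 1 2
    unfolding bern_ex_cmult insert.IH prod.insert[OF insert(1,2)]
    by (simp add: algebra_simps)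
qed simp

section \<open>Exponential moments and tail bounds\<close>

lemma exp_le_quadratic:
  fixes x :: real
  assumes "\<bar>x\<bar> \<le> 1"
  shows "exp x \<le> 1 + x + x\<^sup>2"
proof (cases "0 \<le> x")
  case True
  then show ?thesis using assms exp_bound[of x] by simp
next
  case False
  define y where "y = - x"
  have y: "0 < y" using False by (simp add: y_def)
  have "1 + y \<le> exp y" by (rule exp_ge_add_one_self)
  then have "exp x \<le> 1 / (1 + y)" using y by (simp add: y_def exp_minus field_simps)
  also have "\<dots> \<le> 1 - y + y\<^sup>2"
  proof -
    have "(1 - y + y\<^sup>2) * (1 + y) = 1 + y ^ 3"
      by (simp add: algebra_simps power2_eq_square power3_eq_cube)
    then have "1 \<le> (1 - y + y\<^sup>2) * (1 + y)" using y by simp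
    then show ?thesis using y by (simp add: field_simps)
  qed
  finally show ?thesis by (simp add: y_def)
qed

text \<open>Applying \<open>1 + x \<le> exp x\<close> after extracting the centring keeps the factor
  \<open>p\<close> in the exponent. A bound by the range alone would lose it, and with it the gain
  from sparsity.\<close>

lemma bernoulli_mgf:
  fixes p c :: real
  assumes p: "0 \<le> p" and c: "\<bar>c\<bar> \<le> 1"
  shows "p * exp (c * (1 - p)) + (1 - p) * exp (c * (0 - p)) \<le> exp (p * c\<^sup>2)"
proof -
  have "p * exp (c * (1 - p)) + (1 - p) * exp (c * (0 - p)) = exp (- (c * p)) * (1 + p * (exp c - 1))"
    by (simp add: algebra_simps exp_diff exp_minus divide_inverse)
  also have "\<dots> \<le> exp (- (c * p)) * exp (p * (exp c - 1))"
    using exp_ge_add_one_self by (intro mult_left_mono) auto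
  also have "\<dots> = exp (p * (exp c - 1 - c))"
    by (simp add: exp_add[symmetric] algebra_simps)
  also have "\<dots> \<le> exp (p * c\<^sup>2)"
    using exp_le_quadratic[OF c] p by (simp add: mult_left_mono)
  finally show ?thesis .
qed

lemma bern_mgf:
  assumes S: "finite S" and p: "\<And>e. e \<in> S \<Longrightarrow> p e \<in> {0..1}" and c: "\<And>e. e \<in> S \<Longrightarrow> \<bar>c e\<bar> \<le> 1"
  shows "bern_ex p S (\<lambda>a. exp (\<Sum>e\<in>S. c e * centered p a e)) \<le> exp (\<Sum>e\<in>S. p e * (c e)\<^sup>2)"
proof -
  have "bern_ex p S (\<lambda>a. exp (\<Sum>e\<in>S. c e * centered p a e)) =
    bern_ex p S (\<lambda>a. \<Prod>e\<in>S. exp (c e * (of_bool (e \<in> a) - p e)))"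
    by (simp add: exp_sum[OF S] centered_def)
  also have "\<dots> = (\<Prod>e\<in>S. p e * exp (c e * (1 - p e)) + (1 - p e) * exp (c e * (0 - p e)))"
    using bern_ex_prod[OF S, of p "\<lambda>e b. exp (c e * (of_bool b - p e))"] by simp
  also have "\<dots> \<le> (\<Prod>e\<in>S. exp (p e * (c e)\<^sup>2))"
    using p c by (intro prod_mono conjI bernoulli_mgf add_nonneg_nonneg mult_nonneg_nonneg) auto
  finally show ?thesis by (simp add: exp_sum[OF S])
qed

lemma bern_pr_mono:
  assumes "\<And>e. e \<in> S \<Longrightarrow> p e \<in> {0..1}" "\<And>a. a \<subseteq> S \<Longrightarrow> Q a \<Longrightarrow> R a"
  shows "bern_pr p S Q \<le> bern_pr p S R"
  unfolding bern_pr_def using assms by (intro bern_ex_mono) auto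

lemma bern_pr_disj:
  assumes "\<And>e. e \<in> S \<Longrightarrow> p e \<in> {0..1}"
  shows "bern_pr p S (\<lambda>a. Q a \<or> R a) \<le> bern_pr p S Q + bern_pr p S R"
  unfolding bern_pr_def bern_ex_add[symmetric] using assms by (intro bern_ex_mono) auto

lemma bern_pr_bex:
  assumes "\<And>e. e \<in> S \<Longrightarrow> p e \<in> {0..1}" "finite I" "finite S" "\<And>i. i \<in> I \<Longrightarrow> bern_pr p S (Q i) \<le> \<epsilon>"
  shows "bern_pr p S (\<lambda>a. \<exists>i\<in>I. Q i a) \<le> real (card I) * \<epsilon>"
  using assms(2,4)
proof (induction I)
  case empty
  then show ?case using bern_ex_const[OF assms(3), of p 0] by (simp add: bern_pr_def)
next
  case (insert i I)
  have "bern_pr p S (\<lambda>a. \<exists>i\<in>insert i I. Q i a) \<le> bern_pr p S (Q i) + bern_pr p S (\<lambda>a. \<exists>i\<in>I. Q i a)"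
    using bern_pr_disj[where Q = "Q i" and R = "\<lambda>a. \<exists>i\<in>I. Q i a", OF assms(1)] by simp
  with insert show ?case by (simp add: algebra_simps) (smt (verit))
qed

text \<open>The trials outside \<open>S1\<close> are frozen; a bound that holds for each frozen
  outcome survives averaging over them.\<close>

lemma bern_pr_condition:
  assumes "\<And>e. e \<in> S \<Longrightarrow> p e \<in> {0..1}" "finite S" "S1 \<subseteq> S"
    "\<And>a2. a2 \<subseteq> S - S1 \<Longrightarrow> bern_pr p S1 (\<lambda>a1. Q (a1 \<union> a2)) \<le> \<epsilon>"
  shows "bern_pr p S Q \<le> \<epsilon>"
proof -
  have "S1 \<union> (S - S1) = S" using assms(3) by auto
  then have "bern_pr p S Q = bern_ex p (S1 \<union> (S - S1)) (\<lambda>a. of_bool (Q a))" by (simp add: bern_pr_def)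
  also have "\<dots> = bern_ex p (S - S1) (\<lambda>a2. bern_pr p S1 (\<lambda>a1. Q (a1 \<union> a2)))"
    unfolding bern_pr_def using assms(2,3) by (intro bern_ex_Un) (auto intro: finite_subset)
  also have "\<dots> \<le> bern_ex p (S - S1) (\<lambda>_. \<epsilon>)"
    using assms by (intro bern_ex_mono) auto
  also have "\<dots> = \<epsilon>" using assms(2) by (intro bern_ex_const) auto
  finally show ?thesis .
qed

lemma bern_pr_exp_markov:
  assumes "\<And>e. e \<in> S \<Longrightarrow> p e \<in> {0..1}" and "\<And>a. a \<subseteq> S \<Longrightarrow> Q a \<Longrightarrow> s \<le> X a"
  shows "bern_pr p S Q \<le> exp (- s) * bern_ex p S (\<lambda>a. exp (X a))"
proof -
  have "bern_pr p S Q \<le> bern_ex p S (\<lambda>a. exp (- s) * exp (X a))"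
    unfolding bern_pr_def using assms(1)
  proof (rule bern_ex_mono)
    fix a assume a: "a \<subseteq> S"
    show "of_bool (Q a) \<le> exp (- s) * exp (X a)"
      using assms(2)[OF a] by (auto simp: exp_add[symmetric])
  qed
  then show ?thesis by (simp add: bern_ex_cmult)
qed

text \<open>Exponential Markov inequality with parameter \<open>r\<close>: the logarithm of the
  moment is at most \<open>r\<^sup>2 * W\<close>, hence at most \<open>\<tau>\<close>, and the
  threshold is built so that \<open>r\<close> times it is at least
  \<open>2 * \<tau>\<close>.\<close>

lemma bern_bernstein_upper:
  assumes S: "finite S" and p: "\<And>e. e \<in> S \<Longrightarrow> p e \<in> {0..1}"
    and W: "0 < W" "(\<Sum>e\<in>S. p e * (c e)\<^sup>2) \<le> W" and B: "0 < B" "\<And>e. e \<in> S \<Longrightarrow> \<bar>c e\<bar> \<le> B"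
    and \<tau>: "0 < \<tau>"
  shows "bern_pr p S (\<lambda>a. 2 * sqrt (W * \<tau>) + 2 * B * \<tau> < (\<Sum>e\<in>S. c e * centered p a e)) \<le> exp (- \<tau>)"
proof -
  \<comment> \<open>\<open>sqrt (\<tau> / W)\<close> balances the moment against
    \<open>\<tau>\<close>; the cap \<open>1 / B\<close> keeps every exponent in the range of the
    quadratic bound. Whichever is the minimum, one summand of the threshold alone yields
    \<open>2 * \<tau>\<close>.\<close>
  define r where "r = min (1 / B) (sqrt (\<tau> / W))"
  define s where "s = 2 * sqrt (W * \<tau>) + 2 * B * \<tau>"
  have r: "0 < r" "r \<le> 1 / B" "r \<le> sqrt (\<tau> / W)" using W B \<tau> by (auto simp: r_def)
  have "r\<^sup>2 \<le> (sqrt (\<tau> / W))\<^sup>2" using r by (intro power_mono) auto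
  then have rW: "r\<^sup>2 * W \<le> \<tau>" using W \<tau> by (simp add: field_simps)
  have rs: "2 * \<tau> \<le> r * s"
  proof (cases "1 / B \<le> sqrt (\<tau> / W)")
    case True
    then have "r * s = 1 / B * (2 * sqrt (W * \<tau>)) + 2 * \<tau>"
      using B by (simp add: r_def s_def distrib_left min_def)
    then show ?thesis using B W \<tau> by simp
  next
    case False
    then have "r * s = 2 * (sqrt (\<tau> / W) * sqrt (W * \<tau>)) + sqrt (\<tau> / W) * (2 * B * \<tau>)"
      by (simp add: r_def s_def distrib_left min_def mult_ac)
    also have "sqrt (\<tau> / W) * sqrt (W * \<tau>) = \<tau>"
      using W \<tau> by (simp add: real_sqrt_mult[symmetric])
    finally show ?thesis using B W \<tau> by simp
  qed
  have "bern_pr p S (\<lambda>a. s < (\<Sum>e\<in>S. c e * centered p a e)) \<le>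
    exp (- (r * s)) * bern_ex p S (\<lambda>a. exp (r * (\<Sum>e\<in>S. c e * centered p a e)))"
    by (rule bern_pr_exp_markov[OF p]) (use r in auto)
  also have "bern_ex p S (\<lambda>a. exp (r * (\<Sum>e\<in>S. c e * centered p a e))) =
    bern_ex p S (\<lambda>a. exp (\<Sum>e\<in>S. (r * c e) * centered p a e))"
    by (simp add: sum_distrib_left mult.assoc)
  also have "\<dots> \<le> exp (\<Sum>e\<in>S. p e * (r * c e)\<^sup>2)"
  proof (rule bern_mgf[OF S p])
    fix e assume "e \<in> S"
    have "\<bar>r * c e\<bar> \<le> r * B" using r B(2)[OF \<open>e \<in> S\<close>] by (simp add: abs_mult)
    also have "\<dots> \<le> 1" using r B by (simp add: field_simps)
    finally show "\<bar>r * c e\<bar> \<le> 1" .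
  qed
  also have "(\<Sum>e\<in>S. p e * (r * c e)\<^sup>2) = r\<^sup>2 * (\<Sum>e\<in>S. p e * (c e)\<^sup>2)"
    by (simp add: sum_distrib_left power_mult_distrib mult_ac)
  also have "\<dots> \<le> r\<^sup>2 * W" by (rule mult_left_mono[OF W(2)]) simp
  also have "\<dots> \<le> \<tau>" by (rule rW)
  finally have "bern_pr p S (\<lambda>a. s < (\<Sum>e\<in>S. c e * centered p a e)) \<le> exp (- (r * s)) * exp \<tau>" by simp
  also have "\<dots> = exp (\<tau> - r * s)" by (simp add: exp_add[symmetric])
  also have "\<dots> \<le> exp (- \<tau>)" using rs by simp
  finally show ?thesis unfolding s_def .
qed

lemma bern_bernstein:
  assumes S: "finite S" and p: "\<And>e. e \<in> S \<Longrightarrow> p e \<in> {0..1}"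
    and W: "0 < W" "(\<Sum>e\<in>S. p e * (c e)\<^sup>2) \<le> W" and B: "0 < B" "\<And>e. e \<in> S \<Longrightarrow> \<bar>c e\<bar> \<le> B"
    and \<tau>: "0 < \<tau>"
  shows "bern_pr p S (\<lambda>a. 2 * sqrt (W * \<tau>) + 2 * B * \<tau> < \<bar>\<Sum>e\<in>S. c e * centered p a e\<bar>) \<le> 2 * exp (- \<tau>)"
proof -
  define s where "s = 2 * sqrt (W * \<tau>) + 2 * B * \<tau>"
  have "bern_pr p S (\<lambda>a. s < \<bar>\<Sum>e\<in>S. c e * centered p a e\<bar>) \<le>
    bern_pr p S (\<lambda>a. s < (\<Sum>e\<in>S. c e * centered p a e) \<or> s < (\<Sum>e\<in>S. (- c e) * centered p a e))"
    by (rule bern_pr_mono[OF p]) (auto simp: sum_negf abs_if split: if_splits)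
  also have "\<dots> \<le> bern_pr p S (\<lambda>a. s < (\<Sum>e\<in>S. c e * centered p a e)) +
    bern_pr p S (\<lambda>a. s < (\<Sum>e\<in>S. (- c e) * centered p a e))"
    by (rule bern_pr_disj[OF p])
  also have "\<dots> \<le> exp (- \<tau>) + exp (- \<tau>)"
    unfolding s_def using assms by (intro add_mono bern_bernstein_upper) auto
  finally show ?thesis by (simp add: s_def)
qed

text \<open>The offset \<open>x\<close> makes the induction go through: fixing the outcome of one
  trial merely shifts it.\<close>

lemma bern_second_moment:
  assumes "finite S"
  shows "bern_ex p S (\<lambda>a. (x + (\<Sum>e\<in>S. c e * centered p a e))\<^sup>2) = x\<^sup>2 + (\<Sum>e\<in>S. p e * (1 - p e) * (c e)\<^sup>2)"
  using assms
proof (induction S arbitrary: x)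
  case (insert e S)
  have 1: "bern_ex p S (\<lambda>a. (x + (\<Sum>e'\<in>insert e S. c e' * centered p (insert e a) e'))\<^sup>2) =
    bern_ex p S (\<lambda>a. ((x + c e * (1 - p e)) + (\<Sum>e\<in>S. c e * centered p a e))\<^sup>2)"
  proof (rule bern_ex_cong)
    fix a
    have "(\<Sum>e'\<in>S. c e' * centered p (insert e a) e') = (\<Sum>e\<in>S. c e * centered p a e)"
      by (rule sum.cong) (use insert in \<open>auto simp: centered_def\<close>)
    then show "(x + (\<Sum>e'\<in>insert e S. c e' * centered p (insert e a) e'))\<^sup>2 =
      ((x + c e * (1 - p e)) + (\<Sum>e\<in>S. c e * centered p a e))\<^sup>2"
      using insert by (simp add: centered_def add.assoc)
  qed
  have 2: "bern_ex p S (\<lambda>a. (x + (\<Sum>e'\<in>insert e S. c e' * centered p a e'))\<^sup>2) =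
    bern_ex p S (\<lambda>a. ((x - c e * p e) + (\<Sum>e\<in>S. c e * centered p a e))\<^sup>2)"
  proof (rule bern_ex_cong)
    fix a assume "a \<subseteq> S"
    then have "centered p a e = - p e" using insert(2) by (auto simp: centered_def)
    then show "(x + (\<Sum>e'\<in>insert e S. c e' * centered p a e'))\<^sup>2 =
      ((x - c e * p e) + (\<Sum>e\<in>S. c e * centered p a e))\<^sup>2"
      using insert(1,2) by (simp add: algebra_simps)
  qed
  show ?case
    unfolding bern_ex_insert[OF insert(1,2)] 1 2
    unfolding insert.IH sum.insert[OF insert(1,2)]
    by (simp add: algebra_simps power2_eq_square)
qed simp

text \<open>Dividing by \<open>D\<^sup>2\<close> puts the square into the unit interval, where the
  exponential lies below \<open>1 + 2 * y\<close>. The exponential moment is thereby controlled by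
  the variance.\<close>

lemma bern_exp_square:
  assumes S: "finite S" and p: "\<And>e. e \<in> S \<Longrightarrow> p e \<in> {0..1}" and D: "0 < D"
    and X: "\<And>a. a \<subseteq> S \<Longrightarrow> \<bar>\<Sum>e\<in>S. c e * centered p a e\<bar> \<le> D"
    and v: "(\<Sum>e\<in>S. p e * (c e)\<^sup>2) \<le> v"
  shows "bern_ex p S (\<lambda>a. exp ((\<Sum>e\<in>S. c e * centered p a e)\<^sup>2 / D\<^sup>2)) \<le> exp (2 * v / D\<^sup>2)"
proof -
  have "bern_ex p S (\<lambda>a. exp ((\<Sum>e\<in>S. c e * centered p a e)\<^sup>2 / D\<^sup>2)) \<le>
    bern_ex p S (\<lambda>a. 1 + 2 / D\<^sup>2 * (0 + (\<Sum>e\<in>S. c e * centered p a e))\<^sup>2)"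
  proof (rule bern_ex_mono[OF p])
    fix a assume a: "a \<subseteq> S"
    define y where "y = (\<Sum>e\<in>S. c e * centered p a e)\<^sup>2 / D\<^sup>2"
    have "(\<Sum>e\<in>S. c e * centered p a e)\<^sup>2 \<le> D\<^sup>2"
      using X[OF a] D by (simp add: abs_le_square_iff[symmetric])
    then have y: "0 \<le> y" "y \<le> 1" using D by (auto simp: y_def)
    then have "exp y \<le> 1 + y + y\<^sup>2" by (intro exp_bound)
    also have "y\<^sup>2 \<le> y" using y by (simp add: power2_eq_square mult_left_le)
    finally show "exp ((\<Sum>e\<in>S. c e * centered p a e)\<^sup>2 / D\<^sup>2) \<le> 1 + 2 / D\<^sup>2 * (0 +
        (\<Sum>e\<in>S. c e * centered p a e))\<^sup>2"
      by (simp add: y_def)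
  qed
  also have "\<dots> = 1 + 2 / D\<^sup>2 * (\<Sum>e\<in>S. p e * (1 - p e) * (c e)\<^sup>2)"
    by (subst bern_ex_add, subst bern_ex_cmult, subst bern_second_moment[OF S]) (simp add: bern_ex_const[OF S])
  also have "(\<Sum>e\<in>S. p e * (1 - p e) * (c e)\<^sup>2) \<le> (\<Sum>e\<in>S. p e * (c e)\<^sup>2)"
    using p by (intro sum_mono mult_right_mono) (auto simp: mult_left_le)
  also have "\<dots> \<le> v" by (rule v)
  also have "1 + 2 / D\<^sup>2 * v \<le> exp (2 / D\<^sup>2 * v)" by (rule exp_ge_add_one_self)
  finally show ?thesis using D by (simp add: divide_right_mono mult_left_mono)
qed

text \<open>Disjoint blocks of trials are independent, so the exponential moments of the squares
  multiply.\<close>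

lemma bern_exp_sum_squares:
  assumes J: "finite J" and S: "\<And>j. j \<in> J \<Longrightarrow> finite (S j)" and dj: "disjoint_family_on S J"
    and p: "\<And>j e. j \<in> J \<Longrightarrow> e \<in> S j \<Longrightarrow> p e \<in> {0..1}" and D: "0 < D"
    and X: "\<And>j a. j \<in> J \<Longrightarrow> a \<subseteq> S j \<Longrightarrow> \<bar>\<Sum>e\<in>S j. c e * centered p a e\<bar> \<le> D"
    and v: "\<And>j. j \<in> J \<Longrightarrow> (\<Sum>e\<in>S j. p e * (c e)\<^sup>2) \<le> v"
  shows "bern_ex p (\<Union>j\<in>J. S j) (\<lambda>a. exp (\<Sum>j\<in>J. (\<Sum>e\<in>S j. c e * centered p a e)\<^sup>2 / D\<^sup>2))
    \<le> exp (real (card J) * (2 * v / D\<^sup>2))"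
  using J S dj p X v
proof (induction J)
  case (insert j J)
  define U where "U = (\<Union>j\<in>J. S j)"
  have disj: "S j \<inter> U = {}"
    using insert.prems(2) insert.hyps(2) by (auto simp: U_def disjoint_family_on_def)
  have fin: "finite (S j)" "finite U" using insert.prems(1) insert.hyps(1) by (auto simp: U_def)
  define E1 where "E1 = (\<lambda>a. exp ((\<Sum>e\<in>S j. c e * centered p a e)\<^sup>2 / D\<^sup>2))"
  define E2 where "E2 = (\<lambda>a. exp (\<Sum>j\<in>J. (\<Sum>e\<in>S j. c e * centered p a e)\<^sup>2 / D\<^sup>2))"
  have "bern_ex p (\<Union>j\<in>insert j J. S j) (\<lambda>a. exp (\<Sum>j\<in>insert j J. (\<Sum>e\<in>S j. c e * centered p a e)\<^sup>2 / D\<^sup>2))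
    = bern_ex p (S j \<union> U) (\<lambda>a. E1 a * E2 a)"
    using insert.hyps by (simp add: U_def E1_def E2_def exp_add)
  also have "\<dots> = bern_ex p U (\<lambda>a2. bern_ex p (S j) (\<lambda>a1. E1 (a1 \<union> a2) * E2 (a1 \<union> a2)))"
    by (rule bern_ex_Un[OF fin disj])
  also have "\<dots> = bern_ex p U (\<lambda>a2. bern_ex p (S j) (\<lambda>a1. E1 a1 * E2 a2))"
  proof (intro bern_ex_cong)
    fix a2 a1 assume a: "a2 \<subseteq> U" "a1 \<subseteq> S j"
    have "centered p (a1 \<union> a2) e = centered p a1 e" if "e \<in> S j" for e
      using that a disj by (auto simp: centered_def)
    then have 1: "E1 (a1 \<union> a2) = E1 a1" by (simp add: E1_def)
    have "centered p (a1 \<union> a2) e = centered p a2 e" if "e \<in> S j'" "j' \<in> J" for e j'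
      using that a disj by (auto simp: centered_def U_def)
    then have 2: "E2 (a1 \<union> a2) = E2 a2" by (simp add: E2_def)
    show "E1 (a1 \<union> a2) * E2 (a1 \<union> a2) = E1 a1 * E2 a2" by (simp add: 1 2)
  qed
  also have "\<dots> = bern_ex p (S j) E1 * bern_ex p U E2"
    by (simp add: bern_ex_cmult_right bern_ex_cmult)
  also have "\<dots> \<le> exp (2 * v / D\<^sup>2) * exp (real (card J) * (2 * v / D\<^sup>2))"
  proof (intro mult_mono)
    show "bern_ex p (S j) E1 \<le> exp (2 * v / D\<^sup>2)"
      unfolding E1_def using insert.prems fin D by (intro bern_exp_square) auto
    show "bern_ex p U E2 \<le> exp (real (card J) * (2 * v / D\<^sup>2))"
      unfolding E2_def U_def
      by (rule insert.IH) (use insert.prems in \<open>auto simp: disjoint_family_on_def\<close>)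
    have "bern_ex p U (\<lambda>_. 0) \<le> bern_ex p U E2"
      by (rule bern_ex_mono) (use insert.prems in \<open>auto simp: U_def E2_def\<close>)
    then show "0 \<le> bern_ex p U E2" by (simp add: bern_ex_const fin)
  qed simp
  also have "\<dots> = exp (real (card (insert j J)) * (2 * v / D\<^sup>2))"
    using insert.hyps by (simp add: exp_add[symmetric] algebra_simps add_divide_distrib)
  finally show ?case .
qed simp

text \<open>Exponential Markov inequality with parameter \<open>1 / D\<^sup>2\<close>. The bound on
  the mean is only doubled, and the deviation \<open>D\<^sup>2 * \<tau>\<close> does not grow with
  the number of blocks, so a crude bound \<open>D\<close> on a single form is affordable.\<close>

lemma bern_sum_squares_tail:
  assumes J: "finite J" and S: "\<And>j. j \<in> J \<Longrightarrow> finite (S j)" and dj: "disjoint_family_on S J"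
    and p: "\<And>j e. j \<in> J \<Longrightarrow> e \<in> S j \<Longrightarrow> p e \<in> {0..1}" and D: "0 < D"
    and X: "\<And>j a. j \<in> J \<Longrightarrow> a \<subseteq> S j \<Longrightarrow> \<bar>\<Sum>e\<in>S j. c e * centered p a e\<bar> \<le> D"
    and v: "\<And>j. j \<in> J \<Longrightarrow> (\<Sum>e\<in>S j. p e * (c e)\<^sup>2) \<le> v"
  shows "bern_pr p (\<Union>j\<in>J. S j)
    (\<lambda>a. 2 * real (card J) * v + D\<^sup>2 * \<tau> < (\<Sum>j\<in>J. (\<Sum>e\<in>S j. c e * centered p a e)\<^sup>2)) \<le> exp (- \<tau>)"
proof -
  define N where "N = real (card J) * (2 * v / D\<^sup>2)"
  have "bern_pr p (\<Union>j\<in>J. S j)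
    (\<lambda>a. 2 * real (card J) * v + D\<^sup>2 * \<tau> < (\<Sum>j\<in>J. (\<Sum>e\<in>S j. c e * centered p a e)\<^sup>2)) \<le>
    exp (- (N + \<tau>)) * bern_ex p (\<Union>j\<in>J. S j) (\<lambda>a. exp (\<Sum>j\<in>J. (\<Sum>e\<in>S j. c e * centered p a e)\<^sup>2 / D\<^sup>2))"
  proof (rule bern_pr_exp_markov)
    fix a assume "2 * real (card J) * v + D\<^sup>2 * \<tau> < (\<Sum>j\<in>J. (\<Sum>e\<in>S j. c e * centered p a e)\<^sup>2)"
    then have "(2 * real (card J) * v + D\<^sup>2 * \<tau>) / D\<^sup>2 \<le> (\<Sum>j\<in>J. (\<Sum>e\<in>S j. c e * centered p a e)\<^sup>2) / D\<^sup>2"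
      by (intro divide_right_mono) auto
    then show "N + \<tau> \<le> (\<Sum>j\<in>J. (\<Sum>e\<in>S j. c e * centered p a e)\<^sup>2 / D\<^sup>2)"
      using D by (simp add: N_def add_divide_distrib sum_divide_distrib mult_ac)
  qed (use p in auto)
  also have "\<dots> \<le> exp (- (N + \<tau>)) * exp N"
    unfolding N_def by (intro mult_left_mono bern_exp_sum_squares[OF assms]) auto
  also have "\<dots> = exp (- \<tau>)" by (simp add: exp_add[symmetric])
  finally show ?thesis .
qed

section \<open>The model given the latent positions\<close>

text \<open>The smaller node comes first, so that both entries of a symmetric pair refer to one
  Bernoulli variable.\<close>

definition edge_slot :: "nat \<Rightarrow> nat \<Rightarrow> nat \<Rightarrow> nat \<times> nat \<times> nat" where
  "edge_slot k i j = (k, min i j, max i j)"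

definition slot_prob ::
  "(real \<Rightarrow> real \<Rightarrow> real \<Rightarrow> real) \<Rightarrow> real \<Rightarrow> (nat \<Rightarrow> real) \<Rightarrow> (nat \<Rightarrow> 'a \<Rightarrow> real) \<Rightarrow> 'a \<Rightarrow> nat \<times> nat \<times> nat \<Rightarrow> real" where
  "slot_prob f \<rho> T \<xi> \<omega> = (\<lambda>(k, i, j). edge_prob f \<rho> \<xi> \<omega> (T k) i j)"

lemma finite_edge_slots: "finite (edge_slots n m)"
proof -
  have "edge_slots n m \<subseteq> {1..m} \<times> {1..n} \<times> {1..n}" by (auto simp: edge_slots_def)
  then show ?thesis by (rule finite_subset) auto
qed

lemma edge_slot_in_edge_slots:
  assumes "k \<in> {1..m}" "i \<in> {1..n}" "j \<in> {1..n}"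
  shows "edge_slot k i j \<in> edge_slots n m"
  using assms by (auto simp: edge_slot_def edge_slots_def min_def max_def)

lemma edge_slot_eq_iff: "edge_slot k i j = edge_slot k' i' j' \<longleftrightarrow> k = k' \<and> (i = i' \<and> j = j' \<or> i = j' \<and> j =
    i')"
  by (auto simp: edge_slot_def min_def max_def)

lemma bernoulli_weight_split:
  fixes p :: "'e \<Rightarrow> real"
  assumes "finite S" "a \<subseteq> S"
  shows "(\<Prod>e\<in>S. if e \<in> a then p e else 1 - p e) = (\<Prod>e\<in>a. p e) * (\<Prod>e\<in>S - a. 1 - p e)"
proof -
  have "S \<inter> {e. e \<in> a} = a" "S \<inter> - {e. e \<in> a} = S - a" using assms(2) by auto
  then show ?thesis using assms(1) by (simp add: prod.If_cases)
qed

context sparse_graphon_sample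
begin

abbreviation "latent \<equiv> latent_algebra M n \<xi>"
abbreviation "slots \<equiv> edge_slots n m"
abbreviation "sprob \<equiv> slot_prob f \<rho> T \<xi>"

definition present :: "'a \<Rightarrow> (nat \<times> nat \<times> nat) set" where
  "present \<omega> = {e \<in> slots. \<omega> \<in> edge_event M A e}"

lemma space_latent: "space latent = space M"
  by (simp add: latent_algebra_def)

lemma latent_map_measurable: "(\<lambda>\<omega>. \<lambda>i\<in>{1..n}. \<xi> i \<omega>) \<in> measurable M (PiM {1..n} (\<lambda>_. borel))"
  using latent_indep by (intro measurable_restrict) (auto simp: indep_vars_def)

lemma latent_subalgebra: "subalgebra M latent"
proof -
  have "sets latent \<subseteq> sets M"
    unfolding latent_algebra_def using latent_map_measurable
    by (auto simp: sets_vimage_algebra2 measurable_def space_PiM)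
  then show ?thesis by (simp add: subalgebra_def space_latent)
qed

sublocale latent: finite_measure_subalgebra M latent
  by unfold_locales (rule latent_subalgebra)

lemma latent_measurable: "i \<in> {1..n} \<Longrightarrow> \<xi> i \<in> borel_measurable latent"
proof -
  assume i: "i \<in> {1..n}"
  have "(\<lambda>\<omega>. \<lambda>i\<in>{1..n}. \<xi> i \<omega>) \<in> measurable latent (PiM {1..n} (\<lambda>_. borel))"
    unfolding latent_algebra_def by (rule measurable_vimage_algebra1) (auto simp: space_PiM)
  then have "(\<lambda>\<omega>. (\<lambda>i\<in>{1..n}. \<xi> i \<omega>) i) \<in> borel_measurable latent"
    by (rule measurable_compose) (use i in measurable)
  then show ?thesis using i by simp
qed

lemma latent_event: "X \<in> sets latent \<Longrightarrow> X \<in> sets M"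
  using latent_subalgebra by (auto simp: subalgebra_def)

lemma edge_event_measurable [measurable]: "e \<in> slots \<Longrightarrow> edge_event M A e \<in> sets M"
proof -
  assume "e \<in> slots"
  then obtain k i j where e: "e = (k, i, j)" and kij: "k \<in> {1..m}" "i \<in> {1..n}" "j \<in> {1..n}"
    by (auto simp: edge_slots_def)
  have [measurable]: "A k i j \<in> borel_measurable M" by (rule adj_measurable[OF kij])
  show ?thesis unfolding e edge_event_def by simp
qed

lemma present_subset: "present \<omega> \<subseteq> slots"
  by (auto simp: present_def)

lemma adjacency_present:
  assumes "\<omega> \<in> space M" "k \<in> {1..m}" "i \<in> {1..n}" "j \<in> {1..n}"
  shows "A k i j \<omega> = of_bool (edge_slot k i j \<in> present \<omega>)"
proof -
  have "A k i j \<omega> = A k (min i j) (max i j) \<omega>"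
    using adj_sym[OF assms(2-4,1)] by (auto simp: min_def max_def)
  moreover have "A k (min i j) (max i j) \<omega> \<in> {0, 1}"
    using adj_binary assms by (auto simp: min_def max_def)
  ultimately show ?thesis
    using assms edge_slot_in_edge_slots[OF assms(2-4)]
    by (auto simp: present_def edge_event_def edge_slot_def)
qed

lemma edge_prob_measurable:
  assumes f: "time_varying_graphon f" and "i \<in> {1..n}" "j \<in> {1..n}" "t \<in> {0..1}"
  shows "(\<lambda>\<omega>. edge_prob f \<rho> \<xi> \<omega> t i j) \<in> borel_measurable latent"
proof -
  have [measurable]: "\<xi> i \<in> borel_measurable latent" "\<xi> j \<in> borel_measurable latent"
    using assms by (auto intro: latent_measurable)
  have "(\<lambda>\<omega>. (\<xi> i \<omega>, \<xi> j \<omega>, t)) \<in> measurable latent (restrict_space borel ({0..1} \<times> {0..1} \<times> {0..1}))"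
    by (rule measurable_restrict_space2) (use assms latent_range in \<open>auto simp: space_latent\<close>)
  moreover have "(\<lambda>(x, y, t). f x y t) \<in> borel_measurable (restrict_space borel ({0..1} \<times> {0..1} \<times> {0..1}))"
    using f by (simp add: time_varying_graphon_def)
  ultimately have "(\<lambda>\<omega>. (\<lambda>(x, y, t). f x y t) (\<xi> i \<omega>, \<xi> j \<omega>, t)) \<in> borel_measurable latent"
    by (rule measurable_compose)
  then show ?thesis by (simp add: edge_prob_def)
qed

lemma edge_prob_range:
  assumes "time_varying_graphon f" "0 < \<rho>" "i \<in> {1..n}" "j \<in> {1..n}" "t \<in> {0..1}" "\<omega> \<in> space M"
  shows "0 \<le> edge_prob f \<rho> \<xi> \<omega> t i j" "edge_prob f \<rho> \<xi> \<omega> t i j \<le> \<rho>"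
  using assms latent_range[of i \<omega>] latent_range[of j \<omega>]
  by (auto simp: edge_prob_def time_varying_graphon_def mult_left_le)

lemma slot_prob_range:
  assumes "time_varying_graphon f" "0 < \<rho>" "\<rho> < 1" "\<And>k. k \<in> {1..m} \<Longrightarrow> T k \<in> {0..1}" "\<omega> \<in> space M" "e \<in> slots"
  shows "sprob \<omega> e \<in> {0..1}" "sprob \<omega> e \<le> \<rho>"
proof -
  obtain k i j where e: "e = (k, i, j)" and kij: "k \<in> {1..m}" "i \<in> {1..n}" "j \<in> {1..n}"
    using assms(6) by (auto simp: edge_slots_def)
  show "sprob \<omega> e \<in> {0..1}" "sprob \<omega> e \<le> \<rho>"
    using edge_prob_range[OF assms(1,2) kij(2,3) assms(4)[OF kij(1)] assms(5)] assms(3)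
    by (auto simp: e slot_prob_def)
qed

lemma slot_prob_measurable:
  assumes "time_varying_graphon f" "\<And>k. k \<in> {1..m} \<Longrightarrow> T k \<in> {0..1}" "e \<in> slots"
  shows "(\<lambda>\<omega>. sprob \<omega> e) \<in> borel_measurable latent"
proof -
  obtain k i j where e: "e = (k, i, j)" and kij: "k \<in> {1..m}" "i \<in> {1..n}" "j \<in> {1..n}"
    using assms(3) by (auto simp: edge_slots_def)
  show ?thesis
    using edge_prob_measurable[OF assms(1) kij(2,3) assms(2)[OF kij(1)]] by (simp add: e slot_prob_def)
qed

section \<open>Reduction to finitely many edge configurations\<close>

text \<open>The test function \<open>g\<close>, later the indicator of a latent event, stands for
  conditioning: the characteristic property of the conditional expectation replaces the indicator of
  an intersection, and the model assumptions then factor it.\<close>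

lemma integral_edge_intersection:
  assumes f: "time_varying_graphon f" "0 < \<rho>" "\<rho> < 1" and T: "\<And>k. k \<in> {1..m} \<Longrightarrow> T k \<in> {0..1}"
    and g: "g \<in> borel_measurable latent" "\<And>\<omega>. \<omega> \<in> space M \<Longrightarrow> g \<omega> \<in> {0..1}" and S: "S \<subseteq> slots"
  shows "(\<integral>\<omega>. g \<omega> * (\<Prod>e\<in>S. indicator (edge_event M A e) \<omega>) \<partial>M) = (\<integral>\<omega>. g \<omega> * (\<Prod>e\<in>S. sprob \<omega> e) \<partial>M)"
proof (cases "S = {}")
  case False
  have finS: "finite S" using S finite_edge_slots by (rule finite_subset)
  define E where "E = (\<Inter>e\<in>S. edge_event M A e)"
  have E [measurable]: "E \<in> sets M" unfolding E_def using False finS S by (intro sets.finite_INT) auto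
  have gM [measurable]: "g \<in> borel_measurable M" by (rule measurable_from_subalg[OF latent_subalgebra g(1)])
  have pM: "(\<lambda>\<omega>. \<Prod>e\<in>S. sprob \<omega> e) \<in> borel_measurable M"
    using S by (intro borel_measurable_prod measurable_from_subalg[OF latent_subalgebra] slot_prob_measurable f T) auto
  have "(\<Prod>e\<in>S. indicator (edge_event M A e) \<omega> :: real) = indicator E \<omega>" for \<omega>
  proof (cases "\<omega> \<in> E")
    case True
    then show ?thesis by (simp add: E_def)
  next
    case False
    then obtain e where "e \<in> S" "\<omega> \<notin> edge_event M A e" by (auto simp: E_def)
    then have "\<exists>e\<in>S. (indicator (edge_event M A e) \<omega> :: real) = 0" by (intro bexI[of _ e]) auto
    then show ?thesis using False finS by simp
  qed
  then have "(\<integral>\<omega>. g \<omega> * (\<Prod>e\<in>S. indicator (edge_event M A e) \<omega>) \<partial>M) = (\<integral>\<omega>. g \<omega> * indicator E \<omega> \<partial>M)" by simp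
  also have "\<dots> = (\<integral>\<omega>. g \<omega> * real_cond_exp M latent (indicator E) \<omega> \<partial>M)"
  proof (rule latent.real_cond_exp_intg(2)[symmetric])
    show "integrable M (\<lambda>\<omega>. g \<omega> * indicator E \<omega>)"
      by (rule integrable_const_bound[of _ 1]) (use g(2) in \<open>auto simp: abs_mult indicator_def\<close>)
  qed (use g in measurable)
  also have "\<dots> = (\<integral>\<omega>. g \<omega> * (\<Prod>e\<in>S. sprob \<omega> e) \<partial>M)"
  proof (rule integral_cong_AE)
    show "(\<lambda>\<omega>. g \<omega> * real_cond_exp M latent (indicator E) \<omega>) \<in> borel_measurable M"
      by (intro borel_measurable_times gM borel_measurable_cond_exp2)
    show "(\<lambda>\<omega>. g \<omega> * (\<Prod>e\<in>S. sprob \<omega> e)) \<in> borel_measurable M" using pM by measurable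
    have "AE \<omega> in M. \<forall>e\<in>S. real_cond_exp M latent (indicator (edge_event M A e)) \<omega> = sprob \<omega> e"
      using S adj_bernoulli by (intro AE_finite_allI[OF finS]) (auto simp: slot_prob_def split: prod.splits)
    with adj_cond_indep[OF S False]
    show "AE \<omega> in M. g \<omega> * real_cond_exp M latent (indicator E) \<omega> = g \<omega> * (\<Prod>e\<in>S. sprob \<omega> e)"
      by eventually_elim (simp add: E_def)
  qed
  finally show ?thesis .
qed simp

text \<open>The model factors only intersections of present edges. Absent edges enter by induction
  on \<open>S2\<close>: expanding one factor "one minus" leads to two integrals with fewer absent
  edges, in the same way on both sides.\<close>

lemma integral_edge_configuration:
  assumes f: "time_varying_graphon f" "0 < \<rho>" "\<rho> < 1" and T: "\<And>k. k \<in> {1..m} \<Longrightarrow> T k \<in> {0..1}"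
    and g: "g \<in> borel_measurable latent" "\<And>\<omega>. \<omega> \<in> space M \<Longrightarrow> g \<omega> \<in> {0..1}"
    and S: "finite S2" "S1 \<subseteq> slots" "S2 \<subseteq> slots" "S1 \<inter> S2 = {}"
  shows "(\<integral>\<omega>. g \<omega> * (\<Prod>e\<in>S1. indicator (edge_event M A e) \<omega>) * (\<Prod>e\<in>S2. 1 - indicator (edge_event M A e) \<omega>) \<partial>M)
    = (\<integral>\<omega>. g \<omega> * (\<Prod>e\<in>S1. sprob \<omega> e) * (\<Prod>e\<in>S2. 1 - sprob \<omega> e) \<partial>M)"
  using S
proof (induction S2 arbitrary: S1)
  case empty
  then show ?case using integral_edge_intersection[OF f T g] by simp
next
  case (insert e S2)
  have gM [measurable]: "g \<in> borel_measurable M" by (rule measurable_from_subalg[OF latent_subalgebra g(1)])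
  have int: "integrable M (\<lambda>\<omega>. g \<omega> * (\<Prod>e\<in>S. u e \<omega>) * (\<Prod>e\<in>S'. 1 - u e \<omega>))"
    if S: "S \<subseteq> slots" "S' \<subseteq> slots" and u: "\<And>e. e \<in> slots \<Longrightarrow> u e \<in> borel_measurable M"
      "\<And>e \<omega>. e \<in> slots \<Longrightarrow> \<omega> \<in> space M \<Longrightarrow> u e \<omega> \<in> {0..1}" for S S' and u :: "_ \<Rightarrow> 'a \<Rightarrow> real"
  proof (rule integrable_const_bound[of _ 1])
    show "AE \<omega> in M. norm (g \<omega> * (\<Prod>e\<in>S. u e \<omega>) * (\<Prod>e\<in>S'. 1 - u e \<omega>)) \<le> 1"
    proof (rule AE_I2)
      fix \<omega> assume w: "\<omega> \<in> space M"
      have 1: "0 \<le> (\<Prod>e\<in>S. u e \<omega>)" "(\<Prod>e\<in>S. u e \<omega>) \<le> 1"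
        using u(2)[OF _ w] S by (auto intro!: prod_nonneg prod_le_1)
      have 2: "0 \<le> (\<Prod>e\<in>S'. 1 - u e \<omega>)" "(\<Prod>e\<in>S'. 1 - u e \<omega>) \<le> 1"
        using u(2)[OF _ w] S by (auto intro!: prod_nonneg prod_le_1)
      show "norm (g \<omega> * (\<Prod>e\<in>S. u e \<omega>) * (\<Prod>e\<in>S'. 1 - u e \<omega>)) \<le> 1"
        using 1 2 g(2)[OF w] by (simp add: abs_mult mult_le_one)
    qed
    show "(\<lambda>\<omega>. g \<omega> * (\<Prod>e\<in>S. u e \<omega>) * (\<Prod>e\<in>S'. 1 - u e \<omega>)) \<in> borel_measurable M"
      using S u(1) by (intro borel_measurable_times gM borel_measurable_prod borel_measurable_diff) auto
  qed
  \<comment> \<open>Stated for arbitrary factors \<open>u\<close> because it is applied twice, to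
    the indicators of the edges and to their probabilities.\<close>
  have split: "(\<integral>\<omega>. g \<omega> * (\<Prod>e\<in>S1. u e \<omega>) * (\<Prod>e\<in>insert e S2. 1 - u e \<omega>) \<partial>M) =
    (\<integral>\<omega>. g \<omega> * (\<Prod>e\<in>S1. u e \<omega>) * (\<Prod>e\<in>S2. 1 - u e \<omega>) \<partial>M) -
    (\<integral>\<omega>. g \<omega> * (\<Prod>e\<in>insert e S1. u e \<omega>) * (\<Prod>e\<in>S2. 1 - u e \<omega>) \<partial>M)"
    if u: "\<And>e. e \<in> slots \<Longrightarrow> u e \<in> borel_measurable M"
      "\<And>e \<omega>. e \<in> slots \<Longrightarrow> \<omega> \<in> space M \<Longrightarrow> u e \<omega> \<in> {0..1}" for u :: "_ \<Rightarrow> 'a \<Rightarrow> real"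
  proof -
    have "finite S1" "e \<notin> S1" using insert.prems finite_subset[OF _ finite_edge_slots] by auto
    then have "g \<omega> * (\<Prod>e\<in>S1. u e \<omega>) * (\<Prod>e\<in>insert e S2. 1 - u e \<omega>) =
      g \<omega> * (\<Prod>e\<in>S1. u e \<omega>) * (\<Prod>e\<in>S2. 1 - u e \<omega>) -
      g \<omega> * (\<Prod>e\<in>insert e S1. u e \<omega>) * (\<Prod>e\<in>S2. 1 - u e \<omega>)" for \<omega>
      using insert.hyps by (simp add: algebra_simps)
    then show ?thesis
      using insert.prems by (simp only:) (intro Bochner_Integration.integral_diff int u, auto)
  qed
  have ind: "(indicator (edge_event M A e) :: 'a \<Rightarrow> real) \<in> borel_measurable M" if "e \<in> slots" for e
    using edge_event_measurable[OF that] by measurable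
  have sp: "(\<lambda>\<omega>. sprob \<omega> e) \<in> borel_measurable M" if "e \<in> slots" for e
    by (rule measurable_from_subalg[OF latent_subalgebra slot_prob_measurable[OF f(1) T that]])
  have IH: "(\<integral>\<omega>. g \<omega> * (\<Prod>e\<in>S. indicator (edge_event M A e) \<omega>) * (\<Prod>e\<in>S2. 1 - indicator (edge_event M A e) \<omega>) \<partial>M)
    = (\<integral>\<omega>. g \<omega> * (\<Prod>e\<in>S. sprob \<omega> e) * (\<Prod>e\<in>S2. 1 - sprob \<omega> e) \<partial>M)" if "S = S1 \<or> S = insert e S1" for S
    using that insert.prems insert.hyps by (intro insert.IH) auto
  show ?case
    using split[of "\<lambda>e. indicator (edge_event M A e)", OF ind] split[of "\<lambda>e \<omega>. sprob \<omega> e", OF sp]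
      slot_prob_range(1)[OF f T] IH[of S1] IH[of "insert e S1"]
    by (simp add: indicator_def)
qed

lemma present_event_measurable: "{\<omega> \<in> space M. present \<omega> = a} \<in> sets M"
proof (cases "a \<subseteq> slots")
  case True
  have "{\<omega> \<in> space M. present \<omega> = a} = {\<omega> \<in> space M. \<forall>e\<in>slots. (\<omega> \<in> edge_event M A e) = (e \<in> a)}"
    using True by (auto simp: present_def)
  also have "\<dots> \<in> sets M"
  proof (rule sets.sets_Collect_finite_All)
    fix e assume e: "e \<in> slots"
    have [measurable]: "edge_event M A e \<in> sets M" using e by (rule edge_event_measurable)
    show "{\<omega> \<in> space M. (\<omega> \<in> edge_event M A e) = (e \<in> a)} \<in> sets M" by measurable
  qed (rule finite_edge_slots)
  finally show ?thesis .
next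
  case False
  then have "present \<omega> \<noteq> a" for \<omega> using present_subset by auto
  then show ?thesis by simp
qed

lemma present_Collect_eq:
  "{\<omega> \<in> space M. R \<omega> (present \<omega>)} = (\<Union>a\<in>Pow slots. {\<omega> \<in> space M. R \<omega> a} \<inter> {\<omega> \<in> space M. present \<omega> = a})"
  using present_subset by auto

lemma present_Collect_measurable:
  assumes "\<And>a. a \<subseteq> slots \<Longrightarrow> {\<omega> \<in> space M. R \<omega> a} \<in> sets latent"
  shows "{\<omega> \<in> space M. R \<omega> (present \<omega>)} \<in> sets M"
  unfolding present_Collect_eq using assms finite_edge_slots
  by (intro sets.finite_UN sets.Int present_event_measurable latent_event) auto

text \<open>The event is the disjoint union, over the configurations \<open>a\<close>, of a latent
  event and \<open>present \<omega> = a\<close>. Given the latent positions the latter has the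
  product weight of \<open>a\<close>, so the probability is the integral of \<open>bern_pr\<close>,
  and a pointwise bound can be integrated.\<close>

lemma prob_present_le:
  assumes f: "time_varying_graphon f" "0 < \<rho>" "\<rho> < 1" and T: "\<And>k. k \<in> {1..m} \<Longrightarrow> T k \<in> {0..1}"
    and R: "\<And>a. a \<subseteq> slots \<Longrightarrow> {\<omega> \<in> space M. R \<omega> a} \<in> sets latent"
    and bound: "\<And>\<omega>. \<omega> \<in> space M \<Longrightarrow> bern_pr (sprob \<omega>) slots (R \<omega>) \<le> \<epsilon>"
  shows "prob {\<omega> \<in> space M. R \<omega> (present \<omega>)} \<le> \<epsilon>"
proof -
  define X where "X = (\<lambda>a. {\<omega> \<in> space M. R \<omega> a} \<inter> {\<omega> \<in> space M. present \<omega> = a})"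
  define W where "W =
      (\<lambda>\<omega> a. indicator {\<omega> \<in> space M. R \<omega> a} \<omega> * (\<Prod>e\<in>a. sprob \<omega> e) * (\<Prod>e\<in>slots - a. 1 - sprob \<omega> e))"
  have X: "X a \<in> sets M" if "a \<in> Pow slots" for a
    unfolding X_def using R that by (intro sets.Int present_event_measurable latent_event) auto
  have prob_X: "prob (X a) = (\<integral>\<omega>. W \<omega> a \<partial>M)" if a: "a \<in> Pow slots" for a
  proof -
    have ind: "(indicator {\<omega> \<in> space M. R \<omega> a} :: 'a \<Rightarrow> real) \<in> borel_measurable latent"
      using a by (intro borel_measurable_indicator R) auto
    have fin: "finite a" "finite (slots - a)" using a finite_edge_slots by (auto intro: finite_subset)
    have "indicator (X a) \<omega> = indicator {\<omega> \<in> space M. R \<omega> a} \<omega> * (\<Prod>e\<in>a. indicator (edge_event M A e) \<omega>) *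
        (\<Prod>e\<in>slots - a. 1 - indicator (edge_event M A e) \<omega> :: real)" if w: "\<omega> \<in> space M" for \<omega>
    proof (cases "present \<omega> = a")
      case True
      then have "(\<Prod>e\<in>a. indicator (edge_event M A e) \<omega>) = (1::real)"
        "(\<Prod>e\<in>slots - a. 1 - indicator (edge_event M A e) \<omega>) = (1::real)"
        by (auto simp: present_def intro!: prod.neutral)
      then show ?thesis using True w by (simp add: X_def indicator_def)
    next
      case False
      then have "(\<exists>e\<in>a. \<omega> \<notin> edge_event M A e) \<or> (\<exists>e\<in>slots - a. \<omega> \<in> edge_event M A e)"
        using a by (auto simp: present_def)
      then have "(\<Prod>e\<in>a. indicator (edge_event M A e) \<omega>) = (0::real) \<or>
        (\<Prod>e\<in>slots - a. 1 - indicator (edge_event M A e) \<omega>) = (0::real)"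
        using fin by (auto simp: indicator_def)
      then show ?thesis using False by (auto simp: X_def)
    qed
    then have "(\<integral>\<omega>. indicator (X a) \<omega> \<partial>M) = (\<integral>\<omega>. indicator {\<omega> \<in> space M. R \<omega> a} \<omega> *
        (\<Prod>e\<in>a. indicator (edge_event M A e) \<omega>) * (\<Prod>e\<in>slots - a. 1 - indicator (edge_event M A e) \<omega> :: real) \<partial>M)"
      by (intro Bochner_Integration.integral_cong) auto
    also have "\<dots> = (\<integral>\<omega>. W \<omega> a \<partial>M)"
      unfolding W_def
      by (rule integral_edge_configuration[OF f T ind]) (use a R fin in \<open>auto simp: indicator_def\<close>)
    finally show ?thesis using X[OF a] by simp
  qed
  have intW: "integrable M (\<lambda>\<omega>. W \<omega> a)" if a: "a \<in> Pow slots" for a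
  proof (rule integrable_const_bound[of _ 1])
    show "AE \<omega> in M. norm (W \<omega> a) \<le> 1"
    proof (rule AE_I2)
      fix \<omega> assume w: "\<omega> \<in> space M"
      have 1: "0 \<le> (\<Prod>e\<in>a. sprob \<omega> e)" "(\<Prod>e\<in>a. sprob \<omega> e) \<le> 1"
        using slot_prob_range(1)[OF f T w] a by (auto intro!: prod_nonneg prod_le_1)
      have 2: "0 \<le> (\<Prod>e\<in>slots - a. 1 - sprob \<omega> e)" "(\<Prod>e\<in>slots - a. 1 - sprob \<omega> e) \<le> 1"
        using slot_prob_range(1)[OF f T w] a by (auto intro!: prod_nonneg prod_le_1)
      show "norm (W \<omega> a) \<le> 1" using 1 2 by (auto simp: W_def abs_mult indicator_def mult_le_one)
    qed
    have "(indicator {\<omega> \<in> space M. R \<omega> a} :: 'a \<Rightarrow> real) \<in> borel_measurable latent"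
      using a by (intro borel_measurable_indicator R) auto
    then have "(\<lambda>\<omega>. W \<omega> a) \<in> borel_measurable latent"
      unfolding W_def using a
      by (intro borel_measurable_times borel_measurable_prod
          borel_measurable_diff borel_measurable_const slot_prob_measurable f T) auto
    then show "(\<lambda>\<omega>. W \<omega> a) \<in> borel_measurable M"
      by (rule measurable_from_subalg[OF latent_subalgebra])
  qed
  have "prob {\<omega> \<in> space M. R \<omega> (present \<omega>)} = prob (\<Union>a\<in>Pow slots. X a)"
    unfolding X_def present_Collect_eq ..
  also have "\<dots> = (\<Sum>a\<in>Pow slots. prob (X a))"
    using X finite_edge_slots
    by (intro finite_measure_finite_Union) (auto simp: X_def disjoint_family_on_def)
  also have "\<dots> = (\<Sum>a\<in>Pow slots. \<integral>\<omega>. W \<omega> a \<partial>M)" using prob_X by simp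
  also have "\<dots> = (\<integral>\<omega>. (\<Sum>a\<in>Pow slots. W \<omega> a) \<partial>M)"
    using intW by (simp add: Bochner_Integration.integral_sum)
  also have "\<dots> \<le> (\<integral>\<omega>. \<epsilon> \<partial>M)"
  proof (rule integral_mono)
    show "integrable M (\<lambda>\<omega>. \<Sum>a\<in>Pow slots. W \<omega> a)" by (rule Bochner_Integration.integrable_sum[OF intW])
    fix \<omega> assume w: "\<omega> \<in> space M"
    have "(\<Sum>a\<in>Pow slots. W \<omega> a) = bern_pr (sprob \<omega>) slots (R \<omega>)"
      unfolding bern_pr_def bern_ex_def W_def
      using w finite_edge_slots by (intro sum.cong) (auto simp: bernoulli_weight_split indicator_def)
    then show "(\<Sum>a\<in>Pow slots. W \<omega> a) \<le> \<epsilon>" using bound[OF w] by simp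
  qed simp
  also have "\<dots> = \<epsilon>" by (simp add: prob_space)
  finally show ?thesis .
qed

text \<open>\<open>H\<close> is the latent event on which the conditional bound is available; its
  complement is charged separately.\<close>

lemma prob_present_ge:
  assumes f: "time_varying_graphon f" "0 < \<rho>" "\<rho> < 1" and T: "\<And>k. k \<in> {1..m} \<Longrightarrow> T k \<in> {0..1}"
    and R: "\<And>a. a \<subseteq> slots \<Longrightarrow> {\<omega> \<in> space M. R \<omega> a} \<in> sets latent"
    and H: "{\<omega> \<in> space M. H \<omega>} \<in> sets latent" "prob {\<omega> \<in> space M. \<not> H \<omega>} \<le> \<epsilon>'"
    and bound: "\<And>\<omega>. \<omega> \<in> space M \<Longrightarrow> H \<omega> \<Longrightarrow> bern_pr (sprob \<omega>) slots (\<lambda>a. \<not> R \<omega> a) \<le> \<epsilon>"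
    and \<epsilon>: "0 \<le> \<epsilon>"
  shows "1 - (\<epsilon> + \<epsilon>') \<le> prob {\<omega> \<in> space M. R \<omega> (present \<omega>)}"
proof -
  have meas: "{\<omega> \<in> space M. H \<omega> \<and> \<not> R \<omega> a} \<in> sets latent" if "a \<subseteq> slots" for a
  proof -
    have "{\<omega> \<in> space M. H \<omega> \<and> \<not> R \<omega> a} = {\<omega> \<in> space M. H \<omega>} - {\<omega> \<in> space M. R \<omega> a}" by auto
    then show ?thesis using H(1) R[OF that] by (simp add: sets.Diff)
  qed
  have 1: "prob {\<omega> \<in> space M. H \<omega> \<and> \<not> R \<omega> (present \<omega>)} \<le> \<epsilon>"
  proof (rule prob_present_le[OF f T meas])
    fix \<omega> assume w: "\<omega> \<in> space M"
    show "bern_pr (sprob \<omega>) slots (\<lambda>a. H \<omega> \<and> \<not> R \<omega> a) \<le> \<epsilon>"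
      using bound[OF w] \<epsilon> bern_ex_const[OF finite_edge_slots, of "sprob \<omega>" n m 0]
      by (cases "H \<omega>") (auto simp: bern_pr_def)
  qed
  have M1: "{\<omega> \<in> space M. H \<omega> \<and> \<not> R \<omega> (present \<omega>)} \<in> sets M" by (rule present_Collect_measurable[OF meas])
  have "{\<omega> \<in> space M. \<not> H \<omega>} = space M - {\<omega> \<in> space M. H \<omega>}" by auto
  then have M2: "{\<omega> \<in> space M. \<not> H \<omega>} \<in> sets M" using latent_event[OF H(1)] by simp
  have "prob (space M - {\<omega> \<in> space M. R \<omega> (present \<omega>)}) \<le>
    prob ({\<omega> \<in> space M. H \<omega> \<and> \<not> R \<omega> (present \<omega>)} \<union> {\<omega> \<in> space M. \<not> H \<omega>})"
    using M1 M2 by (intro finite_measure_mono) auto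
  also have "\<dots> \<le> prob {\<omega> \<in> space M. H \<omega> \<and> \<not> R \<omega> (present \<omega>)} + prob {\<omega> \<in> space M. \<not> H \<omega>}"
    by (rule measure_Un_le[OF M1 M2])
  also have "\<dots> \<le> \<epsilon> + \<epsilon>'" using 1 H(2) by (rule add_mono)
  finally have le: "prob (space M - {\<omega> \<in> space M. R \<omega> (present \<omega>)}) \<le> \<epsilon> + \<epsilon>'" .
  have "{\<omega> \<in> space M. R \<omega> (present \<omega>)} \<in> sets M" by (rule present_Collect_measurable[OF R])
  from prob_compl[OF this] le show ?thesis by linarith
qed

end

section \<open>The error as a function of the configuration, and its measurability\<close>

lemma lp_smooth_cong:
  assumes "\<And>k. k \<in> {1..m} \<Longrightarrow> X k i j = Y k i j"
  shows "lp_smooth K l m T h X t i j = lp_smooth K l m T h Y t i j"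
  unfolding lp_smooth_def using assms by (intro sum.cong) auto

lemma neighborhood_cong:
  assumes PQ: "\<And>i j. i \<in> {1..n} \<Longrightarrow> j \<in> {1..n} \<Longrightarrow> P i j = Q i j" and i: "i \<in> {1..n}"
  shows "neighborhood n h2 P i = neighborhood n h2 Q i"
proof -
  have "(\<lambda>l. \<bar>\<Sum>j=1..n. (P i j - P i' j) * P l j\<bar>) ` ({1..n} - {i, i'}) =
    (\<lambda>l. \<bar>\<Sum>j=1..n. (Q i j - Q i' j) * Q l j\<bar>) ` ({1..n} - {i, i'})" if "i' \<in> {1..n}" for i'
    using that i PQ by (intro image_cong refl arg_cong[of _ _ abs] sum.cong) auto
  then have nd: "node_dist n P i i' = node_dist n Q i i'" if "i' \<in> {1..n}" for i'
    using that by (simp add: node_dist_def)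
  have "{k \<in> {1..n}. node_dist n P i k \<le> x} = {k \<in> {1..n}. node_dist n Q i k \<le> x}" for x
    using nd by auto
  then have "lower_quantile n h (node_dist n P i) = lower_quantile n h (node_dist n Q i)" for h
    by (simp add: lower_quantile_def)
  then show ?thesis using nd by (auto simp: neighborhood_def split: option.split)
qed

lemma neighborhood_subset: "i \<in> {1..n} \<Longrightarrow> neighborhood n h2 P i \<subseteq> {1..n}"
  by (auto simp: neighborhood_def split: option.splits)

text \<open>Matrices are arbitrary outside their index range, so agreement inside has to be carried
  through the data-driven neighborhoods. It permits replacing the observed snapshots by those read
  off from the configuration.\<close>

lemma three_stage_estimator_cong:
  assumes AB: "\<And>k i j. k \<in> {1..m} \<Longrightarrow> i \<in> {1..n} \<Longrightarrow> j \<in> {1..n} \<Longrightarrow> A k i j = B k i j"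
    and ij: "i \<in> {1..n}" "j \<in> {1..n}"
  shows "three_stage_estimator K l n m T h1 h2 h3 A t i j =
      three_stage_estimator K l n m T h1 h2 h3 B t i j"
  unfolding three_stage_estimator_def
proof (rule lp_smooth_cong)
  fix k
  have eq: "lp_smooth K l m T h1 A (T k) i j = lp_smooth K l m T h1 B (T k) i j"
    if "i \<in> {1..n}" "j \<in> {1..n}" for i j
    using that AB by (intro lp_smooth_cong) auto
  have N: "neighborhood n h2 (lp_smooth K l m T h1 A (T k)) i =
      neighborhood n h2 (lp_smooth K l m T h1 B (T k)) i"
    by (rule neighborhood_cong[OF eq ij(1)])
  have "(\<Sum>i'\<in>neighborhood n h2 (lp_smooth K l m T h1 B (T k)) i. lp_smooth K l m T h1 A (T k) i' j) =
    (\<Sum>i'\<in>neighborhood n h2 (lp_smooth K l m T h1 B (T k)) i. lp_smooth K l m T h1 B (T k) i' j)"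
    using neighborhood_subset[OF ij(1)] eq ij(2) by (intro sum.cong refl) blast
  then show "two_stage_estimator K l n m T h1 h2 A (T k) i j =
      two_stage_estimator K l n m T h1 h2 B (T k) i j"
    by (simp add: two_stage_estimator_def Let_def N)
qed

lemma sup_error_le_iff:
  assumes n: "0 < n"
  shows "sup_error n Q P \<le> ereal c \<longleftrightarrow>
    (\<forall>t\<in>{0..1}. \<forall>i\<in>{1..n}. 1 / real n * (\<Sum>j=1..n. (Q t i j - P t i j)\<^sup>2) \<le> c)"
proof -
  have "1 / real n * (norm_2_inf n B)\<^sup>2 \<le> c \<longleftrightarrow> (\<forall>i\<in>{1..n}. 1 / real n * (\<Sum>j=1..n. (B i j)\<^sup>2) \<le> c)" for B
  proof -
    define L where "L = (\<lambda>i. L2_set (B i) {1..n}) ` {1..n}"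
    have L: "finite L" "L \<noteq> {}" using n by (auto simp: L_def)
    have sq: "(L2_set (B i) {1..n})\<^sup>2 = (\<Sum>j=1..n. (B i j)\<^sup>2)" for i
      by (simp add: L2_set_def sum_nonneg)
    have pos: "0 \<le> y" if "y \<in> L" for y using that by (auto simp: L_def)
    have "norm_2_inf n B \<in> L" unfolding norm_2_inf_def L_def[symmetric] by (rule Max_in[OF L])
    then obtain i where i: "i \<in> {1..n}" "norm_2_inf n B = L2_set (B i) {1..n}" by (auto simp: L_def)
    have le: "L2_set (B i) {1..n} \<le> norm_2_inf n B" if "i \<in> {1..n}" for i
      unfolding norm_2_inf_def L_def[symmetric] by (rule Max_ge[OF L(1)]) (use that in \<open>auto simp: L_def\<close>)
    show ?thesis
    proof
      assume a: "1 / real n * (norm_2_inf n B)\<^sup>2 \<le> c"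
      show "\<forall>i\<in>{1..n}. 1 / real n * (\<Sum>j=1..n. (B i j)\<^sup>2) \<le> c"
      proof
        fix i assume i: "i \<in> {1..n}"
        have "(L2_set (B i) {1..n})\<^sup>2 \<le> (norm_2_inf n B)\<^sup>2" using le[OF i] by (intro power_mono) auto
        then have "1 / real n * (\<Sum>j=1..n. (B i j)\<^sup>2) \<le> 1 / real n * (norm_2_inf n B)\<^sup>2"
          unfolding sq by (intro mult_left_mono) auto
        with a show "1 / real n * (\<Sum>j=1..n. (B i j)\<^sup>2) \<le> c" by linarith
      qed
    next
      assume "\<forall>i\<in>{1..n}. 1 / real n * (\<Sum>j=1..n. (B i j)\<^sup>2) \<le> c"
      then show "1 / real n * (norm_2_inf n B)\<^sup>2 \<le> c" unfolding i(2) sq using i(1) by blast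
    qed
  qed
  then show ?thesis by (simp add: sup_error_def SUP_le_iff)
qed

definition adjacency :: "(nat \<times> nat \<times> nat) set \<Rightarrow> nat \<Rightarrow> nat \<Rightarrow> nat \<Rightarrow> real" where
  "adjacency a k i j = of_bool (edge_slot k i j \<in> a)"

context sparse_graphon_sample
begin

text \<open>The weights need not be measurable in \<open>t\<close>. Since the error is continuous in the pair of
  \<open>t\<close> and the weight vector, it is enough to control it on a countable dense set of such pairs.\<close>

lemma smoothing_error_event:
  assumes f: "time_varying_graphon f" and cont: "\<And>x y. x \<in> {0..1} \<Longrightarrow> y \<in> {0..1} \<Longrightarrow>
      continuous_on {0..1} (f x y)"
  shows "{\<omega> \<in> space M. \<forall>t\<in>{0..1}. \<forall>i\<in>{1..n}. 1 / real n *
      (\<Sum>j=1..n. (lp_smooth K l m T h X t i j - edge_prob f \<rho> \<xi> \<omega> t i j)\<^sup>2) \<le> c} \<in> sets latent"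
proof -
  define \<phi> :: "real \<Rightarrow> real \<times> (nat \<Rightarrow> real)" where "\<phi> = (\<lambda>t. (t, lp_weight K l m T h t))"
  define H where "H = (\<lambda>\<omega> i z. 1 / real n *
    (\<Sum>j=1..n. ((\<Sum>k=1..m. snd z k * X k i j) - edge_prob f \<rho> \<xi> \<omega> (fst z) i j)\<^sup>2))"
  obtain D where D: "countable D" "D \<subseteq> \<phi> ` {0..1}" "\<phi> ` {0..1} \<subseteq> closure D"
    using separable[of "\<phi> ` {0..1}"] by blast
  have sub: "\<phi> ` {0..1} \<subseteq> {0..1} \<times> UNIV" by (auto simp: \<phi>_def)
  have H_phi: "H \<omega> i (\<phi> t) = 1 / real n *
      (\<Sum>j=1..n. (lp_smooth K l m T h X t i j - edge_prob f \<rho> \<xi> \<omega> t i j)\<^sup>2)" for \<omega> i t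
    by (simp add: H_def \<phi>_def lp_smooth_def)
  have contH: "continuous_on ({0..1} \<times> UNIV) (H \<omega> i)" if w: "\<omega> \<in> space M" and i: "i \<in> {1..n}" for \<omega> i
  proof -
    have c1: "continuous_on ({0..1} \<times> UNIV) (\<lambda>z :: real \<times> (nat \<Rightarrow> real). f (\<xi> i \<omega>) (\<xi> j \<omega>) (fst z))"
      if j: "j \<in> {1..n}" for j
      by (rule continuous_on_compose2[OF cont[OF latent_range[OF i w] latent_range[OF j w]]])
        (auto intro: continuous_intros)
    have c2: "continuous_on ({0..1} \<times> UNIV) (\<lambda>z :: real \<times> (nat \<Rightarrow> real). snd z k)" for k
      by (rule continuous_on_compose2[OF continuous_on_product_coordinates continuous_on_snd]) auto
    show ?thesis unfolding H_def edge_prob_def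
      by (intro continuous_intros c1 c2) auto
  qed
  have "(\<forall>t\<in>{0..1}. \<forall>i\<in>{1..n}. H \<omega> i (\<phi> t) \<le> c) \<longleftrightarrow> (\<forall>z\<in>D. \<forall>i\<in>{1..n}. H \<omega> i z \<le> c)"
    if w: "\<omega> \<in> space M" for \<omega>
  proof
    assume a: "\<forall>t\<in>{0..1}. \<forall>i\<in>{1..n}. H \<omega> i (\<phi> t) \<le> c"
    show "\<forall>z\<in>D. \<forall>i\<in>{1..n}. H \<omega> i z \<le> c" using a D(2) by blast
  next
    assume a: "\<forall>z\<in>D. \<forall>i\<in>{1..n}. H \<omega> i z \<le> c"
    show "\<forall>t\<in>{0..1}. \<forall>i\<in>{1..n}. H \<omega> i (\<phi> t) \<le> c"
    proof (intro ballI)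
      fix t :: real and i assume t: "t \<in> {0..1}" and i: "i \<in> {1..n}"
      define C where "C = {z \<in> {0..1} \<times> UNIV. H \<omega> i z \<le> c}"
      have "closed ({0..1::real} \<times> (UNIV :: (nat \<Rightarrow> real) set))" by (intro closed_Times) auto
      then have "closed (({0..1} \<times> UNIV) \<inter> H \<omega> i -` {..c})"
        by (intro continuous_closed_preimage contH w i closed_atMost)
      moreover have "C = ({0..1} \<times> UNIV) \<inter> H \<omega> i -` {..c}" by (auto simp: C_def)
      ultimately have "closed C" by simp
      moreover have "D \<subseteq> C" using a i D(2) sub unfolding C_def by blast
      ultimately have "closure D \<subseteq> C" by (intro closure_minimal)
      then show "H \<omega> i (\<phi> t) \<le> c" using D(3) t unfolding C_def by blast
    qed
  qed
  then have "{\<omega> \<in> space M. \<forall>t\<in>{0..1}. \<forall>i\<in>{1..n}. 1 / real n *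
      (\<Sum>j=1..n. (lp_smooth K l m T h X t i j - edge_prob f \<rho> \<xi> \<omega> t i j)\<^sup>2) \<le> c} =
    {\<omega> \<in> space latent. \<forall>z\<in>D. \<forall>i\<in>{1..n}. H \<omega> i z \<le> c}"
    unfolding H_phi space_latent by blast
  also have "\<dots> \<in> sets latent"
  proof (intro sets.sets_Collect_countable_All' D(1) sets.sets_Collect_finite_All)
    fix z i assume z: "z \<in> D" and i: "i \<in> {1..n}"
    have "fst z \<in> {0..1}" using z D(2) sub by fastforce
    then have [measurable]: "(\<lambda>\<omega>. edge_prob f \<rho> \<xi> \<omega> (fst z) i j) \<in> borel_measurable latent" if "j \<in> {1..n}"
        for j
      using edge_prob_measurable[OF f i that] by simp
    have "(\<lambda>\<omega>. H \<omega> i z) \<in> borel_measurable latent" unfolding H_def by measurable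
    then show "{\<omega> \<in> space latent. H \<omega> i z \<le> c} \<in> sets latent" by measurable
  qed auto
  finally show ?thesis .
qed

text \<open>For a fixed configuration the estimator is a smoothing of fixed matrices, so its error
  event is latent-measurable and the reduction to configurations applies.\<close>

lemma prob_sup_error_ge:
  assumes f: "time_varying_graphon f" "0 < \<rho>" "\<rho> < 1" and T: "\<And>k. k \<in> {1..m} \<Longrightarrow> T k \<in> {0..1}"
    and cont: "\<And>x y. x \<in> {0..1} \<Longrightarrow> y \<in> {0..1} \<Longrightarrow> continuous_on {0..1} (f x y)"
    and n: "0 < n"
    and H: "{\<omega> \<in> space M. H \<omega>} \<in> sets latent" "prob {\<omega> \<in> space M. \<not> H \<omega>} \<le> \<epsilon>'"
    and bound: "\<And>\<omega>. \<omega> \<in> space M \<Longrightarrow> H \<omega> \<Longrightarrow> bern_pr (sprob \<omega>) slots (\<lambda>a. \<not>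
      sup_error n (three_stage_estimator K l n m T h1 h2 h3 (adjacency a)) (edge_prob f \<rho> \<xi> \<omega>) \<le> ereal c) \<le> \<epsilon>"
    and \<epsilon>: "0 \<le> \<epsilon>"
  shows "1 - (\<epsilon> + \<epsilon>') \<le> prob {\<omega> \<in> space M.
    sup_error n (three_stage_estimator K l n m T h1 h2 h3 (\<lambda>k i j. A k i j \<omega>)) (edge_prob f \<rho> \<xi> \<omega>) \<le> ereal c}"
proof -
  define R where "R = (\<lambda>\<omega> a.
    sup_error n (three_stage_estimator K l n m T h1 h2 h3 (adjacency a)) (edge_prob f \<rho> \<xi> \<omega>) \<le> ereal c)"
  have "(sup_error n (three_stage_estimator K l n m T h1 h2 h3 (\<lambda>k i j. A k i j \<omega>)) (edge_prob f \<rho> \<xi> \<omega>) \<le>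
      ereal c)
    \<longleftrightarrow> R \<omega> (present \<omega>)" if w: "\<omega> \<in> space M" for \<omega>
  proof -
    have "three_stage_estimator K l n m T h1 h2 h3 (\<lambda>k i j. A k i j \<omega>) t i j =
      three_stage_estimator K l n m T h1 h2 h3 (adjacency (present \<omega>)) t i j"
      if "i \<in> {1..n}" "j \<in> {1..n}" for t i j
      using that adjacency_present[OF w] by (intro three_stage_estimator_cong) (auto simp: adjacency_def)
    then show ?thesis unfolding R_def sup_error_le_iff[OF n] by simp
  qed
  then have eq: "{\<omega> \<in> space M. sup_error n (three_stage_estimator K l n m T h1 h2 h3 (\<lambda>k i j. A k i j \<omega>))
      (edge_prob f \<rho> \<xi> \<omega>) \<le> ereal c} = {\<omega> \<in> space M. R \<omega> (present \<omega>)}" by blast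
  have meas: "{\<omega> \<in> space M. R \<omega> a} \<in> sets latent" for a
    unfolding R_def sup_error_le_iff[OF n] three_stage_estimator_def
        by (rule smoothing_error_event[OF f(1) cont])
  have bd: "bern_pr (sprob \<omega>) slots (\<lambda>a. \<not> R \<omega> a) \<le> \<epsilon>" if "\<omega> \<in> space M" "H \<omega>" for \<omega>
    unfolding R_def by (rule bound[OF that])
  show ?thesis
    unfolding eq by (rule prob_present_ge[OF f T meas H bd \<epsilon>])
qed

end

section \<open>Cells of latent positions and their occupancy\<close>

text \<open>Since \<open>r \<le> \<delta>\<close>, intervals of exact length \<open>r\<close> fit
  into every block. They may overlap: each needs a lower bound on its occupancy, and only their
  number enters the union bound. Equal lengths give all cells the same occupancy bound.\<close>

lemma piecewise_lipschitz_cells: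
  assumes PL: "piecewise_lipschitz \<delta> J L f" and J: "1 \<le> J" and r: "0 < r" "r \<le> \<delta>"
  shows "\<exists>C. finite C \<and> real (card C) \<le> real J * (1 / r + 1) \<and> (\<forall>a\<in>C. 0 \<le> a \<and> a + r \<le> 1) \<and>
    (\<forall>u\<in>{0..<1}. \<exists>a\<in>C. u \<in> {a..<a + r}) \<and>
    (\<forall>a\<in>C. \<forall>u1\<in>{a..<a + r}. \<forall>u2\<in>{a..<a + r}. \<forall>v\<in>{0..<1}. \<forall>t\<in>{0..1}. \<bar>f u1 v t - f u2 v t\<bar> \<le> L * r)"
    and "0 \<le> L"
proof -
  obtain x where x: "x 0 = 0" "x J = 1" "\<And>s. s < J \<Longrightarrow> x s < x (Suc s)" "\<And>s. s < J \<Longrightarrow> \<delta> < x (Suc s) - x s"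
    and lip: "\<And>k l t u1 u2 v. k < J \<Longrightarrow> l < J \<Longrightarrow> t \<in> {0..1} \<Longrightarrow> u1 \<in> {x k..<x (Suc k)} \<Longrightarrow>
      u2 \<in> {x k..<x (Suc k)} \<Longrightarrow> v \<in> {x l..<x (Suc l)} \<Longrightarrow> \<bar>f u1 v t - f u2 v t\<bar> \<le> L * \<bar>u1 - u2\<bar>"
    using PL unfolding piecewise_lipschitz_def by (elim exE conjE) blast
  have mono: "x j \<le> x k" if "j \<le> k" "k \<le> J" for j k
    using that
  proof (induction k rule: dec_induct)
    case (step k)
    then show ?case using x(3)[of k] by simp
  qed simp
  have block: "\<exists>k<J. u \<in> {x k..<x (Suc k)}" if u: "u \<in> {0..<1}" for u
  proof -
    define k where "k = (LEAST k. u < x k)"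
    have k: "u < x k" unfolding k_def by (rule LeastI[of _ J]) (use u x(2) in simp)
    have kJ: "k \<le> J" unfolding k_def by (rule Least_le) (use u x(2) in simp)
    have "k \<noteq> 0" using k u x(1) by (cases k) auto
    then obtain k' where k': "k = Suc k'" by (cases k) auto
    then have "\<not> u < x k'" using not_less_Least[of k' "\<lambda>k. u < x k"] unfolding k_def by simp
    then show ?thesis using k k' kJ by (intro exI[of _ k']) auto
  qed
  have J0: "0 < J" using J by simp
  show L: "0 \<le> L"
  proof -
    define u where "u = (x 0 + x (Suc 0)) / 2"
    have "x 0 < u" "u < x (Suc 0)" using x(3)[OF J0] by (auto simp: u_def)
    then have "\<bar>f (x 0) (x 0) 0 - f u (x 0) 0\<bar> \<le> L * \<bar>x 0 - u\<bar>"
      by (intro lip[OF J0 J0]) auto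
    then have "0 \<le> L * \<bar>x 0 - u\<bar>" by (rule order_trans[OF abs_ge_zero])
    then show ?thesis using \<open>x 0 < u\<close> by (simp add: zero_le_mult_iff)
  qed
  define b where "b = (\<lambda>(k, s). min (x k + real s * r) (x (Suc k) - r))"
    \<comment> \<open>the last cell of a block is shifted to the left so as to stay inside the block\<close>
  define I where "I = {..<J} \<times> {..nat \<lfloor>1 / r\<rfloor>}"
  have inb: "{b (k, s)..<b (k, s) + r} \<subseteq> {x k..<x (Suc k)}" if "k < J" for k s
    using x(4)[OF that] r by (auto simp: b_def)
  have "finite (b ` I)" by (simp add: I_def)
  moreover have "real (card (b ` I)) \<le> real J * (1 / r + 1)"
  proof -
    have "card (b ` I) \<le> card I" by (rule card_image_le) (simp add: I_def)
    also have "\<dots> = J * Suc (nat \<lfloor>1 / r\<rfloor>)" by (simp add: I_def)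
    finally have "real (card (b ` I)) \<le> real J * real (Suc (nat \<lfloor>1 / r\<rfloor>))"
      unfolding of_nat_mult[symmetric] of_nat_le_iff .
    also have "\<dots> \<le> real J * (1 / r + 1)"
      using r by (intro mult_left_mono) (auto simp: of_nat_nat)
    finally show ?thesis .
  qed
  moreover have "\<forall>a\<in>b ` I. 0 \<le> a \<and> a + r \<le> 1"
  proof
    fix a assume "a \<in> b ` I"
    then obtain k s where a: "a = b (k, s)" and k: "k < J" by (auto simp: I_def)
    have "a \<in> {a..<a + r}" using r by simp
    then have "x k \<le> a" using inb[OF k, of s] a by auto
    moreover have "a + r \<le> x (Suc k)" by (simp add: a b_def)
    ultimately show "0 \<le> a \<and> a + r \<le> 1" using mono[of 0 k] mono[of "Suc k" J] k x(1,2) by auto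
  qed
  moreover have "\<forall>u\<in>{0..<1}. \<exists>a\<in>b ` I. u \<in> {a..<a + r}"
  proof
    fix u :: real assume u: "u \<in> {0..<1}"
    then obtain k where k: "k < J" "u \<in> {x k..<x (Suc k)}" using block by blast
    \<comment> \<open>Index of the grid interval containing \<open>u\<close> within its block; if
      that interval sticks out of the block, the shifted one still contains
      \<open>u\<close>.\<close>
    define s where "s = nat \<lfloor>(u - x k) / r\<rfloor>"
    have xk: "0 \<le> x k" using mono[of 0 k] k x(1) by simp
    have fl: "real s = of_int \<lfloor>(u - x k) / r\<rfloor>" using k r by (simp add: s_def of_nat_nat)
    have s1: "real s * r \<le> u - x k" "u - x k < (real s + 1) * r"
      using of_int_floor_le[of "(u - x k) / r", unfolded pos_le_divide_eq[OF r(1)]]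
        floor_correct[of "(u - x k) / r", THEN conjunct2, unfolded pos_divide_less_eq[OF r(1)]]
      unfolding fl by simp_all
    have "(u - x k) / r \<le> 1 / r" using u xk r by (intro divide_right_mono) auto
    then have "s \<le> nat \<lfloor>1 / r\<rfloor>" unfolding s_def by (intro nat_mono floor_mono)
    then have "b (k, s) \<in> b ` I" using k by (auto simp: I_def)
    moreover have "u \<in> {b (k, s)..<b (k, s) + r}"
      using s1 k by (auto simp: b_def min_def algebra_simps)
    ultimately show "\<exists>a\<in>b ` I. u \<in> {a..<a + r}" by blast
  qed
  moreover have "\<forall>a\<in>b ` I. \<forall>u1\<in>{a..<a + r}. \<forall>u2\<in>{a..<a + r}. \<forall>v\<in>{0..<1}. \<forall>t\<in>{0..1}.
      \<bar>f u1 v t - f u2 v t\<bar> \<le> L * r"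
  proof (intro ballI)
    fix a u1 u2 v t :: real
    assume a: "a \<in> b ` I" and u: "u1 \<in> {a..<a + r}" "u2 \<in> {a..<a +
        r}" and v: "v \<in> {0..<1}" and t: "t \<in> {0..1}"
    obtain k s where ab: "a = b (k, s)" and k: "k < J" using a by (auto simp: I_def)
    obtain l where l: "l < J" "v \<in> {x l..<x (Suc l)}" using block[OF v] by blast
    have "\<bar>f u1 v t - f u2 v t\<bar> \<le> L * \<bar>u1 - u2\<bar>"
      by (rule lip[OF k l(1) t _ _ l(2)]) (use inb[OF k, of s] u ab in auto)
    also have "\<dots> \<le> L * r" using u L by (intro mult_left_mono) auto
    finally show "\<bar>f u1 v t - f u2 v t\<bar> \<le> L * r" .
  qed
  ultimately show "\<exists>C. finite C \<and> real (card C) \<le> real J * (1 / r + 1) \<and> (\<forall>a\<in>C. 0 \<le> a \<and> a + r \<le> 1) \<and>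
    (\<forall>u\<in>{0..<1}. \<exists>a\<in>C. u \<in> {a..<a + r}) \<and>
    (\<forall>a\<in>C. \<forall>u1\<in>{a..<a + r}. \<forall>u2\<in>{a..<a + r}. \<forall>v\<in>{0..<1}. \<forall>t\<in>{0..1}. \<bar>f u1 v t - f u2 v t\<bar> \<le> L * r)"
    by blast
qed

context sparse_graphon_sample
begin

definition cell_count :: "real \<Rightarrow> real \<Rightarrow> 'a \<Rightarrow> real" where
  "cell_count a r \<omega> = (\<Sum>i=1..n. indicator {a..<a + r} (\<xi> i \<omega>))"

lemma cell_count_card: "cell_count a r \<omega> = real (card {i\<in>{1..n}. \<xi> i \<omega> \<in> {a..<a + r}})"
  by (simp add: cell_count_def indicator_def sum.If_cases Int_def)

lemma cell_count_measurable: "cell_count a r \<in> borel_measurable latent"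
proof -
  have "(\<lambda>\<omega>. indicator {a..<a + r} (\<xi> i \<omega>) :: real) \<in> borel_measurable latent" if "i \<in> {1..n}" for i
    by (rule measurable_compose[OF latent_measurable[OF that]]) simp
  then show ?thesis unfolding cell_count_def by (intro borel_measurable_sum) auto
qed

lemma latent_measurable_M: "i \<in> {1..n} \<Longrightarrow> \<xi> i \<in> borel_measurable M"
  by (rule measurable_from_subalg[OF latent_subalgebra latent_measurable])

lemma prob_latent:
  assumes i: "i \<in> {1..n}" and B: "B \<in> sets borel"
  shows "prob (\<xi> i -` B \<inter> space M) = measure lborel ({0..1} \<inter> B)"
proof -
  have "prob (\<xi> i -` B \<inter> space M) = measure (distr M borel (\<xi> i)) B"
    using latent_measurable_M[OF i] B by (simp add: measure_distr)
  also have "\<dots> = measure lborel ({0..1} \<inter> B)"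
    unfolding latent_uniform[OF i] using B by (subst measure_uniform_measure) auto
  finally show ?thesis .
qed

text \<open>Chernoff bound with the fixed parameter -1. As \<open>1 - exp (- 1)\<close> is at least
  1/2, the expectation of \<open>exp (- cell_count a r \<omega>)\<close> is at most
  \<open>exp (- (n * r / 2))\<close>, and half of this exponent is spent on the threshold. Here the
  independence is that of the latent positions themselves.\<close>

lemma prob_cell_count_less:
  assumes a: "0 \<le> a" "a + r \<le> 1" and r: "0 < r"
  shows "prob {\<omega> \<in> space M. cell_count a r \<omega> < real n * r / 4} \<le> exp (- (real n * r / 4))"
proof (cases "n = 0")
  case True
  then show ?thesis by simp
next
  case False
  define I where "I = {a..<a + r}"
  define g where "g = (\<lambda>y. exp (- indicator I y :: real))"
  have gm [measurable]: "g \<in> borel_measurable borel" unfolding g_def I_def by measurable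
  have gb: "0 \<le> g y" "g y \<le> 1" for y by (auto simp: g_def indicator_def)
  have ind: "indep_vars (\<lambda>_. borel) (\<lambda>i \<omega>. g (\<xi> i \<omega>)) {1..n}"
    using indep_vars_compose2[OF latent_indep, of "\<lambda>_. g" "\<lambda>_. borel"] gm by simp
  have [measurable]: "(\<lambda>\<omega>. g (\<xi> i \<omega>)) \<in> borel_measurable M" if "i \<in> {1..n}" for i
    by (rule measurable_compose[OF latent_measurable_M[OF that] gm])
  have int: "integrable M (\<lambda>\<omega>. g (\<xi> i \<omega>))" if "i \<in> {1..n}" for i
    by (rule integrable_const_bound[of _ 1]) (use gb that in auto)
  have E: "expectation (\<lambda>\<omega>. g (\<xi> i \<omega>)) \<le> exp (- (r / 2))" if i: "i \<in> {1..n}" for i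
  proof -
    have meas: "\<xi> i -` I \<inter> space M \<in> sets M"
      using latent_measurable_M[OF i] by (rule measurable_sets) (simp add: I_def)
    have "expectation (\<lambda>\<omega>. g (\<xi> i \<omega>)) =
        expectation (\<lambda>\<omega>. 1 - (1 - exp (- 1)) * indicator (\<xi> i -` I \<inter> space M) \<omega>)"
      by (intro Bochner_Integration.integral_cong) (auto simp: g_def indicator_def)
    also have "\<dots> = 1 - (1 - exp (- 1)) * prob (\<xi> i -` I \<inter> space M)"
    proof -
      have "integrable M (\<lambda>\<omega>. (1 - exp (- 1)) * indicat_real (\<xi> i -` I \<inter> space M) \<omega>)"
        using meas by (intro integrable_mult_right integrable_real_indicator) (auto simp: less_top[symmetric])
      then have "expectation (\<lambda>\<omega>. 1 - (1 - exp (- 1)) * indicat_real (\<xi> i -` I \<inter> space M) \<omega>) =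
        expectation (\<lambda>\<omega>. 1) - expectation (\<lambda>\<omega>. (1 - exp (- 1)) * indicat_real (\<xi> i -` I \<inter> space M) \<omega>)"
        by (intro Bochner_Integration.integral_diff) auto
      also have "expectation (\<lambda>\<omega>. (1 - exp (- 1)) * indicat_real (\<xi> i -` I \<inter> space M) \<omega>) =
        (1 - exp (- 1)) * prob (\<xi> i -` I \<inter> space M)"
        by (subst integral_mult_right_zero) (use meas in simp)
      finally show ?thesis by (simp add: prob_space)
    qed
    also have "prob (\<xi> i -` I \<inter> space M) = measure lborel ({0..1} \<inter> I)"
      by (rule prob_latent[OF i]) (simp add: I_def)
    also have "{0..1} \<inter> I = {a..<a + r}" using a by (auto simp: I_def)
    also have "measure lborel {a..<a + r} = r" using r by simp
    also have "1 - (1 - exp (- 1)) * r \<le> 1 - r / 2"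
    proof -
      have "2 \<le> exp (1::real)" using exp_ge_add_one_self[of 1] by simp
      then have "exp (- 1) \<le> (1 / 2 :: real)" by (simp add: exp_minus field_simps)
      then have "1 / 2 * r \<le> (1 - exp (- 1)) * r" using r by (intro mult_right_mono) auto
      then show ?thesis by simp
    qed
    also have "\<dots> \<le> exp (- (r / 2))" using exp_ge_add_one_self[of "- (r / 2)"] by simp
    finally show ?thesis .
  qed
  have prodg: "(\<Prod>i=1..n. g (\<xi> i \<omega>)) = exp (- cell_count a r \<omega>)" for \<omega>
    by (simp add: g_def cell_count_def I_def exp_sum sum_negf[symmetric])
  have "expectation (\<lambda>\<omega>. exp (- cell_count a r \<omega>)) = (\<Prod>i=1..n. expectation (\<lambda>\<omega>. g (\<xi> i \<omega>)))"
    unfolding prodg[symmetric] by (rule indep_vars_lebesgue_integral[OF _ ind int]) auto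
  also have "\<dots> \<le> (\<Prod>i=1..n. exp (- (r / 2)))"
    using E gb by (intro prod_mono) (auto intro!: integral_nonneg_AE)
  also have "\<dots> = exp (- (real n * r / 2))" by (simp add: exp_of_nat_mult[symmetric])
  finally have Ec: "expectation (\<lambda>\<omega>. exp (- cell_count a r \<omega>)) \<le> exp (- (real n * r / 2))" .
  have cm [measurable]: "cell_count a r \<in> borel_measurable M"
    by (rule measurable_from_subalg[OF latent_subalgebra cell_count_measurable])
  have cpos: "0 \<le> cell_count a r \<omega>" for \<omega> by (simp add: cell_count_card)
  have inte: "integrable M (\<lambda>\<omega>. exp (- cell_count a r \<omega>))"
    by (rule integrable_const_bound[of _ 1]) (use cpos in auto)
  have "prob {\<omega> \<in> space M. cell_count a r \<omega> < real n * r / 4} \<le>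
    prob {\<omega> \<in> space M. exp (- (real n * r / 4)) \<le> exp (- cell_count a r \<omega>)}"
    by (intro finite_measure_mono) auto
  also have "\<dots> \<le> expectation (\<lambda>\<omega>. exp (- cell_count a r \<omega>)) / exp (- (real n * r / 4))"
    using inte by (intro integral_Markov_inequality_measure[where A = "space M"]) auto
  also have "\<dots> \<le> exp (- (real n * r / 2)) / exp (- (real n * r / 4))"
    using Ec by (intro divide_right_mono) auto
  also have "\<dots> = exp (- (real n * r / 4))" by (simp add: exp_diff[symmetric])
  finally show ?thesis .
qed

lemma prob_latent_eq_1:
  assumes i: "i \<in> {1..n}" shows "prob {\<omega> \<in> space M. \<xi> i \<omega> = 1} = 0"
proof -
  have "{\<omega> \<in> space M. \<xi> i \<omega> = 1} = \<xi> i -` {1} \<inter> space M" by auto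
  then show ?thesis using prob_latent[OF i, of "{1}"] by simp
qed

text \<open>On \<open>H\<close> all cells are well filled, so the cell of a node supplies the
  required set \<open>S\<close>. No half-open block contains the position 1, where regularity in the
  position says nothing; it is excluded at probability zero.\<close>

lemma latent_cells:
  assumes PL: "piecewise_lipschitz \<delta> J L f" and J: "1 \<le> J" and r: "0 < r" "r \<le> \<delta>"
    and f: "time_varying_graphon f" and \<rho>: "0 < \<rho>"
  shows "\<exists>H. {\<omega> \<in> space M. H \<omega>} \<in> sets latent \<and>
    prob {\<omega> \<in> space M. \<not> H \<omega>} \<le> real J * (1 / r + 1) * exp (- (real n * r / 4)) \<and>
    (\<forall>\<omega>\<in>space M. H \<omega> \<longrightarrow> (\<forall>i\<in>{1..n}. \<exists>S\<subseteq>{1..n}. real n * r / 4 \<le> real (card S) \<and>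
      (\<forall>i'\<in>S. \<forall>j\<in>{1..n}. \<forall>t\<in>{0..1}.
        \<bar>edge_prob f \<rho> \<xi> \<omega> t i j - edge_prob f \<rho> \<xi> \<omega> t i' j\<bar> \<le> \<rho> * (L * r))))"
proof -
  obtain C where C: "finite C" "real (card C) \<le> real J * (1 / r + 1)" "\<forall>a\<in>C. 0 \<le> a \<and> a + r \<le> 1"
    "\<forall>u\<in>{0..<1}. \<exists>a\<in>C. u \<in> {a..<a + r}"
    "\<forall>a\<in>C. \<forall>u1\<in>{a..<a + r}. \<forall>u2\<in>{a..<a + r}. \<forall>v\<in>{0..<1}. \<forall>t\<in>{0..1}. \<bar>f u1 v t - f u2 v t\<bar> \<le> L * r"
    using piecewise_lipschitz_cells(1)[OF PL J r] by blast
  define H where "H = (\<lambda>\<omega>. (\<forall>i\<in>{1..n}. \<xi> i \<omega> \<noteq> 1) \<and> (\<forall>a\<in>C. real n * r / 4 \<le> cell_count a r \<omega>))"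
  have "{\<omega> \<in> space latent. H \<omega>} \<in> sets latent"
    unfolding H_def
  proof (intro sets.sets_Collect_conj sets.sets_Collect_finite_All C(1))
    fix i assume "i \<in> {1..n}"
    then have [measurable]: "\<xi> i \<in> borel_measurable latent" by (rule latent_measurable)
    show "{\<omega> \<in> space latent. \<xi> i \<omega> \<noteq> 1} \<in> sets latent" by measurable
  next
    fix a
    have [measurable]: "cell_count a r \<in> borel_measurable latent" by (rule cell_count_measurable)
    show "{\<omega> \<in> space latent. real n * r / 4 \<le> cell_count a r \<omega>} \<in> sets latent" by measurable
  qed simp
  moreover have "prob {\<omega> \<in> space M. \<not> H \<omega>} \<le> real J * (1 / r + 1) * exp (- (real n * r / 4))"
  proof -
    define U1 where "U1 = (\<Union>i\<in>{1..n}. {\<omega> \<in> space M. \<xi> i \<omega> = 1})"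
    define U2 where "U2 = (\<Union>a\<in>C. {\<omega> \<in> space M. cell_count a r \<omega> < real n * r / 4})"
    have m1: "{\<omega> \<in> space M. \<xi> i \<omega> = 1} \<in> sets M" if "i \<in> {1..n}" for i
      using latent_measurable_M[OF that] by measurable
    have m2: "{\<omega> \<in> space M. cell_count a r \<omega> < real n * r / 4} \<in> sets M" for a
      using measurable_from_subalg[OF latent_subalgebra cell_count_measurable[of a r]] by measurable
    have eqU: "{\<omega> \<in> space M. \<not> H \<omega>} = U1 \<union> U2" by (auto simp: H_def U1_def U2_def not_le)
    have "prob (U1 \<union> U2) \<le> prob U1 + prob U2"
      unfolding U1_def U2_def using m1 m2 C(1) by (intro measure_Un_le sets.finite_UN) auto
    moreover have "prob U1 \<le> (\<Sum>i\<in>{1..n}. prob {\<omega> \<in> space M. \<xi> i \<omega> = 1})"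
      unfolding U1_def by (intro measure_UNION_le m1) auto
    moreover have "prob U2 \<le> (\<Sum>a\<in>C. prob {\<omega> \<in> space M. cell_count a r \<omega> < real n * r / 4})"
      unfolding U2_def by (intro measure_UNION_le m2 C(1))
    moreover have "(\<Sum>a\<in>C. prob {\<omega> \<in> space M. cell_count a r \<omega> < real n * r / 4}) \<le>
        (\<Sum>a\<in>C. exp (- (real n * r / 4)))"
      using C(3) r(1) by (intro sum_mono prob_cell_count_less) auto
    moreover have "(\<Sum>a\<in>C. exp (- (real n * r / 4))) \<le> real J * (1 / r + 1) * exp (- (real n * r / 4))"
      using mult_right_mono[OF C(2), of "exp (- (real n * r / 4))"] by simp
    moreover have "(\<Sum>i\<in>{1..n}. prob {\<omega> \<in> space M. \<xi> i \<omega> = 1}) = 0"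
      using prob_latent_eq_1 by (intro sum.neutral) auto
    ultimately show ?thesis unfolding eqU by linarith
  qed
  moreover have "\<exists>S\<subseteq>{1..n}. real n * r / 4 \<le> real (card S) \<and> (\<forall>i'\<in>S. \<forall>j\<in>{1..n}. \<forall>t\<in>{0..1}.
        \<bar>edge_prob f \<rho> \<xi> \<omega> t i j - edge_prob f \<rho> \<xi> \<omega> t i' j\<bar> \<le> \<rho> * (L * r))"
    if w: "\<omega> \<in> space M" "H \<omega>" and i: "i \<in> {1..n}" for \<omega> i
  proof -
    have less1: "\<xi> j \<omega> \<in> {0..<1}" if "j \<in> {1..n}" for j
      using latent_range[OF that w(1)] w(2) that by (force simp: H_def)
    obtain a where a: "a \<in> C" "\<xi> i \<omega> \<in> {a..<a + r}" using C(4) less1[OF i] by blast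
    define S where "S = {i'\<in>{1..n}. \<xi> i' \<omega> \<in> {a..<a + r}}"
    have "real n * r / 4 \<le> real (card S)"
      using w(2) a(1) by (simp add: H_def cell_count_card S_def)
    moreover have "\<bar>edge_prob f \<rho> \<xi> \<omega> t i j - edge_prob f \<rho> \<xi> \<omega> t i' j\<bar> \<le> \<rho> * (L * r)"
      if "i' \<in> S" "j \<in> {1..n}" "t \<in> {0..1}" for i' j t
    proof -
      have "\<bar>f (\<xi> i \<omega>) (\<xi> j \<omega>) t - f (\<xi> i' \<omega>) (\<xi> j \<omega>) t\<bar> \<le> L * r"
        using C(5) a that less1[OF that(2)] unfolding S_def by blast
      then have "\<rho> * \<bar>f (\<xi> i \<omega>) (\<xi> j \<omega>) t - f (\<xi> i' \<omega>) (\<xi> j \<omega>) t\<bar> \<le> \<rho> * (L * r)"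
        using \<rho> by (intro mult_left_mono) auto
      then show ?thesis using \<rho> by (simp add: edge_prob_def right_diff_distrib[symmetric] abs_mult)
    qed
    ultimately show ?thesis by (intro exI[of _ S]) (auto simp: S_def)
  qed
  ultimately show ?thesis unfolding space_latent by (intro exI[of _ H]) blast
qed

end

section \<open>Concentration of the smoothed noise\<close>

text \<open>The noise is summed over pairs of a time and a column, while the trials are indexed by
  normalised slots; injectivity transports the coefficients.\<close>

lemma bern_bernstein_image:
  assumes I: "finite I" "inj_on g I" and p: "\<And>x. x \<in> I \<Longrightarrow> p (g x) \<in> {0..1}"
    and W: "0 < W" "(\<Sum>x\<in>I. p (g x) * (c x)\<^sup>2) \<le> W" and B: "0 < B" "\<And>x. x \<in> I \<Longrightarrow> \<bar>c x\<bar> \<le> B"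
    and \<tau>: "0 < \<tau>"
  shows "bern_pr p (g ` I) (\<lambda>a. 2 * sqrt (W * \<tau>) + 2 * B * \<tau> < \<bar>\<Sum>x\<in>I. c x * centered p a (g x)\<bar>) \<le>
      2 * exp (- \<tau>)"
proof -
  define c' where "c' = (\<lambda>e. c (the_inv_into I g e))"
  have c': "c' (g x) = c x" if "x \<in> I" for x using that I(2) by (simp add: c'_def the_inv_into_f_f)
  have "bern_pr p (g ` I) (\<lambda>a. 2 * sqrt (W * \<tau>) + 2 * B * \<tau> < \<bar>\<Sum>e\<in>g ` I. c' e * centered p a e\<bar>) \<le>
      2 * exp (- \<tau>)"
  proof (rule bern_bernstein)
    show "(\<Sum>e\<in>g ` I. p e * (c' e)\<^sup>2) \<le> W" using W(2) c' by (simp add: sum.reindex[OF I(2)])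
    show "\<bar>c' e\<bar> \<le> B" if "e \<in> g ` I" for e using that c' B(2) by auto
  qed (use I p W B \<tau> in auto)
  moreover have "(\<Sum>e\<in>g ` I. c' e * centered p a e) = (\<Sum>x\<in>I. c x * centered p a (g x))" for a
    using c' by (simp add: sum.reindex[OF I(2)])
  ultimately show ?thesis by simp
qed

lemma bern_pr_False:
  assumes "finite S" "\<And>a. a \<subseteq> S \<Longrightarrow> \<not> Q a"
  shows "bern_pr p S Q = 0"
proof -
  have "bern_pr p S Q = bern_ex p S (\<lambda>_. 0)" unfolding bern_pr_def using assms(2)
      by (intro bern_ex_cong) auto
  then show ?thesis using bern_ex_const[OF assms(1)] by simp
qed

definition noise :: "nat \<Rightarrow> (nat \<Rightarrow> real) \<Rightarrow> (nat \<times> nat \<times> nat \<Rightarrow> real) \<Rightarrow> (nat \<times> nat \<times> nat) set \<Rightarrow> nat \<Rightarrow> nat \<Rightarrow> real" where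
  "noise m w p a i j = (\<Sum>k=1..m. w k * centered p a (edge_slot k i j))"

lemma noise_cong:
  assumes "\<And>k. k \<in> {1..m} \<Longrightarrow> edge_slot k i j \<in> a \<longleftrightarrow> edge_slot k i j \<in> a'"
  shows "noise m w p a i j = noise m w p a' i j"
  unfolding noise_def centered_def using assms by (intro sum.cong) auto

text \<open>\<open>B\<close> bounds a single weight and \<open>W\<close> their total mass. The
  product \<open>B * W\<close> bounds the sum of squares, so an entry of the noise has variance at
  most \<open>\<rho> * (B * W)\<close>, of order \<open>\<rho> / (m * h)\<close> in the
  application.\<close>

locale weighted_slots =
  fixes n m :: nat and w :: "nat \<Rightarrow> real" and p :: "nat \<times> nat \<times> nat \<Rightarrow> real" and \<rho> B W :: real
  assumes p01: "\<And>e. e \<in> edge_slots n m \<Longrightarrow> p e \<in> {0..1}" and p\<rho>: "\<And>e. e \<in> edge_slots n m \<Longrightarrow> p e \<le> \<rho>"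
    and \<rho>pos: "0 < \<rho>" and Bpos: "0 < B" and Wpos: "0 < W"
    and w_le: "\<And>k. k \<in> {1..m} \<Longrightarrow> \<bar>w k\<bar> \<le> B" and w_sum: "(\<Sum>k=1..m. \<bar>w k\<bar>) \<le> W"
begin

lemma sum_w_square: "(\<Sum>k=1..m. (w k)\<^sup>2) \<le> B * W"
proof -
  have "(\<Sum>k=1..m. (w k)\<^sup>2) \<le> (\<Sum>k=1..m. B * \<bar>w k\<bar>)"
  proof (rule sum_mono)
    fix k assume "k \<in> {1..m}"
    then have "\<bar>w k\<bar> * \<bar>w k\<bar> \<le> B * \<bar>w k\<bar>" using w_le by (intro mult_right_mono) auto
    then show "(w k)\<^sup>2 \<le> B * \<bar>w k\<bar>" by (simp add: power2_eq_square)
  qed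
  also have "\<dots> \<le> B * W" using w_sum Bpos by (simp add: sum_distrib_left[symmetric] mult_left_mono)
  finally show ?thesis .
qed

lemma noise_bound:
  assumes "i \<in> {1..n}" "j \<in> {1..n}"
  shows "\<bar>noise m w p a i j\<bar> \<le> W"
proof -
  have "\<bar>noise m w p a i j\<bar> \<le> (\<Sum>k=1..m. \<bar>w k\<bar>)"
    unfolding noise_def
  proof (intro order_trans[OF sum_abs] sum_mono)
    fix k assume k: "k \<in> {1..m}"
    have "\<bar>centered p a (edge_slot k i j)\<bar> \<le> 1"
      using p01[OF edge_slot_in_edge_slots[OF k assms]] by (auto simp: centered_def)
    then show "\<bar>w k * centered p a (edge_slot k i j)\<bar> \<le> \<bar>w k\<bar>" by (simp add: abs_mult mult_left_le)
  qed
  then show ?thesis using w_sum by linarith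
qed

lemma row_slots_subset:
  assumes "i \<in> {1..n}" "J \<subseteq> {1..n}"
  shows "(\<lambda>(k, j). edge_slot k i j) ` ({1..m} \<times> J) \<subseteq> edge_slots n m"
proof
  fix e assume "e \<in> (\<lambda>(k, j). edge_slot k i j) ` ({1..m} \<times> J)"
  then obtain k j where "e = edge_slot k i j" "k \<in> {1..m}" "j \<in> J" by auto
  then show "e \<in> edge_slots n m" using assms edge_slot_in_edge_slots by blast
qed

text \<open>Within one row different times and columns use different slots, so the double sum
  consists of independent terms and Bernstein's inequality applies to all of them at once.\<close>

lemma noise_linear_tail:
  assumes i: "i \<in> {1..n}" and J: "J \<subseteq> {1..n}"
    and Y: "0 < Y" "\<And>j. j \<in> J \<Longrightarrow> \<bar>y j\<bar> \<le> Y" and Y2: "0 < Y2" "(\<Sum>j\<in>J. (y j)\<^sup>2) \<le> Y2" and \<tau>: "0 < \<tau>"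
  shows "bern_pr p ((\<lambda>(k, j). edge_slot k i j) ` ({1..m} \<times> J))
    (\<lambda>a. 2 * sqrt (\<rho> * (B * W) * Y2 * \<tau>) + 2 * (B * Y) * \<tau> < \<bar>\<Sum>j\<in>J. noise m w p a i j * y j\<bar>) \<le> 2 * exp (- \<tau>)"
proof -
  define g where "g = (\<lambda>(k, j). edge_slot k i j)"
  define c where "c = (\<lambda>(k, j). w k * y j)"
  have finJ: "finite J" using J by (auto intro: finite_subset)
  have ins: "g x \<in> edge_slots n m" if "x \<in> {1..m} \<times> J" for x
    using that J i by (auto simp: g_def intro!: edge_slot_in_edge_slots)
  have "bern_pr p (g ` ({1..m} \<times> J)) (\<lambda>a. 2 * sqrt (\<rho> * (B * W) * Y2 * \<tau>) + 2 * (B * Y) * \<tau> <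
      \<bar>\<Sum>x\<in>{1..m} \<times> J. c x * centered p a (g x)\<bar>) \<le> 2 * exp (- \<tau>)"
  proof (rule bern_bernstein_image)
    show "inj_on g ({1..m} \<times> J)" by (auto simp: inj_on_def g_def edge_slot_eq_iff)
    show "0 < \<rho> * (B * W) * Y2" using \<rho>pos Bpos Wpos Y2 by simp
    have "(\<Sum>x\<in>{1..m} \<times> J. p (g x) * (c x)\<^sup>2) \<le> (\<Sum>x\<in>{1..m} \<times> J. \<rho> * (c x)\<^sup>2)"
      using ins p\<rho> by (intro sum_mono mult_right_mono) auto
    also have "\<dots> = \<rho> * ((\<Sum>k=1..m. (w k)\<^sup>2) * (\<Sum>j\<in>J. (y j)\<^sup>2))"
    proof -
      have "(\<Sum>k=1..m. (w k)\<^sup>2) * (\<Sum>j\<in>J. (y j)\<^sup>2) = (\<Sum>x\<in>{1..m} \<times> J. (c x)\<^sup>2)"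
        unfolding sum_product sum.cartesian_product
        by (rule sum.cong) (auto simp: c_def power_mult_distrib)
      then show ?thesis by (simp only: sum_distrib_left)
    qed
    also have "\<dots> \<le> \<rho> * ((B * W) * Y2)"
      using \<rho>pos Bpos Wpos sum_w_square Y2 by (intro mult_left_mono mult_mono sum_nonneg) auto
    finally show "(\<Sum>x\<in>{1..m} \<times> J. p (g x) * (c x)\<^sup>2) \<le> \<rho> * (B * W) * Y2" by (simp add: mult.assoc)
    show "\<bar>c x\<bar> \<le> B * Y" if "x \<in> {1..m} \<times> J" for x
      using that w_le Y Bpos by (auto simp: c_def abs_mult intro!: mult_mono)
    show "p (g x) \<in> {0..1}" if "x \<in> {1..m} \<times> J" for x using p01[OF ins[OF that]] .
  qed (use finJ Bpos Y \<tau> in auto)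
  moreover have "(\<Sum>x\<in>{1..m} \<times> J. c x * centered p a (g x)) = (\<Sum>j\<in>J. noise m w p a i j * y j)" for a
    unfolding noise_def sum_distrib_right
    by (subst sum.swap) (simp add: sum.cartesian_product c_def g_def split_def mult_ac)
  ultimately show ?thesis unfolding g_def by simp
qed

lemma noise_linear_tail_slots:
  assumes i: "i \<in> {1..n}" and J: "J \<subseteq> {1..n}"
    and Y: "0 < Y" "\<And>j. j \<in> J \<Longrightarrow> \<bar>y j\<bar> \<le> Y" and Y2: "0 < Y2" "(\<Sum>j\<in>J. (y j)\<^sup>2) \<le> Y2" and \<tau>: "0 < \<tau>"
  shows "bern_pr p (edge_slots n m)
    (\<lambda>a. 2 * sqrt (\<rho> * (B * W) * Y2 * \<tau>) + 2 * (B * Y) * \<tau> < \<bar>\<Sum>j\<in>J. noise m w p a i j * y j\<bar>) \<le> 2 * exp (- \<tau>)"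
proof (rule bern_pr_condition[OF p01 finite_edge_slots])
  define S1 where "S1 = (\<lambda>(k, j). edge_slot k i j) ` ({1..m} \<times> J)"
  show "(\<lambda>(k, j). edge_slot k i j) ` ({1..m} \<times> J) \<subseteq> edge_slots n m"
    by (rule row_slots_subset[OF i J])
  fix a2 assume a2: "a2 \<subseteq> edge_slots n m - (\<lambda>(k, j). edge_slot k i j) ` ({1..m} \<times> J)"
  have eq: "noise m w p (a1 \<union> a2) i j = noise m w p a1 i j" if "j \<in> J" for a1 j
    using that a2 by (intro noise_cong) force
  show "bern_pr p ((\<lambda>(k, j). edge_slot k i j) ` ({1..m} \<times> J)) (\<lambda>a1. 2 * sqrt (\<rho> * (B * W) * Y2 * \<tau>) +
      2 * (B * Y) * \<tau> <
      \<bar>\<Sum>j\<in>J. noise m w p (a1 \<union> a2) i j * y j\<bar>) \<le> 2 * exp (- \<tau>)"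
    using noise_linear_tail[OF assms] eq by simp
qed

text \<open>The columns of one row occupy disjoint sets of slots, so the squared entries are
  independent. The bound for sums of squares applies with \<open>W\<close> as the crude bound on an
  entry.\<close>

lemma noise_energy_tail:
  assumes l: "l \<in> {1..n}"
  shows "bern_pr p (edge_slots n m)
    (\<lambda>a. 2 * real n * (\<rho> * (B * W)) + W\<^sup>2 * \<tau> < (\<Sum>j=1..n. (noise m w p a l j)\<^sup>2)) \<le> exp (- \<tau>)"
proof -
  define S where "S = (\<lambda>j. (\<lambda>k. edge_slot k l j) ` {1..m})"
  define c where "c = (\<lambda>(k, i :: nat, j :: nat). w k)"
  have inj: "inj_on (\<lambda>k. edge_slot k l j) {1..m}" for j by (auto simp: inj_on_def edge_slot_eq_iff)
  have c: "c (edge_slot k l j) = w k" for k j by (simp add: c_def edge_slot_def)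
  have X: "(\<Sum>e\<in>S j. c e * centered p a e) = noise m w p a l j" for a j
    unfolding S_def noise_def sum.reindex[OF inj] by (simp add: c)
  have Ssub: "S j \<subseteq> edge_slots n m" if "j \<in> {1..n}" for j
    using that l by (auto simp: S_def intro!: edge_slot_in_edge_slots)
  have "bern_pr p (\<Union>j\<in>{1..n}. S j) (\<lambda>a. 2 * real (card {1..n}) * (\<rho> * (B * W)) + W\<^sup>2 * \<tau> <
      (\<Sum>j\<in>{1..n}. (\<Sum>e\<in>S j. c e * centered p a e)\<^sup>2)) \<le> exp (- \<tau>)"
  proof (rule bern_sum_squares_tail)
    show "disjoint_family_on S {1..n}"
      by (auto simp: disjoint_family_on_def S_def edge_slot_eq_iff)
    show "(\<Sum>e\<in>S j. p e * (c e)\<^sup>2) \<le> \<rho> * (B * W)" if j: "j \<in> {1..n}" for j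
    proof -
      have "(\<Sum>e\<in>S j. p e * (c e)\<^sup>2) = (\<Sum>k=1..m. p (edge_slot k l j) * (w k)\<^sup>2)"
        unfolding S_def sum.reindex[OF inj] by (simp add: c)
      also have "\<dots> \<le> (\<Sum>k=1..m. \<rho> * (w k)\<^sup>2)"
        using p\<rho> edge_slot_in_edge_slots l j by (intro sum_mono mult_right_mono) auto
      also have "\<dots> \<le> \<rho> * (B * W)"
        using sum_w_square \<rho>pos by (simp add: sum_distrib_left[symmetric])
      finally show ?thesis .
    qed
    show "\<bar>\<Sum>e\<in>S j. c e * centered p a e\<bar> \<le> W" if "j \<in> {1..n}" for j a
      unfolding X using noise_bound[OF l that] .
    show "p e \<in> {0..1}" if "j \<in> {1..n}" "e \<in> S j" for j e using p01 Ssub that by blast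
  qed (auto simp: S_def Wpos)
  then have base: "bern_pr p (\<Union>j\<in>{1..n}. S j) (\<lambda>a. 2 * real n * (\<rho> * (B * W)) + W\<^sup>2 * \<tau> <
      (\<Sum>j=1..n. (noise m w p a l j)\<^sup>2)) \<le> exp (- \<tau>)" by (simp add: X)
  show ?thesis
  proof (rule bern_pr_condition[OF p01 finite_edge_slots])
    show "(\<Union>j\<in>{1..n}. S j) \<subseteq> edge_slots n m" using Ssub by blast
    fix a2 assume a2: "a2 \<subseteq> edge_slots n m - (\<Union>j\<in>{1..n}. S j)"
    have "noise m w p (a1 \<union> a2) l j = noise m w p a1 l j" if "j \<in> {1..n}" for a1 j
    proof (rule noise_cong)
      fix k assume "k \<in> {1..m}"
      then have "edge_slot k l j \<in> (\<Union>j\<in>{1..n}. S j)" using that unfolding S_def by blast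
      then show "edge_slot k l j \<in> a1 \<union> a2 \<longleftrightarrow> edge_slot k l j \<in> a1" using a2 by blast
    qed
    then have "(\<Sum>j=1..n. (noise m w p (a1 \<union> a2) l j)\<^sup>2) = (\<Sum>j=1..n. (noise m w p a1 l j)\<^sup>2)" for a1
      by (intro sum.cong) auto
    with base show "bern_pr p (\<Union>j\<in>{1..n}. S j) (\<lambda>a1. 2 * real n * (\<rho> * (B * W)) + W\<^sup>2 * \<tau> <
      (\<Sum>j=1..n. (noise m w p (a1 \<union> a2) l j)\<^sup>2)) \<le> exp (- \<tau>)" by simp
  qed
qed

text \<open>The two rows share only the edge between \<open>i\<close> and \<open>l\<close>, so that without the columns \<open>i\<close> and \<open>l\<close>
  row \<open>i\<close> is a linear form whose coefficients, the entries of row \<open>l\<close>, are independent of it.\<close>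

lemma noise_product_tail:
  assumes i: "i \<in> {1..n}" and l: "l \<in> {1..n}" and il: "i \<noteq> l" and E: "0 < E" and \<tau>: "0 < \<tau>"
  shows "bern_pr p (edge_slots n m) (\<lambda>a. (\<Sum>j=1..n. (noise m w p a l j)\<^sup>2) \<le> E \<and>
    2 * sqrt (\<rho> * (B * W) * E * \<tau>) + 2 * (B * W) * \<tau> + 2 * W\<^sup>2 < \<bar>\<Sum>j=1..n. noise m w p a i j * noise m w p a l j\<bar>)
    \<le> 2 * exp (- \<tau>)"
proof (rule bern_pr_condition[OF p01 finite_edge_slots])
  define J where "J = {1..n} - {i, l}"
  define S1 where "S1 = (\<lambda>(k, j). edge_slot k i j) ` ({1..m} \<times> J)"
  define thr where "thr = 2 * sqrt (\<rho> * (B * W) * E * \<tau>) + 2 * (B * W) * \<tau>"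
  have JV: "J \<subseteq> {1..n}" by (auto simp: J_def)
  show S1: "S1 \<subseteq> edge_slots n m"
    unfolding S1_def by (rule row_slots_subset[OF i JV])
  fix a2 assume a2: "a2 \<subseteq> edge_slots n m - S1"
  have ni: "noise m w p (a1 \<union> a2) i j = noise m w p a1 i j" if "j \<in> J" for a1 j
    using that a2 unfolding S1_def by (intro noise_cong) force
  have nl: "noise m w p (a1 \<union> a2) l j = noise m w p a2 l j" if "a1 \<subseteq> S1" for a1 j
  proof (rule noise_cong)
    fix k
    have "edge_slot k l j \<notin> S1" using il by (auto simp: S1_def J_def edge_slot_eq_iff)
    then show "edge_slot k l j \<in> a1 \<union> a2 \<longleftrightarrow> edge_slot k l j \<in> a2" using that by blast
  qed
  show "bern_pr p S1 (\<lambda>a1. (\<Sum>j=1..n. (noise m w p (a1 \<union> a2) l j)\<^sup>2) \<le> E \<and> thr + 2 * W\<^sup>2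
      < \<bar>\<Sum>j=1..n. noise m w p (a1 \<union> a2) i j * noise m w p (a1 \<union> a2) l j\<bar>) \<le> 2 * exp (- \<tau>)"
  proof (cases "(\<Sum>j=1..n. (noise m w p a2 l j)\<^sup>2) \<le> E")
    case False
    have "finite S1" using S1 finite_edge_slots by (rule finite_subset)
    then have "bern_pr p S1 (\<lambda>a1. (\<Sum>j=1..n. (noise m w p (a1 \<union> a2) l j)\<^sup>2) \<le> E \<and> thr + 2 * W\<^sup>2
      < \<bar>\<Sum>j=1..n. noise m w p (a1 \<union> a2) i j * noise m w p (a1 \<union> a2) l j\<bar>) = 0"
      using False nl by (intro bern_pr_False) auto
    then show ?thesis by simp
  next
    case True
    have "bern_pr p S1 (\<lambda>a1. (\<Sum>j=1..n. (noise m w p (a1 \<union> a2) l j)\<^sup>2) \<le> E \<and> thr + 2 * W\<^sup>2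
      < \<bar>\<Sum>j=1..n. noise m w p (a1 \<union> a2) i j * noise m w p (a1 \<union> a2) l j\<bar>) \<le>
      bern_pr p S1 (\<lambda>a1. thr < \<bar>\<Sum>j\<in>J. noise m w p a1 i j * noise m w p a2 l j\<bar>)"
    proof (rule bern_pr_mono)
      show "p e \<in> {0..1}" if "e \<in> S1" for e using p01 S1 that by blast
      fix a1 assume a1: "a1 \<subseteq> S1"
      define F where "F = (\<lambda>j. noise m w p (a1 \<union> a2) i j * noise m w p (a1 \<union> a2) l j)"
      assume "(\<Sum>j=1..n. (noise m w p (a1 \<union> a2) l j)\<^sup>2) \<le> E \<and> thr + 2 * W\<^sup>2 < \<bar>\<Sum>j=1..n. F j\<bar>"
      \<comment> \<open>The columns \<open>i\<close> and \<open>l\<close> are split off; each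
        contributes at most \<open>W\<^sup>2\<close>, which explains the additive
        \<open>2 * W\<^sup>2\<close>.\<close>
      moreover have "(\<Sum>j=1..n. F j) = F i + (F l + (\<Sum>j\<in>J. F j))"
      proof -
        have "(\<Sum>j=1..n. F j) = F i + (\<Sum>j\<in>{1..n} - {i}. F j)" using i by (simp add: sum.remove)
        also have "(\<Sum>j\<in>{1..n} - {i}. F j) = F l + (\<Sum>j\<in>{1..n} - {i} - {l}. F j)"
          using l il by (subst sum.remove[of _ l]) auto
        also have "{1..n} - {i} - {l} = J" by (auto simp: J_def)
        finally show ?thesis .
      qed
      moreover have "\<bar>F j\<bar> \<le> W\<^sup>2" if "j \<in> {1..n}" for j
        using noise_bound[OF i that] noise_bound[OF l that] Wpos
        by (simp add: F_def abs_mult power2_eq_square mult_mono)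
      moreover have "(\<Sum>j\<in>J. F j) = (\<Sum>j\<in>J. noise m w p a1 i j * noise m w p a2 l j)"
        unfolding F_def using ni nl[OF a1] by (intro sum.cong) auto
      ultimately show "thr < \<bar>\<Sum>j\<in>J. noise m w p a1 i j * noise m w p a2 l j\<bar>"
        using i l by (smt (verit))
    qed
    also have "\<dots> \<le> 2 * exp (- \<tau>)"
      unfolding S1_def thr_def
    proof (rule noise_linear_tail[OF i JV Wpos _ E _ \<tau>])
      show "\<bar>noise m w p a2 l j\<bar> \<le> W" if "j \<in> J" for j using noise_bound[OF l] that JV by blast
      have "(\<Sum>j\<in>J. (noise m w p a2 l j)\<^sup>2) \<le> (\<Sum>j=1..n. (noise m w p a2 l j)\<^sup>2)"
        by (rule sum_mono2) (use JV in auto)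
      then show "(\<Sum>j\<in>J. (noise m w p a2 l j)\<^sup>2) \<le> E" using True by linarith
    qed
    finally show ?thesis .
  qed
qed

lemma noise_entry_tail:
  assumes "i \<in> {1..n}" "j \<in> {1..n}" "0 < \<tau>"
  shows "bern_pr p (edge_slots n m) (\<lambda>a. 2 * sqrt (\<rho> * (B * W) * \<tau>) + 2 * B * \<tau> < \<bar>noise m w p a i j\<bar>) \<le>
      2 * exp (- \<tau>)"
  using noise_linear_tail_slots[of i "{j}" 1 "\<lambda>_. 1" 1 \<tau>] assms by simp

end

section \<open>The two regimes\<close>

text \<open>All that the error analysis uses about the weights, with constants uniform in
  \<open>t\<close>. In the application \<open>B\<close> is of order \<open>1 / (m * h)\<close>,
  while \<open>W\<close> depends neither on the sample size nor on the bandwidth.\<close>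

definition weight_system ::
  "nat \<Rightarrow> nat \<Rightarrow> (nat \<Rightarrow> real) \<Rightarrow> real \<Rightarrow> (real \<Rightarrow> nat \<Rightarrow> real) \<Rightarrow> real \<Rightarrow> real \<Rightarrow> bool" where
  "weight_system l m T h w B W \<longleftrightarrow> 0 < h \<and> 0 < B \<and> 0 < W \<and> (\<forall>t\<in>{0..1}.
     (\<forall>j\<le>l. (\<Sum>k=1..m. w t k * ((T k - t) / h) ^ j) = (if j = 0 then 1 else 0)) \<and>
     (\<forall>k\<in>{1..m}. \<bar>w t k\<bar> \<le> B \<and> (h < \<bar>T k - t\<bar> \<longrightarrow> w t k = 0)) \<and>
     (\<Sum>k=1..m. \<bar>w t k\<bar>) \<le> W)"

lemma lp_weight_system:
  assumes LP1: "LP1 K l lam0 m0 m (T m) h" "m0 \<le> m" "0 < lam0" and LP3: "LP3 Kmax K" and h: "0 <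
      h" and m: "0 < m"
    and LP2: "LP2 a0 T" "0 < a0" and T: "\<And>k. k \<in> {1..m} \<Longrightarrow> T m k \<in> {0..1}"
    and cw: "0 < cw" "Kmax * real (Suc l) / lam0 \<le> cw"
  shows "weight_system l m (T m) h (lp_weight K l m (T m) h) (cw / (real m * h)) (2 * a0 * cw)"
  unfolding weight_system_def
proof (intro conjI ballI allI impI)
  fix t :: real assume t: "t \<in> {0..1}"
  show "(\<Sum>k=1..m. lp_weight K l m (T m) h t k * ((T m k - t) / h) ^ j) = (if j = 0 then 1 else 0)"
      if "j \<le> l" for j
    by (rule lp_weight_moment[OF LP1(1,2) t LP1(3) that])
  show "\<bar>lp_weight K l m (T m) h t k\<bar> \<le> cw / (real m * h)" for k
    by (rule order_trans[OF lp_weight_bound[OF LP1(1,2) t LP1(3) LP3 h] divide_right_mono[OF cw(2)]])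
        (use h in simp)
  show "lp_weight K l m (T m) h t k = 0" if "h < \<bar>T m k - t\<bar>" for k
    by (rule lp_weight_support[OF LP3 h]) (rule that)
  show "(\<Sum>k=1..m. \<bar>lp_weight K l m (T m) h t k\<bar>) \<le> 2 * a0 * cw"
    using order_trans[OF lp_weight_sum_bound[OF LP1(1,2) t LP1(3) LP3 h m LP2 T]
      mult_left_mono[OF cw(2), of "2 * a0"]] LP2(2) by simp
qed (use h m cw LP2 in auto)

text \<open>Cauchy-Schwarz with respect to the masses \<open>\<bar>w k\<bar>\<close>: signed
  averaging with total mass at most \<open>W\<close> inflates a common bound on squared norms by at
  most \<open>W\<^sup>2\<close>.\<close>

lemma weighted_square_sum_le:
  fixes y :: "nat \<Rightarrow> nat \<Rightarrow> real"
  assumes W: "(\<Sum>k=1..m. \<bar>w k\<bar>) \<le> W" and D: "0 \<le> D" and y: "\<And>k. k \<in> {1..m} \<Longrightarrow> (\<Sum>j\<in>V. (y k j)\<^sup>2) \<le> D"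
  shows "(\<Sum>j\<in>V. (\<Sum>k=1..m. w k * y k j)\<^sup>2) \<le> W\<^sup>2 * D"
proof -
  define s where "s = (\<Sum>k=1..m. \<bar>w k\<bar>)"
  have s: "0 \<le> s" by (auto simp: s_def intro: sum_nonneg)
  have "(\<Sum>j\<in>V. (\<Sum>k=1..m. w k * y k j)\<^sup>2) \<le> (\<Sum>j\<in>V. s * (\<Sum>k=1..m. \<bar>w k\<bar> * (y k j)\<^sup>2))"
  proof (rule sum_mono)
    fix j
    have "(\<Sum>k=1..m. w k * y k j)\<^sup>2 \<le> (\<Sum>k=1..m. \<bar>w k\<bar> * \<bar>y k j\<bar>)\<^sup>2"
      by (subst power2_abs[symmetric], intro power_mono order_trans[OF sum_abs]) (auto simp: abs_mult)
    also have "\<dots> = (\<Sum>k=1..m. sqrt \<bar>w k\<bar> * (sqrt \<bar>w k\<bar> * \<bar>y k j\<bar>))\<^sup>2"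
      by (simp add: mult.assoc[symmetric])
    also have "\<dots> \<le> (\<Sum>k=1..m. (sqrt \<bar>w k\<bar>)\<^sup>2) * (\<Sum>k=1..m. (sqrt \<bar>w k\<bar> * \<bar>y k j\<bar>)\<^sup>2)"
      by (rule Cauchy_Schwarz_ineq_sum)
    also have "\<dots> = s * (\<Sum>k=1..m. \<bar>w k\<bar> * (y k j)\<^sup>2)" by (simp add: s_def power_mult_distrib)
    finally show "(\<Sum>k=1..m. w k * y k j)\<^sup>2 \<le> s * (\<Sum>k=1..m. \<bar>w k\<bar> * (y k j)\<^sup>2)" .
  qed
  also have "\<dots> = s * (\<Sum>k=1..m. \<bar>w k\<bar> * (\<Sum>j\<in>V. (y k j)\<^sup>2))"
    unfolding sum_distrib_left[symmetric] by (subst sum.swap) (simp add: sum_distrib_left)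
  also have "\<dots> \<le> s * (\<Sum>k=1..m. \<bar>w k\<bar> * D)"
    using s y by (intro mult_left_mono sum_mono) auto
  also have "(\<Sum>k=1..m. \<bar>w k\<bar> * D) = s * D" unfolding s_def by (simp only: sum_distrib_right)
  also have "s * (s * D) = s * s * D" by simp
  also have "\<dots> \<le> W * W * D"
  proof (intro mult_right_mono mult_mono)
    show "s \<le> W" "s \<le> W" using W by (simp_all add: s_def)
    then show "0 \<le> W" using s by linarith
  qed (use s D in auto)
  finally show ?thesis by (simp add: power2_eq_square)
qed

lemma sum_square_add_le:
  fixes a b :: "nat \<Rightarrow> real"
  shows "(\<Sum>j\<in>V. (a j + b j)\<^sup>2) \<le> 2 * (\<Sum>j\<in>V. (a j)\<^sup>2) + 2 * (\<Sum>j\<in>V. (b j)\<^sup>2)"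
proof -
  have "(x + y)\<^sup>2 \<le> 2 * x\<^sup>2 + 2 * y\<^sup>2" for x y :: real
    using zero_le_power2[of "x - y"] by (simp add: power2_eq_square algebra_simps)
  then have "(\<Sum>j\<in>V. (a j + b j)\<^sup>2) \<le> (\<Sum>j\<in>V. 2 * (a j)\<^sup>2 + 2 * (b j)\<^sup>2)" by (intro sum_mono) simp
  then show ?thesis by (simp add: sum.distrib sum_distrib_left)
qed

context sparse_graphon_sample
begin

lemma slot_prob_edge_slot:
  assumes f: "time_varying_graphon f" and T: "\<And>k. k \<in> {1..m} \<Longrightarrow> T k \<in> {0..1}"
    and \<omega>: "\<omega> \<in> space M" and kij: "k \<in> {1..m}" "i \<in> {1..n}" "j \<in> {1..n}"
  shows "sprob \<omega> (edge_slot k i j) = edge_prob f \<rho> \<xi> \<omega> (T k) i j"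
proof -
  have "f (\<xi> i \<omega>) (\<xi> j \<omega>) (T k) = f (\<xi> j \<omega>) (\<xi> i \<omega>) (T k)"
    using f latent_range[OF kij(2) \<omega>] latent_range[OF kij(3) \<omega>] T[OF kij(1)]
    unfolding time_varying_graphon_def by blast
  then show ?thesis by (simp add: slot_prob_def edge_slot_def edge_prob_def min_def max_def)
qed

lemma weighted_bias:
  assumes f: "time_varying_graphon f" "0 < \<rho>" and T: "\<And>k. k \<in> {1..m} \<Longrightarrow> T k \<in> {0..1}"
    and hold: "0 < \<beta>" "0 < L1" "holder_in_time \<beta> L1 f" and ws: "weight_system (nat \<lfloor>\<beta>\<rfloor>) m T h w B W"
    and \<omega>: "\<omega> \<in> space M" and t: "t \<in> {0..1}" and ij: "i \<in> {1..n}" "j \<in> {1..n}"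
  shows "\<bar>(\<Sum>k=1..m. w t k * edge_prob f \<rho> \<xi> \<omega> (T k) i j) - edge_prob f \<rho> \<xi> \<omega> t i j\<bar> \<le>
      \<rho> * (L1 * h powr \<beta> * W)"
proof -
  define x y where "x = \<xi> i \<omega>" and "y = \<xi> j \<omega>"
  have xy: "x \<in> {0..1}" "y \<in> {0..1}" using latent_range ij \<omega> by (auto simp: x_def y_def)
  have h: "0 < h" using ws by (simp add: weight_system_def)
  have "\<bar>(\<Sum>k=1..m. w t k * f x y (T k)) - f x y t\<bar> \<le> L1 * h powr \<beta> * (\<Sum>k=1..m. \<bar>w t k\<bar>)"
    by (rule local_polynomial_bias[OF hold(1) less_imp_le[OF hold(2)] hold(3) xy T t h])
      (use ws t in \<open>auto simp: weight_system_def\<close>)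
  also have "\<dots> \<le> L1 * h powr \<beta> * W"
    using ws t hold(2) by (intro mult_left_mono) (auto simp: weight_system_def)
  finally have le: "\<bar>(\<Sum>k=1..m. w t k * f x y (T k)) - f x y t\<bar> \<le> L1 * h powr \<beta> * W" .
  have "(\<Sum>k=1..m. w t k * edge_prob f \<rho> \<xi> \<omega> (T k) i j) - edge_prob f \<rho> \<xi> \<omega> t i j =
    \<rho> * ((\<Sum>k=1..m. w t k * f x y (T k)) - f x y t)"
    by (simp add: edge_prob_def x_def y_def sum_distrib_left algebra_simps)
  then show ?thesis using le f(2) by (simp add: abs_mult mult_left_mono)
qed

text \<open>The error splits into the smoothed errors at the observation times and the bias of
  smoothing the true probabilities. Both bounds are deterministic and uniform in \<open>t\<close>,
  so the third stage needs no further probability estimate.\<close>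

lemma smoothing_error:
  assumes f: "time_varying_graphon f" "0 < \<rho>" and T: "\<And>k. k \<in> {1..m} \<Longrightarrow> T k \<in> {0..1}" and n: "0 < n"
    and hold: "0 < \<beta>" "0 < L1" "holder_in_time \<beta> L1 f"
    and ws: "weight_system (nat \<lfloor>\<beta>\<rfloor>) m T h (lp_weight K l m T h) B W"
    and \<omega>: "\<omega> \<in> space M" and t: "t \<in> {0..1}" and i: "i \<in> {1..n}"
    and X: "\<And>k. k \<in> {1..m} \<Longrightarrow> (\<Sum>j=1..n. (X k i j - edge_prob f \<rho> \<xi> \<omega> (T k) i j)\<^sup>2) \<le> real n * D" and D: "0 \<le>
        D"
    and G: "(\<rho> * (L1 * h powr \<beta> * W))\<^sup>2 \<le> G"
  shows "1 / real n * (\<Sum>j=1..n. (lp_smooth K l m T h X t i j - edge_prob f \<rho> \<xi> \<omega> t i j)\<^sup>2) \<le> 2 * W\<^sup>2 * D +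
      2 * G"
proof -
  define w where "w = lp_weight K l m T h t"
  define P where "P = edge_prob f \<rho> \<xi> \<omega>"
  have "(\<Sum>j=1..n. (lp_smooth K l m T h X t i j - P t i j)\<^sup>2) =
    (\<Sum>j=1..n. ((\<Sum>k=1..m. w k * (X k i j - P (T k) i j)) + ((\<Sum>k=1..m. w k * P (T k) i j) - P t i j))\<^sup>2)"
    by (simp add: lp_smooth_def w_def right_diff_distrib sum_subtractf)
  also have "\<dots> \<le> 2 * (\<Sum>j=1..n. (\<Sum>k=1..m. w k * (X k i j - P (T k) i j))\<^sup>2) +
    2 * (\<Sum>j=1..n. ((\<Sum>k=1..m. w k * P (T k) i j) - P t i j)\<^sup>2)" by (rule sum_square_add_le)
  also have "\<dots> \<le> 2 * (W\<^sup>2 * (real n * D)) + 2 * (\<Sum>j=1..n. G)"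
  proof (intro add_mono mult_left_mono sum_mono)
    show "(\<Sum>j=1..n. (\<Sum>k=1..m. w k * (X k i j - P (T k) i j))\<^sup>2) \<le> W\<^sup>2 * (real n * D)"
      by (rule weighted_square_sum_le) (use X D ws t in \<open>auto simp: P_def w_def weight_system_def\<close>)
    fix j assume j: "j \<in> {1..n}"
    have "\<bar>(\<Sum>k=1..m. w k * P (T k) i j) - P t i j\<bar> \<le> \<rho> * (L1 * h powr \<beta> * W)"
      unfolding w_def P_def by (rule weighted_bias[OF f T hold ws \<omega> t i j])
    from power_mono[OF this abs_ge_zero, of 2] show "((\<Sum>k=1..m. w k * P (T k) i j) - P t i j)\<^sup>2 \<le> G"
      using G by simp
  qed auto
  also have "\<dots> = real n * (2 * W\<^sup>2 * D + 2 * G)" by (simp add: algebra_simps)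
  finally show ?thesis using n by (simp add: P_def field_simps)
qed

lemma smoothed_adjacency:
  assumes f: "time_varying_graphon f" and T: "\<And>k. k \<in> {1..m} \<Longrightarrow> T k \<in> {0..1}"
    and \<omega>: "\<omega> \<in> space M" and ij: "i \<in> {1..n}" "j \<in> {1..n}"
  shows "lp_smooth K l m T h (adjacency a) t i j =
    (\<Sum>k=1..m. lp_weight K l m T h t k * edge_prob f \<rho> \<xi> \<omega> (T k) i j) + noise m (lp_weight K l m T h t) (sprob \<omega>) a i j"
  unfolding lp_smooth_def noise_def sum.distrib[symmetric]
  using slot_prob_edge_slot[OF f T \<omega> _ ij]
  by (intro sum.cong) (auto simp: adjacency_def centered_def algebra_simps)

lemma weighted_slots_sprob:
  assumes f: "time_varying_graphon f" "0 < \<rho>" "\<rho> < 1" and T: "\<And>k. k \<in> {1..m} \<Longrightarrow> T k \<in> {0..1}"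
    and ws: "weight_system l m T h w B W" and \<omega>: "\<omega> \<in> space M" and t: "t \<in> {0..1}"
  shows "weighted_slots n m (w t) (sprob \<omega>) \<rho> B W"
  using slot_prob_range[OF f T \<omega>] ws t f(2) by unfold_locales (auto simp: weight_system_def)

text \<open>Noise and bias of each first-stage entry are at most \<open>\<kappa>\<close> outside an
  event that is a union over times and pairs of nodes. Entry errors are then at most
  \<open>2 * \<kappa>\<close>, and \<open>8 * W\<^sup>2 + 2\<close> results from
  \<open>2 * W\<^sup>2 * 4\<close> and the third-stage bias.\<close>

lemma one_node_regime:
  assumes f: "time_varying_graphon f" "0 < \<rho>" "\<rho> < 1" and T: "\<And>k. k \<in> {1..m} \<Longrightarrow> T k \<in> {0..1}" and n: "0 < n"
    and hold: "0 < \<beta>" "0 < L1" "holder_in_time \<beta> L1 f"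
    and ws1: "weight_system (nat \<lfloor>\<beta>\<rfloor>) m T h1 (lp_weight K l m T h1) B W"
    and ws3: "weight_system (nat \<lfloor>\<beta>\<rfloor>) m T h3 (lp_weight K l m T h3) B' W"
    and \<tau>: "0 < \<tau>" and \<kappa>1: "2 * sqrt (\<rho> * (B * W) * \<tau>) + 2 * B * \<tau> \<le> \<kappa>"
    and \<kappa>2: "\<rho> * (L1 * h1 powr \<beta> * W) \<le> \<kappa>" and \<kappa>3: "\<rho> * (L1 * h3 powr \<beta> * W) \<le> \<kappa>"
    and \<omega>: "\<omega> \<in> space M"
    and rate: "(8 * W\<^sup>2 + 2) * \<kappa>\<^sup>2 \<le> rate"
  shows "bern_pr (sprob \<omega>) slots (\<lambda>a. \<not>
      sup_error n (three_stage_estimator K l n m T h1 None h3 (adjacency a)) (edge_prob f \<rho> \<xi> \<omega>) \<le> ereal rate)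
    \<le> real m * real n * real n * (2 * exp (- \<tau>))"
proof -
  define P where "P = edge_prob f \<rho> \<xi> \<omega>"
  define I where "I = {1..m} \<times> {1..n} \<times> {1..n}"
  define bad where "bad = (\<lambda>(k, i, j) a. \<kappa> < \<bar>noise m (lp_weight K l m T h1 (T k)) (sprob \<omega>) a i j\<bar>)"
  have W: "0 < W" using ws3 by (simp add: weight_system_def)
  have "0 < h3 powr \<beta>" using ws3 by (simp add: weight_system_def)
  then have \<kappa>0: "0 \<le> \<kappa>" using \<kappa>3 f(2) hold(2) W by (intro order_trans[OF _ \<kappa>3]) auto
  note p01 = slot_prob_range(1)[OF f T \<omega>]
  have good: "sup_error n (three_stage_estimator K l n m T h1 None h3 (adjacency a)) P \<le> ereal rate"
    if a: "\<not> (\<exists>x\<in>I. bad x a)" for a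
    unfolding sup_error_le_iff[OF n]
  proof (intro ballI)
    fix t :: real and i assume t: "t \<in> {0..1}" and i: "i \<in> {1..n}"
    have X: "(\<Sum>j=1..n. (two_stage_estimator K l n m T h1 None (adjacency a) (T k) i j - P (T k) i j)\<^sup>2) \<le>
        real n * (4 * \<kappa>\<^sup>2)"
      if k: "k \<in> {1..m}" for k
    proof -
      have "(\<Sum>j=1..n. (two_stage_estimator K l n m T h1 None (adjacency a) (T k) i j - P (T k) i j)\<^sup>2) \<le>
          (\<Sum>j=1..n. 4 * \<kappa>\<^sup>2)"
      proof (rule sum_mono)
        fix j assume j: "j \<in> {1..n}"
        define N where "N = noise m (lp_weight K l m T h1 (T k)) (sprob \<omega>) a i j"
        define b where "b = (\<Sum>k'=1..m. lp_weight K l m T h1 (T k) k' * P (T k') i j) - P (T k) i j"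
        have "two_stage_estimator K l n m T h1 None (adjacency a) (T k) i j - P (T k) i j = b + N"
          unfolding N_def b_def P_def using smoothed_adjacency[OF f(1) T \<omega> i j, of K l h1 a "T k"]
          by (simp add: two_stage_estimator_def neighborhood_def)
        moreover have "\<bar>b\<bar> \<le> \<kappa>" unfolding b_def P_def
          by (rule order_trans[OF weighted_bias[OF f(1,2) T hold ws1 \<omega> T[OF k] i j] \<kappa>2])
        moreover have "\<bar>N\<bar> \<le> \<kappa>" using a k i j unfolding N_def I_def bad_def by force
        ultimately have "\<bar>two_stage_estimator K l n m T h1 None (adjacency a) (T k) i j - P (T k) i j\<bar> \<le>
            2 * \<kappa>"
          by linarith
        from power_mono[OF this abs_ge_zero, of 2]
        show "(two_stage_estimator K l n m T h1 None (adjacency a) (T k) i j - P (T k) i j)\<^sup>2 \<le> 4 * \<kappa>\<^sup>2"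
          by (simp add: power_mult_distrib)
      qed
      then show ?thesis by simp
    qed
    have "(\<rho> * (L1 * h3 powr \<beta> * W))\<^sup>2 \<le> \<kappa>\<^sup>2"
      using \<kappa>3 f(2) hold(2) W by (intro power_mono) auto
    from smoothing_error[where X = "\<lambda>k. two_stage_estimator K l n m T h1 None (adjacency a) (T k)",
        OF f(1,2) T n hold ws3 \<omega> t i X[unfolded P_def] _ this]
    have "1 / real n * (\<Sum>j=1..n. (three_stage_estimator K l n m T h1 None h3 (adjacency a) t i j - P t i j)\<^sup>2)
      \<le> 2 * W\<^sup>2 * (4 * \<kappa>\<^sup>2) + 2 * \<kappa>\<^sup>2"
      unfolding three_stage_estimator_def P_def by simp
    also have "\<dots> = (8 * W\<^sup>2 + 2) * \<kappa>\<^sup>2" by (simp add: algebra_simps)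
    also note rate
    finally show "1 / real n * (\<Sum>j=1..n. (three_stage_estimator K l n m T h1 None h3 (adjacency a) t i j - P t i j)\<^sup>2)
      \<le> rate" .
  qed
  have "bern_pr (sprob \<omega>) slots (\<lambda>a. \<not>
      sup_error n (three_stage_estimator K l n m T h1 None h3 (adjacency a)) P \<le> ereal rate)
    \<le> bern_pr (sprob \<omega>) slots (\<lambda>a. \<exists>x\<in>I. bad x a)"
    by (rule bern_pr_mono[OF p01]) (use good in blast)+
  also have "\<dots> \<le> real (card I) * (2 * exp (- \<tau>))"
  proof (rule bern_pr_bex[OF p01 _ finite_edge_slots])
    fix x assume "x \<in> I"
    then obtain k i j where x: "x = (k, i, j)" "k \<in> {1..m}" "i \<in> {1..n}" "j \<in> {1..n}" by (auto simp: I_def)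
    interpret weighted_slots n m "lp_weight K l m T h1 (T k)" "sprob \<omega>" \<rho> B W
      by (rule weighted_slots_sprob[OF f T ws1 \<omega> T[OF x(2)]])
    have "bern_pr (sprob \<omega>) slots (bad x) \<le> bern_pr (sprob \<omega>) slots
      (\<lambda>a. 2 * sqrt (\<rho> * (B * W) * \<tau>) + 2 * B * \<tau> < \<bar>noise m (lp_weight K l m T h1 (T k)) (sprob \<omega>) a i j\<bar>)"
      by (rule bern_pr_mono[OF p01]) (use \<kappa>1 in \<open>auto simp: bad_def x(1)\<close>)
    also have "\<dots> \<le> 2 * exp (- \<tau>)" by (rule noise_entry_tail[OF x(3,4) \<tau>])
    finally show "bern_pr (sprob \<omega>) slots (bad x) \<le> 2 * exp (- \<tau>)" .
  qed (auto simp: I_def)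
  also have "real (card I) = real m * real n * real n" by (simp add: I_def)
  finally show ?thesis unfolding P_def .
qed

text \<open>The averaging lemma with \<open>\<eta> = n * G\<close>, at all observation times
  simultaneously. Each triple of a time and two nodes has three bad events, of probability at most
  2, 2 and 1 times \<open>exp (- \<tau>)\<close>; 210 is twice the constant 105 of the averaging
  step.\<close>

lemma neighborhood_regime:
  assumes f: "time_varying_graphon f" "0 < \<rho>" "\<rho> < 1" and T: "\<And>k. k \<in> {1..m} \<Longrightarrow> T k \<in> {0..1}" and n: "3 \<le> n"
    and hold: "0 < \<beta>" "0 < L1" "holder_in_time \<beta> L1 f"
    and ws1: "weight_system (nat \<lfloor>\<beta>\<rfloor>) m T h1 (lp_weight K l m T h1) B W"
    and ws3: "weight_system (nat \<lfloor>\<beta>\<rfloor>) m T h3 (lp_weight K l m T h3) B' W"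
    and \<tau>: "0 < \<tau>" and G: "0 \<le> G" and h2: "0 < h2"
    and E: "E = 2 * real n * (\<rho> * (B * W)) + W\<^sup>2 * \<tau>"
    and cross: "2 * sqrt (\<rho> * (B * W) * (real n * (\<rho> * W)\<^sup>2) * \<tau>) + 2 * (B * (\<rho> * W)) * \<tau> \<le> real n * G"
    and prods: "2 * sqrt (\<rho> * (B * W) * E * \<tau>) + 2 * (B * W) * \<tau> + 2 * W\<^sup>2 \<le> real n * G"
    and energy: "E \<le> real n * G * (h2 * real n)"
    and card: "h2 * real n \<le> c0" "3 \<le> c0"
    and \<theta>: "W * \<theta> * (\<rho> * W) \<le> G"
    and bias1: "(\<rho> * (L1 * h1 powr \<beta> * W))\<^sup>2 \<le> G" and bias3: "(\<rho> * (L1 * h3 powr \<beta> * W))\<^sup>2 \<le> G"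
    and \<omega>: "\<omega> \<in> space M"
    and close: "\<And>i. i \<in> {1..n} \<Longrightarrow> \<exists>S\<subseteq>{1..n}. c0 \<le> real (card S) \<and>
      (\<forall>i'\<in>S. \<forall>j\<in>{1..n}. \<forall>t\<in>{0..1}. \<bar>edge_prob f \<rho> \<xi> \<omega> t i j - edge_prob f \<rho> \<xi> \<omega> t i' j\<bar> \<le> \<theta>)"
    and rate: "(210 * W\<^sup>2 + 2) * G \<le> rate"
  shows "bern_pr (sprob \<omega>) slots (\<lambda>a. \<not>
      sup_error n (three_stage_estimator K l n m T h1 (Some h2) h3 (adjacency a)) (edge_prob f \<rho> \<xi> \<omega>) \<le> ereal rate)
    \<le> real m * real n * real n * (5 * exp (- \<tau>))"
proof -
  define P where "P = edge_prob f \<rho> \<xi> \<omega>"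
  \<comment> \<open>Freezing the first stage at the observation time \<open>T k\<close> makes
    \<open>Mn k\<close> its conditional mean and \<open>Z k a\<close> its noise.\<close>
  define w where "w = (\<lambda>k. lp_weight K l m T h1 (T k))"
  define Mn where "Mn = (\<lambda>k i j. \<Sum>k'=1..m. w k k' * P (T k') i j)"
  define Z where "Z = (\<lambda>k a. noise m (w k) (sprob \<omega>) a)"
  define I where "I = {1..m} \<times> {1..n} \<times> {1..n}"
  define bad1 where "bad1 = (\<lambda>k i l a. real n * G < \<bar>\<Sum>j=1..n. Z k a i j * Mn k l j\<bar>)"
  \<comment> \<open>The energy bound is part of the event, so that its probability can be estimated
    conditionally on row \<open>l\<close>; outside \<open>bad3\<close> this conjunct holds
    anyway.\<close>
  define bad2 where "bad2 = (\<lambda>k i l a. i \<noteq> l \<and> (\<Sum>j=1..n. (Z k a l j)\<^sup>2) \<le> E \<and> real n * G <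
      \<bar>\<Sum>j=1..n. Z k a i j * Z k a l j\<bar>)"
  define bad3 where "bad3 = (\<lambda>k l a. E < (\<Sum>j=1..n. (Z k a l j)\<^sup>2))"
  define bad where "bad = (\<lambda>(k, i, l) a. bad1 k i l a \<or> bad2 k i l a \<or> bad3 k l a)"
  have n0: "0 < n" using n by simp
  have W: "0 < W" "0 < B" using ws1 by (auto simp: weight_system_def)
  note p01 = slot_prob_range(1)[OF f T \<omega>]
  have Prange: "0 \<le> P t i j" "P t i j \<le> \<rho>" if "i \<in> {1..n}" "j \<in> {1..n}" "t \<in> {0..1}" for i j t
    using edge_prob_range[OF f(1,2) that \<omega>] by (auto simp: P_def)
  have wsum: "(\<Sum>k'=1..m. \<bar>w k k'\<bar>) \<le> W" if "k \<in> {1..m}" for k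
    using ws1 T[OF that] by (auto simp: w_def weight_system_def)
  have avg: "\<bar>\<Sum>k'=1..m. w k k' * y k'\<bar> \<le> W * b" if k: "k \<in> {1..m}" and b: "0 \<le> b"
    and y: "\<And>k'. k' \<in> {1..m} \<Longrightarrow> \<bar>y k'\<bar> \<le> b" for k y b
  proof -
    have "\<bar>\<Sum>k'=1..m. w k k' * y k'\<bar> \<le> (\<Sum>k'=1..m. \<bar>w k k'\<bar> * b)"
      using y by (intro order_trans[OF sum_abs] sum_mono) (simp add: abs_mult mult_left_mono)
    also have "\<dots> \<le> W * b" using wsum[OF k] b by (simp add: sum_distrib_right[symmetric] mult_right_mono)
    finally show ?thesis .
  qed
  have Msize: "\<bar>Mn k i j\<bar> \<le> \<rho> * W" if "k \<in> {1..m}" "i \<in> {1..n}" "j \<in> {1..n}" for k i j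
  proof -
    have "\<bar>Mn k i j\<bar> \<le> W * \<rho>" unfolding Mn_def
      by (rule avg[OF that(1)])
          (use f(2) Prange[OF that(2,3) T] in \<open>auto simp: abs_le_iff intro: order_trans\<close>)
    then show ?thesis by (simp add: mult.commute)
  qed
  have good: "sup_error n (three_stage_estimator K l n m T h1 (Some h2) h3 (adjacency a)) P \<le> ereal rate"
    if a: "\<not> (\<exists>x\<in>I. bad x a)" for a
    unfolding sup_error_le_iff[OF n0]
  proof (intro ballI)
    fix t :: real and i assume t: "t \<in> {0..1}" and i: "i \<in> {1..n}"
    have X: "(\<Sum>j=1..n. (two_stage_estimator K l n m T h1 (Some h2) (adjacency a) (T k) i j - P (T k) i j)\<^sup>2) \<le> real n * (105 * G)"
      if k: "k \<in> {1..m}" for k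
    proof -
      define Q where "Q = lp_smooth K l m T h1 (adjacency a) (T k)"
      define Q' where "Q' = (\<lambda>i j. Mn k i j + Z k a i j)"
      have QQ': "Q i j = Q' i j" if "i \<in> {1..n}" "j \<in> {1..n}" for i j
        unfolding Q_def Q'_def Mn_def Z_def w_def P_def by (rule smoothed_adjacency[OF f(1) T \<omega> that])
      have N: "neighborhood n (Some h2) Q i = neighborhood n (Some h2) Q' i"
        by (rule neighborhood_cong[OF QQ' i])
      have b3: "(\<Sum>j=1..n. (Z k a l j)\<^sup>2) \<le> E" if "l \<in> {1..n}" for l
        using a that k i unfolding I_def bad_def bad3_def by force
      have "(\<Sum>j=1..n. ((\<Sum>i'\<in>neighborhood n (Some h2) Q' i. Q' i' j) /
        real (card (neighborhood n (Some h2) Q' i)) - P (T k) i j)\<^sup>2) \<le> 105 * (real n * G)"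
        unfolding Q'_def
      proof (rule neighborhood_averaging[where \<mu> = "\<rho> * W" and \<theta> = "W * \<theta>" and \<kappa> = "\<rho> * (L1 * h1 powr \<beta> * W)"])
        show "\<bar>\<Sum>j=1..n. Z k a i j * Mn k l j\<bar> \<le> real n * G" if "i \<in> {1..n}" "l \<in> {1..n}" for i l
          using a that k unfolding I_def bad_def bad1_def by force
        show "\<bar>\<Sum>j=1..n. Z k a i j * Z k a l j\<bar> \<le> real n * G" if "i \<in> {1..n}" "l \<in> {1..n}" "i \<noteq> l" for i l
          using a that k b3[of l] unfolding I_def bad_def bad2_def by force
        show "(\<Sum>j=1..n. Z k a l j * Z k a l j) \<le> real n * G * (h2 * real n)" if "l \<in> {1..n}" for l
          using b3[OF that] energy by (simp add: power2_eq_square)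
        show "\<bar>Mn k i j\<bar> \<le> \<rho> * W" if "i \<in> {1..n}" "j \<in> {1..n}" for i j by (rule Msize[OF k that])
        show "\<exists>S\<subseteq>{1..n}. h2 * real n \<le> real (card S) \<and> 3 \<le> card S \<and>
          (\<forall>i'\<in>S. \<forall>j\<in>{1..n}. \<bar>Mn k i j - Mn k i' j\<bar> \<le> W * \<theta>)" if i: "i \<in> {1..n}" for i
        proof -
          obtain S where S: "S \<subseteq> {1..n}" "c0 \<le> real (card S)"
            "\<forall>i'\<in>S. \<forall>j\<in>{1..n}. \<forall>t\<in>{0..1}. \<bar>P t i j - P t i' j\<bar> \<le> \<theta>"
            using close[OF i] unfolding P_def by blast
          have "\<bar>Mn k i j - Mn k i' j\<bar> \<le> W * \<theta>" if "i' \<in> S" "j \<in> {1..n}" for i' j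
          proof -
            have le: "\<bar>P (T k') i j - P (T k') i' j\<bar> \<le> \<theta>" if "k' \<in> {1..m}" for k'
              using S(3) T[OF that] \<open>i' \<in> S\<close> \<open>j \<in> {1..n}\<close> by blast
            have "Mn k i j - Mn k i' j = (\<Sum>k'=1..m. w k k' * (P (T k') i j - P (T k') i' j))"
              by (simp add: Mn_def right_diff_distrib sum_subtractf)
            moreover have "0 \<le> \<theta>" using le[OF k] by (rule order_trans[OF abs_ge_zero])
            ultimately show ?thesis using avg[OF k, of \<theta>] le by simp
          qed
          moreover have "real 3 \<le> real (card S)" using S(2) card by simp
          ultimately show ?thesis using S card(1) by (intro exI[of _ S]) auto
        qed
        show "\<bar>Mn k i j - P (T k) i j\<bar> \<le> \<rho> * (L1 * h1 powr \<beta> * W)" if "i \<in> {1..n}" "j \<in> {1..n}" for i j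
          unfolding Mn_def w_def P_def by (rule weighted_bias[OF f(1,2) T hold ws1 \<omega> T[OF k] that])
        show "real n * (W * \<theta>) * (\<rho> * W) \<le> real n * G"
          using mult_left_mono[OF \<theta>, of "real n"] by (simp add: mult_ac)
        show "real n * (\<rho> * (L1 * h1 powr \<beta> * W))\<^sup>2 \<le> real n * G"
          using bias1 by (intro mult_left_mono) auto
      qed (use n h2 G W f i in auto)
      moreover have "(\<Sum>j=1..n. (two_stage_estimator K l n m T h1 (Some h2) (adjacency a) (T k) i j - P (T k) i j)\<^sup>2) =
        (\<Sum>j=1..n. ((\<Sum>i'\<in>neighborhood n (Some h2) Q' i. Q' i' j) /
        real (card (neighborhood n (Some h2) Q' i)) - P (T k) i j)\<^sup>2)"
      proof (rule sum.cong[OF refl])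
        fix j assume j: "j \<in> {1..n}"
        have "(\<Sum>i'\<in>neighborhood n (Some h2) Q' i. Q i' j) = (\<Sum>i'\<in>neighborhood n (Some h2) Q' i. Q' i' j)"
          using neighborhood_subset[OF i] QQ' j by (intro sum.cong refl) blast
        then show "(two_stage_estimator K l n m T h1 (Some h2) (adjacency a) (T k) i j - P (T k) i j)\<^sup>2 =
          ((\<Sum>i'\<in>neighborhood n (Some h2) Q' i. Q' i' j) / real (card (neighborhood n (Some h2) Q' i)) - P (T k) i j)\<^sup>2"
          by (simp add: two_stage_estimator_def Q_def[symmetric] N Let_def)
      qed
      ultimately show ?thesis by simp
    qed
    from smoothing_error[where X = "\<lambda>k. two_stage_estimator K l n m T h1 (Some h2) (adjacency a) (T k)",
        OF f(1,2) T n0 hold ws3 \<omega> t i X[unfolded P_def] _ bias3]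
    have "1 / real n * (\<Sum>j=1..n. (three_stage_estimator K l n m T h1 (Some h2) h3 (adjacency a) t i j - P t i j)\<^sup>2)
      \<le> 2 * W\<^sup>2 * (105 * G) + 2 * G"
      unfolding three_stage_estimator_def P_def using G by simp
    also have "\<dots> = (210 * W\<^sup>2 + 2) * G" by (simp add: algebra_simps)
    also note rate
    finally show "1 / real n * (\<Sum>j=1..n. (three_stage_estimator K l n m T h1 (Some h2) h3 (adjacency a) t i j - P t i j)\<^sup>2)
      \<le> rate" .
  qed
  have "bern_pr (sprob \<omega>) slots (\<lambda>a. \<not>
      sup_error n (three_stage_estimator K l n m T h1 (Some h2) h3 (adjacency a)) P \<le> ereal rate)
    \<le> bern_pr (sprob \<omega>) slots (\<lambda>a. \<exists>x\<in>I. bad x a)"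
    by (rule bern_pr_mono[OF p01]) (use good in blast)+
  also have "\<dots> \<le> real (card I) * (5 * exp (- \<tau>))"
  proof (rule bern_pr_bex[OF p01 _ finite_edge_slots])
    fix x assume "x \<in> I"
    then obtain k i l where x: "x = (k, i, l)" "k \<in> {1..m}" "i \<in> {1..n}" "l \<in> {1..n}" by (auto simp: I_def)
    interpret weighted_slots n m "w k" "sprob \<omega>" \<rho> B W
      unfolding w_def by (rule weighted_slots_sprob[OF f T ws1 \<omega> T[OF x(2)]])
    have 1: "bern_pr (sprob \<omega>) slots (bad1 k i l) \<le> 2 * exp (- \<tau>)"
    proof -
      have "bern_pr (sprob \<omega>) slots (bad1 k i l) \<le> bern_pr (sprob \<omega>) slots
        (\<lambda>a. 2 * sqrt (\<rho> * (B * W) * (real n * (\<rho> * W)\<^sup>2) * \<tau>) + 2 * (B * (\<rho> * W)) * \<tau> < \<bar>\<Sum>j\<in>{1..n}. noise m (w k) (sprob \<omega>) a i j * Mn k l j\<bar>)"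
        by (rule bern_pr_mono[OF p01]) (use cross in \<open>auto simp: bad1_def Z_def\<close>)
      also have "\<dots> \<le> 2 * exp (- \<tau>)"
      proof (rule noise_linear_tail_slots[OF x(3) _ _ _ _ _ \<tau>])
        have "(\<Sum>j\<in>{1..n}. (Mn k l j)\<^sup>2) \<le> (\<Sum>j\<in>{1..n}. (\<rho> * W)\<^sup>2)"
          using power_mono[OF Msize[OF x(2,4)] abs_ge_zero, of _ 2] by (intro sum_mono) simp
        then show "(\<Sum>j\<in>{1..n}. (Mn k l j)\<^sup>2) \<le> real n * (\<rho> * W)\<^sup>2" by simp
      qed (use Msize x W f n0 in auto)
      finally show ?thesis .
    qed
    have 2: "bern_pr (sprob \<omega>) slots (bad2 k i l) \<le> 2 * exp (- \<tau>)"
    proof (cases "i = l")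
      case True
      then have "bern_pr (sprob \<omega>) slots (bad2 k i l) = 0"
        by (intro bern_pr_False finite_edge_slots) (simp add: bad2_def)
      then show ?thesis by simp
    next
      case False
      have E0: "0 < E" unfolding E using W \<tau> f(2) by (intro add_nonneg_pos) auto
      have "bern_pr (sprob \<omega>) slots (bad2 k i l) \<le>
          bern_pr (sprob \<omega>) slots (\<lambda>a. (\<Sum>j=1..n. (noise m (w k) (sprob \<omega>) a l j)\<^sup>2) \<le> E \<and>
        2 * sqrt (\<rho> * (B * W) * E * \<tau>) + 2 * (B * W) * \<tau> + 2 * W\<^sup>2 <
        \<bar>\<Sum>j=1..n. noise m (w k) (sprob \<omega>) a i j * noise m (w k) (sprob \<omega>) a l j\<bar>)"
        by (rule bern_pr_mono[OF p01]) (use prods in \<open>auto simp: bad2_def Z_def\<close>)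
      also have "\<dots> \<le> 2 * exp (- \<tau>)" by (rule noise_product_tail[OF x(3,4) False E0 \<tau>])
      finally show ?thesis .
    qed
    have 3: "bern_pr (sprob \<omega>) slots (bad3 k l) \<le> exp (- \<tau>)"
      unfolding bad3_def Z_def E by (rule noise_energy_tail[OF x(4)])
    have "bern_pr (sprob \<omega>) slots (bad x) \<le> bern_pr (sprob \<omega>) slots (bad1 k i l) +
      bern_pr (sprob \<omega>) slots (\<lambda>a. bad2 k i l a \<or> bad3 k l a)"
      unfolding bad_def x(1) prod.case by (rule bern_pr_disj[OF p01])
    also have "bern_pr (sprob \<omega>) slots (\<lambda>a. bad2 k i l a \<or> bad3 k l a) \<le>
      bern_pr (sprob \<omega>) slots (bad2 k i l) + bern_pr (sprob \<omega>) slots (bad3 k l)"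
      by (rule bern_pr_disj[OF p01])
    finally show "bern_pr (sprob \<omega>) slots (bad x) \<le> 5 * exp (- \<tau>)" using 1 2 3 by linarith
  qed (auto simp: I_def)
  also have "real (card I) = real m * real n * real n" by (simp add: I_def)
  finally show ?thesis unfolding P_def .
qed

end

section \<open>Arithmetic of bandwidths, rates and failure probabilities\<close>

text \<open>Here \<open>y\<close> is n R and \<open>u\<close> stands for 1/(m h), so
  \<open>L * u = y * x\<close> encodes the choice of the bandwidth h, and
  \<open>g0 * L \<le> y\<close> is density. Each error is expressed as a multiple of
  \<open>y\<close>; the level \<open>4 * L\<close> beats the number of events in the union
  bound.\<close>

lemma neighborhood_rates:
  fixes n \<rho> x L u B k W g0 c' y E :: real
  assumes \<rho>: "0 < \<rho>" "\<rho> \<le> 1" and x: "0 < x" "x \<le> 1" and n: "0 < n" and L: "1 \<le> L" and u: "0 \<le> u" "u \<le>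
      2 * c'"
    and y: "y = n * \<rho>\<^sup>2 * x" and Lu: "L * u = y * x" and g0: "0 < g0" "g0 * L \<le> y"
    and k: "0 < k" and B: "0 \<le> B" "B \<le> k * u" and W: "0 < W"
    and E: "E = 2 * n * (\<rho> * (B * W)) + W\<^sup>2 * (4 * L)"
  shows "2 * sqrt (\<rho> * (B * W) * (n * (\<rho> * W)\<^sup>2) * (4 * L)) + 2 * (B * (\<rho> * W)) * (4 * L)
      \<le> (4 * sqrt (W ^ 3 * k) + 8 * W * k) * y"
    and "2 * sqrt (\<rho> * (B * W) * E * (4 * L)) + 2 * (B * W) * (4 * L) + 2 * W\<^sup>2
      \<le> (2 * sqrt (16 * W\<^sup>2 * k\<^sup>2 * c' + 16 * W ^ 3 * k / g0) + 8 * W * k + 2 * W\<^sup>2 / g0) * y"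
    and "E * \<rho> \<le> (2 * W * k + 4 * W\<^sup>2 / g0\<^sup>2) * y\<^sup>2"
proof -
  have y0: "0 < y" using y \<rho> x n by simp
  have "B * L \<le> k * u * L" using B(2) L by (intro mult_right_mono) auto
  also have "\<dots> = k * (L * u)" by simp
  finally have BL: "B * L \<le> k * (y * x)" unfolding Lu .
  have yx: "y * x \<le> y" using x y0 by simp
  have BLy: "B * L \<le> k * y" using BL mult_left_mono[OF yx, of k] k by linarith
  have \<rho>y: "\<rho> * z \<le> z" if "0 \<le> z" for z using that \<rho> by (simp add: mult_left_le_one_le)
  have Ly: "L \<le> y / g0" using g0 by (simp add: field_simps)
  have y2: "0 \<le> y\<^sup>2" by simp
  show "2 * sqrt (\<rho> * (B * W) * (n * (\<rho> * W)\<^sup>2) * (4 * L)) + 2 * (B * (\<rho> * W)) * (4 * L)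
      \<le> (4 * sqrt (W ^ 3 * k) + 8 * W * k) * y"
  proof -
    have "\<rho> * (B * W) * (n * (\<rho> * W)\<^sup>2) * (4 * L) = 4 * W ^ 3 * (\<rho> ^ 3 * n) * (B * L)"
      by (simp add: power2_eq_square power3_eq_cube)
    also have "\<dots> \<le> 4 * W ^ 3 * (\<rho> ^ 3 * n) * (k * (y * x))"
      using BL W \<rho> n by (intro mult_left_mono) auto
    also have "\<dots> = 4 * W ^ 3 * k * (\<rho> * y\<^sup>2)"
      by (simp add: y power2_eq_square power3_eq_cube)
    also have "\<dots> \<le> 4 * W ^ 3 * k * y\<^sup>2"
      using \<rho>y[OF y2] W k by (intro mult_left_mono) auto
    finally have "sqrt (\<rho> * (B * W) * (n * (\<rho> * W)\<^sup>2) * (4 * L)) \<le> sqrt (4 * W ^ 3 * k * y\<^sup>2)"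
      by (rule real_sqrt_le_mono)
    also have "\<dots> = 2 * sqrt (W ^ 3 * k) * y" using y0 by (simp add: real_sqrt_mult)
    finally have 1: "2 * sqrt (\<rho> * (B * W) * (n * (\<rho> * W)\<^sup>2) * (4 * L)) \<le> 4 * sqrt (W ^ 3 * k) * y"
        by linarith
    have "2 * (B * (\<rho> * W)) * (4 * L) = \<rho> * (8 * W * (B * L))" by simp
    also have "\<dots> \<le> 8 * W * (B * L)" by (rule \<rho>y) (use W B L in auto)
    also have "\<dots> \<le> 8 * W * (k * y)" using BLy W by (intro mult_left_mono) auto
    finally have 2: "2 * (B * (\<rho> * W)) * (4 * L) \<le> 8 * W * (k * y)" .
    have "(4 * sqrt (W ^ 3 * k) + 8 * W * k) * y = 4 * sqrt (W ^ 3 * k) * y + 8 * W * (k * y)"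
      by (simp add: algebra_simps)
    then show ?thesis using 1 2 by linarith
  qed
  show "2 * sqrt (\<rho> * (B * W) * E * (4 * L)) + 2 * (B * W) * (4 * L) + 2 * W\<^sup>2
      \<le> (2 * sqrt (16 * W\<^sup>2 * k\<^sup>2 * c' + 16 * W ^ 3 * k / g0) + 8 * W * k + 2 * W\<^sup>2 / g0) * y"
  proof -
    \<comment> \<open>Contribution of the mean row energy. One factor \<open>B\<close> takes up
      \<open>L\<close> and becomes \<open>y * x\<close>; the other is only bounded, because
      \<open>u\<close> is.\<close>
    have "(n * \<rho>\<^sup>2) * (B * (B * L)) \<le> (n * \<rho>\<^sup>2) * (k * u * (k * (y * x)))"
      by (rule mult_left_mono[OF mult_mono[OF B(2) BL]]) (use B L n \<rho> u k in auto)
    also have "\<dots> = k\<^sup>2 * y\<^sup>2 * u" by (simp add: y power2_eq_square)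
    also have "\<dots> \<le> k\<^sup>2 * y\<^sup>2 * (2 * c')" using u by (intro mult_left_mono) auto
    finally have p1: "(n * \<rho>\<^sup>2) * (B * (B * L)) \<le> 2 * k\<^sup>2 * c' * y\<^sup>2" by (simp add: mult_ac)
    have "B * L * L \<le> k * y * (y / g0)" by (rule mult_mono[OF BLy Ly]) (use k y0 L in auto)
    then have p2: "\<rho> * (B * L * L) \<le> k / g0 * y\<^sup>2"
      using order_trans[OF \<rho>y[of "B * L * L"]] B L by (simp add: power2_eq_square)
    have "\<rho> * (B * W) * E * (4 * L) = 8 * W\<^sup>2 * ((n * \<rho>\<^sup>2) * (B * (B * L))) +
        16 * W ^ 3 * (\<rho> * (B * L * L))"
      by (simp add: E algebra_simps power2_eq_square power3_eq_cube)
    also have "\<dots> \<le> 8 * W\<^sup>2 * (2 * k\<^sup>2 * c' * y\<^sup>2) + 16 * W ^ 3 * (k / g0 * y\<^sup>2)"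
      using p1 p2 W by (intro add_mono mult_left_mono) auto
    also have "\<dots> = (16 * W\<^sup>2 * k\<^sup>2 * c' + 16 * W ^ 3 * k / g0) * y\<^sup>2" by (simp add: algebra_simps)
    finally have "sqrt (\<rho> * (B * W) * E * (4 * L)) \<le> sqrt ((16 * W\<^sup>2 * k\<^sup>2 * c' +
        16 * W ^ 3 * k / g0) * y\<^sup>2)"
      by (rule real_sqrt_le_mono)
    also have "\<dots> = sqrt (16 * W\<^sup>2 * k\<^sup>2 * c' + 16 * W ^ 3 * k / g0) * y" using y0
        by (simp add: real_sqrt_mult)
    finally have 1: "2 * sqrt (\<rho> * (B * W) * E * (4 * L)) \<le> 2 * sqrt (16 * W\<^sup>2 * k\<^sup>2 * c' +
        16 * W ^ 3 * k / g0) * y" by simp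
    have 2: "2 * (B * W) * (4 * L) \<le> 8 * W * k * y"
      using mult_left_mono[OF BLy, of "8 * W"] W by (simp add: mult_ac)
    have "1 \<le> y / g0" using Ly L by linarith
    then have 3: "2 * W\<^sup>2 \<le> 2 * W\<^sup>2 / g0 * y" using mult_left_mono[of 1 "y / g0" "2 * W\<^sup>2"] by simp
    show ?thesis using 1 2 3 by (simp add: distrib_right)
  qed
  \<comment> \<open>The energy will be compared with \<open>y\<close> times the neighborhood size,
    which is at least of order \<open>n * \<rho> * x\<close>. Since
    \<open>y\<^sup>2 = y * (n * \<rho> * x) * \<rho>\<close>, the extra factor \<open>\<rho>\<close>
    on the left avoids a division.\<close>
  show "E * \<rho> \<le> (2 * W * k + 4 * W\<^sup>2 / g0\<^sup>2) * y\<^sup>2"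
  proof -
    have "B \<le> B * L" using B L by (simp add: mult_le_cancel_left1)
    then have "B \<le> k * (y * x)" using BL by linarith
    then have "(2 * W * n * \<rho>\<^sup>2) * B \<le> (2 * W * n * \<rho>\<^sup>2) * (k * (y * x))" using W n
        by (intro mult_left_mono) auto
    also have "\<dots> = 2 * W * k * y\<^sup>2" by (simp add: y power2_eq_square)
    finally have 1: "(2 * W * n * \<rho>\<^sup>2) * B \<le> 2 * W * k * y\<^sup>2" .
    have "L \<le> L * L" using L by simp
    also have "\<dots> \<le> y / g0 * (y / g0)" using Ly L by (intro mult_mono) auto
    finally have "L \<le> y\<^sup>2 / g0\<^sup>2" by (simp add: power2_eq_square)
    then have "\<rho> * L \<le> y\<^sup>2 / g0\<^sup>2" using \<rho>y[of L] L by linarith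
    then have "4 * W\<^sup>2 * (\<rho> * L) \<le> 4 * W\<^sup>2 * (y\<^sup>2 / g0\<^sup>2)" by (intro mult_left_mono) auto
    then show ?thesis using 1 by (simp add: E algebra_simps power2_eq_square)
  qed
qed

text \<open>The first identity is the defining equation of the bandwidth, with
  \<open>h0 powr (2 * \<beta> + 1)\<close> written as \<open>h0 * x\<^sup>2\<close>. The others
  translate the error rate, the second and the third bandwidth into powers of \<open>\<rho>\<close>,
  \<open>x\<close> and \<open>h0\<close>.\<close>

lemma neighborhood_bandwidth_identities:
  fixes n m \<rho> \<beta> L :: real
  defines "d \<equiv> 2 * \<beta> + 1"
  defines "h0 \<equiv> (L / (\<rho>\<^sup>2 * n * m)) powr (1 / d)"
  defines "x \<equiv> h0 powr \<beta>"
  assumes pos: "0 < n" "0 < m" "0 < \<rho>" "0 < \<beta>" "0 < L"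
  shows "\<rho>\<^sup>2 * n * m * h0 * x\<^sup>2 = L"
    and "\<rho> powr ((2 * \<beta> + 2) / d) * (L / (n * m)) powr (\<beta> / d) = \<rho>\<^sup>2 * x"
    and "\<rho> powr (1 / d) * (L / (n * m)) powr (\<beta> / d) = \<rho> * x"
    and "\<rho> powr (- 2 / d) * (L / (n * m)) powr (1 / d) = h0"
proof -
  define v where "v = L / (n * m)"
  have v: "0 < v" using pos by (simp add: v_def)
  have d: "0 < d" using pos by (simp add: d_def)
  have h0: "h0 = v powr (1 / d) * \<rho> powr (- 2 / d)"
  proof -
    have "L / (\<rho>\<^sup>2 * n * m) = v * \<rho> powr (- 2)"
      using pos by (simp add: v_def powr_minus powr_numeral field_simps)
    then show ?thesis using v pos by (simp add: h0_def powr_mult powr_powr)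
  qed
  have h0pos: "0 < h0" using v pos by (simp add: h0)
  have x: "x = v powr (\<beta> / d) * \<rho> powr (- 2 * \<beta> / d)"
    using v pos by (simp add: x_def h0 powr_mult powr_powr)
  have "x\<^sup>2 = h0 powr (2 * \<beta>)" by (simp add: x_def power2_eq_square powr_add[symmetric])
  moreover have "h0 powr 1 = h0" using h0pos by simp
  ultimately have "h0 * x\<^sup>2 = h0 powr 1 * h0 powr (2 * \<beta>)" by (simp only:)
  also have "\<dots> = h0 powr d" unfolding powr_add[symmetric] by (simp add: d_def add.commute)
  also have "\<dots> = L / (\<rho>\<^sup>2 * n * m)" using d pos by (simp add: h0_def powr_powr)
  finally have "h0 * x\<^sup>2 = L / (\<rho>\<^sup>2 * n * m)" .
  then show "\<rho>\<^sup>2 * n * m * h0 * x\<^sup>2 = L" using pos by (simp add: field_simps)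
  have "2 + - 2 * \<beta> / d = (2 * \<beta> + 2) / d" using d by (simp add: field_simps d_def)
  then have "\<rho> powr ((2 * \<beta> + 2) / d) = \<rho> powr 2 * \<rho> powr (- 2 * \<beta> / d)" by (simp add: powr_add[symmetric])
  then show "\<rho> powr ((2 * \<beta> + 2) / d) * (L / (n * m)) powr (\<beta> / d) = \<rho>\<^sup>2 * x"
    using pos by (simp add: x v_def[symmetric] powr_numeral)
  have e: "1 + - 2 * \<beta> / d = 1 / d" using d by (simp add: field_simps d_def)
  have "\<rho> powr (1 / d) = \<rho> powr 1 * \<rho> powr (- 2 * \<beta> / d)" unfolding powr_add[symmetric] e ..
  then show "\<rho> powr (1 / d) * (L / (n * m)) powr (\<beta> / d) = \<rho> * x"
    using pos by (simp add: x v_def[symmetric])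
  show "\<rho> powr (- 2 / d) * (L / (n * m)) powr (1 / d) = h0"
    by (simp add: h0 v_def[symmetric])
qed

text \<open>With \<open>y = n * \<rho>\<^sup>2 / L\<close> the density condition becomes
  \<open>b\<^sup>2 * m powr (\<beta> / (\<beta> + 1)) \<le> y\<close>. Raising it to the power
  \<open>(\<beta> + 1) / d\<close> turns the factor in \<open>m\<close> into
  \<open>m powr (\<beta> / d)\<close>, which cancels against
  \<open>x = (y * m) powr (- \<beta> / d)\<close>.\<close>

lemma dense_regime_lower_bound:
  fixes n m \<rho> \<beta> L b :: real
  defines "d \<equiv> 2 * \<beta> + 1"
  defines "x \<equiv> ((L / (\<rho>\<^sup>2 * n * m)) powr (1 / d)) powr \<beta>"
  assumes pos: "0 < n" "0 < m" "0 < \<rho>" "0 < \<beta>" "0 < L" "0 < b"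
    and dense: "b * sqrt (n * m powr (\<beta> / (\<beta> + 1)) * L) \<le> n * \<rho>"
  shows "(b\<^sup>2) powr ((\<beta> + 1) / d) * L \<le> n * \<rho>\<^sup>2 * x"
proof -
  define y where "y = n * \<rho>\<^sup>2 / L"
  have d: "0 < d" using pos by (simp add: d_def)
  have y: "0 < y" using pos by (simp add: y_def)
  have "(b * sqrt (n * m powr (\<beta> / (\<beta> + 1)) * L))\<^sup>2 \<le> (n * \<rho>)\<^sup>2"
    by (rule power_mono[OF dense]) (use pos in auto)
  then have "b\<^sup>2 * (n * m powr (\<beta> / (\<beta> + 1)) * L) \<le> n\<^sup>2 * \<rho>\<^sup>2"
    using pos by (simp add: power_mult_distrib)
  then have "n * L * (b\<^sup>2 * m powr (\<beta> / (\<beta> + 1))) \<le> n * L * y"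
    using pos by (simp add: y_def power2_eq_square mult_ac)
  then have "b\<^sup>2 * m powr (\<beta> / (\<beta> + 1)) \<le> y" using pos by simp
  then have "(b\<^sup>2 * m powr (\<beta> / (\<beta> + 1))) powr ((\<beta> + 1) / d) \<le> y powr ((\<beta> + 1) / d)"
    using pos d by (intro powr_mono2) auto
  moreover have "(b\<^sup>2 * m powr (\<beta> / (\<beta> + 1))) powr ((\<beta> + 1) / d) = (b\<^sup>2) powr ((\<beta> +
      1) / d) * m powr (\<beta> / d)"
    using pos by (simp add: powr_mult powr_powr)
  ultimately have le: "(b\<^sup>2) powr ((\<beta> + 1) / d) * m powr (\<beta> / d) \<le> y powr ((\<beta> + 1) / d)" by simp
  have eq: "L / (\<rho>\<^sup>2 * n * m) = (y * m) powr (- 1)"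
    using pos y by (simp add: y_def powr_minus field_simps)
  have "x = (y * m) powr (- \<beta> / d)" unfolding x_def eq powr_powr by simp
  also have "\<dots> = y powr (- \<beta> / d) * m powr (- (\<beta> / d))"
    using y pos by (simp add: powr_mult)
  finally have "y * x = y powr 1 * y powr (- \<beta> / d) * m powr (- (\<beta> / d))" using y by simp
  also have "y powr 1 * y powr (- \<beta> / d) = y powr ((\<beta> + 1) / d)"
  proof -
    have "1 + - \<beta> / d = (\<beta> + 1) / d" using d by (simp add: field_simps d_def)
    then show ?thesis unfolding powr_add[symmetric] by simp
  qed
  also have "y powr ((\<beta> + 1) / d) * m powr (- (\<beta> / d)) \<ge> (b\<^sup>2) powr ((\<beta> +
      1) / d) * m powr (\<beta> / d) * m powr (- (\<beta> / d))"
    using le by (intro mult_right_mono) auto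
  also have "(b\<^sup>2) powr ((\<beta> + 1) / d) * m powr (\<beta> / d) * m powr (- (\<beta> / d)) = (b\<^sup>2) powr ((\<beta> + 1) / d)"
    using pos by (simp add: powr_minus)
  finally have "(b\<^sup>2) powr ((\<beta> + 1) / d) \<le> y * x" .
  then have "(b\<^sup>2) powr ((\<beta> + 1) / d) * L \<le> y * x * L" using pos by (intro mult_right_mono) auto
  then show ?thesis using pos by (simp add: y_def mult_ac)
qed

text \<open>The third identity shows that the prescribed \<open>h3\<close> is the square of the
  first-stage scale \<open>h0\<close>. Its bias is thus of order \<open>x\<^sup>2\<close> instead of
  \<open>x\<close>, which is harmless once \<open>h0\<close> is bounded.\<close>

lemma one_node_bandwidth_identities:
  fixes m \<rho> \<beta> L :: real
  defines "d \<equiv> 2 * \<beta> + 1"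
  defines "h0 \<equiv> (L / (\<rho> * m)) powr (1 / d)"
  defines "x \<equiv> h0 powr \<beta>"
  assumes pos: "0 < m" "0 < \<rho>" "0 < \<beta>" "0 < L"
  shows "\<rho> * m * h0 * x\<^sup>2 = L"
    and "\<rho> powr ((2 * \<beta> + 2) / d) * (L / m) powr (2 * \<beta> / d) = (\<rho> * x)\<^sup>2"
    and "\<rho> powr (- 2 / d) * (L / m) powr (2 / d) = h0\<^sup>2"
proof -
  define v where "v = L / m"
  have v: "0 < v" using pos by (simp add: v_def)
  have d: "0 < d" using pos by (simp add: d_def)
  have h0: "h0 = v powr (1 / d) * \<rho> powr (- 1 / d)"
  proof -
    have eq: "L / (\<rho> * m) = v * \<rho> powr (- 1)"
      using pos by (simp add: v_def powr_minus field_simps)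
    have "h0 = v powr (1 / d) * (\<rho> powr (- 1)) powr (1 / d)"
      unfolding h0_def eq by (rule powr_mult)
    then show ?thesis unfolding powr_powr by simp
  qed
  have h0pos: "0 < h0" using v pos by (simp add: h0)
  have x: "x = v powr (\<beta> / d) * \<rho> powr (- \<beta> / d)"
    using v pos by (simp add: x_def h0 powr_mult powr_powr)
  have "x\<^sup>2 = h0 powr (2 * \<beta>)" by (simp add: x_def power2_eq_square powr_add[symmetric])
  moreover have "h0 powr 1 = h0" using h0pos by simp
  ultimately have "h0 * x\<^sup>2 = h0 powr 1 * h0 powr (2 * \<beta>)" by (simp only:)
  also have "\<dots> = h0 powr d" unfolding powr_add[symmetric] by (simp add: d_def add.commute)
  also have "\<dots> = L / (\<rho> * m)" using d pos by (simp add: h0_def powr_powr)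
  finally have "h0 * x\<^sup>2 = L / (\<rho> * m)" .
  then show "\<rho> * m * h0 * x\<^sup>2 = L" using pos by (simp add: field_simps)
  have "2 + - \<beta> / d + - \<beta> / d = (2 * d - 2 * \<beta>) / d" using d by (simp add: field_simps)
  also have "2 * d - 2 * \<beta> = 2 * \<beta> + 2" by (simp add: d_def)
  finally have e: "2 + - \<beta> / d + - \<beta> / d = (2 * \<beta> + 2) / d" .
  have "\<rho> powr ((2 * \<beta> + 2) / d) = \<rho> powr 2 * \<rho> powr (- \<beta> / d) * \<rho> powr (- \<beta> / d)"
    unfolding powr_add[symmetric] e ..
  moreover have "v powr (2 * \<beta> / d) = v powr (\<beta> / d) * v powr (\<beta> / d)" by (simp add: powr_add[symmetric])
  ultimately show "\<rho> powr ((2 * \<beta> + 2) / d) * (L / m) powr (2 * \<beta> / d) = (\<rho> * x)\<^sup>2"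
    using pos by (simp add: x v_def[symmetric] powr_numeral power2_eq_square mult_ac)
  have "\<rho> powr (- 2 / d) = \<rho> powr (- 1 / d) * \<rho> powr (- 1 / d)" "v powr (2 / d) =
      v powr (1 / d) * v powr (1 / d)"
    by (simp_all add: powr_add[symmetric])
  then show "\<rho> powr (- 2 / d) * (L / m) powr (2 / d) = h0\<^sup>2"
    by (simp add: h0 v_def[symmetric] power2_eq_square mult_ac)
qed

text \<open>Makes the cell width smaller than the minimal block length once n m is large.\<close>

lemma eventually_log_ratio_powr_small:
  fixes e \<epsilon> :: real
  assumes "0 < e" "0 < \<epsilon>"
  shows "\<forall>\<^sub>F z in at_top. (ln z / z) powr e \<le> \<epsilon>"
proof -
  have "((\<lambda>z::real. ln z / z) \<longlongrightarrow> 0) at_top" by (rule ln_x_over_x_tendsto_0)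
  then have "\<forall>\<^sub>F z in at_top. ln z / z < \<epsilon> powr (1 / e)" using assms by (intro order_tendstoD) auto
  moreover have "\<forall>\<^sub>F z in at_top. (1::real) \<le> z" by (rule eventually_ge_at_top)
  ultimately show ?thesis
  proof eventually_elim
    case (elim z)
    then have "(ln z / z) powr e \<le> (\<epsilon> powr (1 / e)) powr e" using assms by (intro powr_mono2) auto
    then show ?case using assms by (simp add: powr_powr)
  qed
qed

text \<open>There are at most \<open>z\<^sup>2\<close> triples and each fails with probability of
  order \<open>z\<close> to the power -4; the constant 5 is absorbed by
  \<open>5 \<le> z\<close>.\<close>

lemma union_bound_small:
  fixes n m :: nat
  defines "z \<equiv> real n * real m"
  assumes "1 \<le> n" "1 \<le> m" "5 \<le> z"
  shows "real m * real n * real n * (5 * exp (- (4 * ln z))) \<le> 1 / z"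
proof -
  have z: "0 < z" using assms(4) by simp
  have "exp (- (4 * ln z)) = 1 / z ^ 4"
    using z exp_of_nat_mult[of 4 "ln z"] by (simp add: exp_minus divide_inverse)
  moreover have "real m * real n * real n \<le> z\<^sup>2"
    using assms(2,3) by (simp add: z_def power2_eq_square mult_le_cancel_left1 mult_ac)
  ultimately have "real m * real n * real n * (5 * exp (- (4 * ln z))) \<le> z\<^sup>2 * (5 * (1 / z ^ 4))"
    using z by (intro mult_mono) auto
  also have "\<dots> = 5 / z * (1 / z)" using z by (simp add: power2_eq_square power4_eq_xxxx field_simps)
  also have "\<dots> \<le> 1 * (1 / z)" using z assms(4) by (intro mult_right_mono) auto
  finally show ?thesis by simp
qed

text \<open>The occupancy condition bounds \<open>1 / r\<close> by \<open>n\<close>, so there are at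
  most \<open>z\<^sup>2\<close> cells, and \<open>16 * ln z \<le> n * r\<close> makes each cell fail
  with probability at most \<open>z\<close> to the power -4.\<close>

lemma cell_bound_small:
  fixes n m :: nat and r :: real
  defines "z \<equiv> real n * real m"
  assumes "1 \<le> n" "1 \<le> m" "5 \<le> z" "2 * real J \<le> z" "1 \<le> ln z" "16 * ln z \<le> real n * r"
  shows "real J * (1 / r + 1) * exp (- (real n * r / 4)) \<le> 1 / z"
proof -
  have z: "0 < z" using assms(4) by simp
  have r: "0 < r" using assms(2,6,7) by (smt (verit) mult_nonneg_nonpos of_nat_0_le_iff)
  have "1 \<le> real n * r" using assms(6,7) by linarith
  then have "1 / r \<le> real n" using r by (simp add: field_simps)
  also have "real n \<le> z" using assms(3) by (simp add: z_def mult_le_cancel_left1)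
  finally have "1 / r + 1 \<le> 2 * z" using assms(4) by linarith
  then have "real J * (1 / r + 1) \<le> real J * (2 * z)" by (intro mult_left_mono) auto
  also have "\<dots> = 2 * real J * z" by simp
  also have "\<dots> \<le> z * z" using assms(5) z by (intro mult_right_mono) auto
  finally have 1: "real J * (1 / r + 1) \<le> z * z" .
  have "exp (- (real n * r / 4)) \<le> exp (- (4 * ln z))" using assms(7) by simp
  also have "\<dots> = 1 / z ^ 4"
    using z exp_of_nat_mult[of 4 "ln z"] by (simp add: exp_minus divide_inverse)
  finally have "real J * (1 / r + 1) * exp (- (real n * r / 4)) \<le> z * z * (1 / z ^ 4)"
    by (rule mult_mono[OF 1]) (use z in auto)
  also have "\<dots> = 1 / z * (1 / z)" using z by (simp add: power4_eq_xxxx field_simps)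
  also have "\<dots> \<le> 1 * (1 / z)" using z assms(4) by (intro mult_right_mono) auto
  finally show ?thesis by simp
qed

section \<open>The estimates with explicit constants\<close>

text \<open>The constants are fixed before the sample sizes, \<open>\<rho>\<close> and the
  probability space. The bound is asserted for every \<open>C \<ge> C0\<close>, so that both regimes
  can finally share one constant.\<close>

lemma dense_regime_estimate:
  fixes f :: "real \<Rightarrow> real \<Rightarrow> real \<Rightarrow> real" and K :: "real \<Rightarrow> real" and T :: "nat \<Rightarrow> nat \<Rightarrow> real"
    and \<beta> L1 L2 \<delta> lam0 a0 Kmax c c' b :: real and J m0 :: nat
  defines "d \<equiv> 2 * \<beta> + 1"
  assumes graphon: "time_varying_graphon f"
    and holder: "0 < \<beta>" "0 < L1" "holder_in_time \<beta> L1 f"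
    and lipschitz: "0 < \<delta>" "1 \<le> J" "piecewise_lipschitz \<delta> J L2 f"
    and observed: "\<forall>m. \<forall>k\<in>{1..m}. T m k \<in> {0..1}"
    and lam0: "0 < lam0" and LP2: "0 < a0" "LP2 a0 T" and LP3: "LP3 Kmax K"
    and cpos: "0 < c" "0 < c'" "0 < b"
  shows "\<exists>C0>0. \<exists>N. \<forall>C\<ge>C0. \<forall>n\<ge>N. \<forall>m\<ge>N. \<forall>\<rho> h1 h2 h3 (M :: 'a measure) \<xi> A.
      0 < \<rho> \<longrightarrow> \<rho> < 1 \<longrightarrow>
      sqrt (ln (real n * real m) / (real n * real m)) \<le> \<rho> \<longrightarrow>
      sparse_graphon_sample M n m f \<rho> (T m) \<xi> A \<longrightarrow>
      LP1 K (nat \<lfloor>\<beta>\<rfloor>) lam0 m0 m (T m) h1 \<longrightarrow>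
      LP1 K (nat \<lfloor>\<beta>\<rfloor>) lam0 m0 m (T m) h3 \<longrightarrow>
      b * degree_threshold \<beta> n m \<le> real n * \<rho> \<longrightarrow>
      same_order c c' h1 ((ln (real n * real m) / (\<rho>\<^sup>2 * real n * real m)) powr (1 / d)) \<longrightarrow>
      same_order c c' h2 (\<rho> powr (1 / d) * (ln (real n * real m) / (real n * real m)) powr (\<beta> / d)) \<longrightarrow>
      h3 = \<rho> powr (- 2 / d) * (ln (real n * real m) / (real n * real m)) powr (1 / d) \<longrightarrow>
      1 - 2 / (real n * real m) \<le> measure M {\<omega> \<in> space M.
        sup_error n
          (three_stage_estimator K (nat \<lfloor>\<beta>\<rfloor>) n m (T m) h1 (Some h2) h3 (\<lambda>k i j. A k i j \<omega>))
          (edge_prob f \<rho> \<xi> \<omega>)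
        \<le> ereal (C * \<rho> powr ((2 * \<beta> + 2) / d) * (ln (real n * real m) / (real n * real m)) powr (\<beta> / d))}"
proof -
  note times = observed[rule_format]
  define l where "l = nat \<lfloor>\<beta>\<rfloor>"
  define cw where "cw = Kmax * real (Suc l) / lam0 + 1"
  define W where "W = 2 * a0 * cw"
  define k where "k = cw / c"
  define g0 where "g0 = (b\<^sup>2) powr ((\<beta> + 1) / d)"
  \<comment> \<open>The cell width will be \<open>rc * (\<rho> * x)\<close>. The part
    \<open>4 * c'\<close> makes a quarter of \<open>n * r\<close> exceed the neighborhood size
    \<open>n * h2\<close>; the part \<open>16 / g0\<close> gives \<open>16 * L \<le> n * r\<close>
    by density.\<close>
  define rc where "rc = 4 * c' + 16 / g0"
  define k1 where "k1 = 4 * sqrt (W ^ 3 * k) + 8 * W * k"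
  define k2 where "k2 = 2 * sqrt (16 * W\<^sup>2 * k\<^sup>2 * c' + 16 * W ^ 3 * k / g0) + 8 * W * k + 2 * W\<^sup>2 / g0"
  define k3 where "k3 = (2 * W * k + 4 * W\<^sup>2 / g0\<^sup>2) / c"
  define k4 where "k4 = W * (L2 * rc) * W"
  define k5 where "k5 = (L1 * c' powr \<beta> * W)\<^sup>2"
  define k6 where "k6 = (L1 * W)\<^sup>2"
  \<comment> \<open>One summand for each requirement: products of noise with signal and with noise,
    row energy, variation over a cell, and the biases of the first and third stage.
    \<open>k3\<close> contains \<open>1 / c\<close> because \<open>h2\<close> is only bounded below
    by \<open>c * (\<rho> * x)\<close>.\<close>
  define Gc where "Gc = 1 + k1 + k2 + k3 + k4 + k5 + k6"
  have "0 \<le> Kmax" using LP3 order_trans[OF abs_ge_zero] unfolding LP3_def by blast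
  then have cw: "0 < cw" "Kmax * real (Suc l) / lam0 \<le> cw"
    using lam0 by (auto simp: cw_def intro!: add_nonneg_pos)
  have W: "0 < W" using LP2 cw by (simp add: W_def)
  have k: "0 < k" using cw cpos by (simp add: k_def)
  have d: "0 < d" "1 \<le> d" using holder by (auto simp: d_def)
  have g0: "0 < g0" using cpos by (simp add: g0_def)
  have "0 < 4 * c'" "0 < 16 / g0" using cpos g0 by simp_all
  then have rc: "0 < rc" "4 * c' \<le> rc" "16 / g0 \<le> rc" unfolding rc_def by linarith+
  have L2: "0 \<le> L2" by (rule piecewise_lipschitz_cells(2)[OF lipschitz(3,2,1) order_refl])
  have ks: "0 \<le> k1" "0 \<le> k2" "0 \<le> k3" "0 \<le> k4" "0 \<le> k5" "0 \<le> k6"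
    using W k g0 cpos L2 rc by (auto simp: k1_def k2_def k3_def k4_def k5_def k6_def)
  have Gc: "k1 \<le> Gc" "k2 \<le> Gc" "k3 \<le> Gc" "k4 \<le> Gc" "k5 \<le> Gc" "k6 \<le> Gc" "0 < Gc"
    using ks by (auto simp: Gc_def)
  obtain z0 where z0: "\<And>z. z0 \<le> z \<Longrightarrow> (ln z / z) powr (\<beta> / d) \<le> \<delta> / rc"
    using eventually_log_ratio_powr_small[of "\<beta> / d" "\<delta> / rc"] holder d rc lipschitz
    unfolding eventually_at_top_linorder by auto
  define N where "N = 5 + m0 + 2 * J + nat \<lceil>z0\<rceil>"
  define C0 where "C0 = (210 * W\<^sup>2 + 2) * Gc"
  have C0: "0 < C0" using Gc by (auto simp: C0_def intro!: mult_pos_pos add_nonneg_pos)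
  show ?thesis
  proof (intro exI[of _ C0] conjI C0 exI[of _ N] allI impI)
    fix C n m \<rho> h1 h2 h3 and M :: "'a measure" and \<xi> A
    assume C: "C0 \<le> C" and nN: "N \<le> n" and mN: "N \<le> m" and \<rho>: "0 < \<rho>" "\<rho> < 1"
      and sparse: "sqrt (ln (real n * real m) / (real n * real m)) \<le> \<rho>"
      and sample: "sparse_graphon_sample M n m f \<rho> (T m) \<xi> A"
      and LP1: "LP1 K (nat \<lfloor>\<beta>\<rfloor>) lam0 m0 m (T m) h1" "LP1 K (nat \<lfloor>\<beta>\<rfloor>) lam0 m0 m (T m) h3"
      and dense: "b * degree_threshold \<beta> n m \<le> real n * \<rho>"
      and h1: "same_order c c' h1 ((ln (real n * real m) / (\<rho>\<^sup>2 * real n * real m)) powr (1 / d))"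
      and h2: "same_order c c' h2 (\<rho> powr (1 / d) * (ln (real n * real m) / (real n * real m)) powr (\<beta> / d))"
      and h3: "h3 = \<rho> powr (- 2 / d) * (ln (real n * real m) / (real n * real m)) powr (1 / d)"
    interpret S: sparse_graphon_sample M n m f \<rho> "T m" \<xi> A by (rule sample)
    define z where "z = real n * real m"
    define L where "L = ln z"
    define h0 where "h0 = (L / (\<rho>\<^sup>2 * real n * real m)) powr (1 / d)"
    define x where "x = h0 powr \<beta>"
    define y where "y = real n * \<rho>\<^sup>2 * x"
    define u where "u = 1 / (real m * h0)"
    define B where "B = cw / (real m * h1)"
    define G where "G = Gc * (\<rho>\<^sup>2 * x)"
    define r where "r = rc * (\<rho> * x)"
    define E where "E = 2 * real n * (\<rho> * (B * W)) + W\<^sup>2 * (4 * L)"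
    have nm: "5 \<le> n" "5 \<le> m" "m0 \<le> m" using nN mN by (auto simp: N_def)
    have zN: "real N \<le> z"
    proof -
      have "real N * 1 \<le> real n * real m" using nN nm by (intro mult_mono) auto
      then show ?thesis by (simp add: z_def)
    qed
    have z: "5 \<le> z" "2 * real J \<le> z" "z0 \<le> z"
      using zN real_nat_ceiling_ge[of z0] by (auto simp: N_def)
    have L1': "1 \<le> L"
    proof -
      have "exp 1 \<le> z" using exp_le z by linarith
      then have "ln (exp 1) \<le> ln z" using z by (subst ln_le_cancel_iff) auto
      then show ?thesis by (simp add: L_def)
    qed
    have pos: "0 < real n" "0 < real m" "0 < \<rho>" "0 < \<beta>" "0 < L" using nm \<rho> holder L1' by auto
    note ids = neighborhood_bandwidth_identities[OF pos, folded d_def, folded h0_def, folded x_def]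
    have h0: "0 < h0" using pos by (simp add: h0_def)
    have x: "0 < x" using h0 by (simp add: x_def)
    \<comment> \<open>The assumed lower bound on \<open>\<rho>\<close> says precisely that the base
      of \<open>h0\<close> is at most 1; hence \<open>h0\<close> and \<open>x\<close> are at most
      1.\<close>
    have "L / z \<le> \<rho>\<^sup>2" using power_mono[OF sparse, of 2] L1' z
        by (simp add: z_def[symmetric] L_def[symmetric])
    then have "L / (\<rho>\<^sup>2 * real n * real m) \<le> 1" using pos by (simp add: z_def field_simps)
    then have "h0 \<le> 1 powr (1 / d)" unfolding h0_def using pos d by (intro powr_mono2) auto
    then have h01: "h0 \<le> 1" by simp
    then have "x \<le> 1 powr \<beta>" unfolding x_def using h0 holder by (intro powr_mono2) auto
    then have x1: "x \<le> 1" by simp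
    have h1b: "c * h0 \<le> h1" "h1 \<le> c' * h0"
      using h1 unfolding same_order_def z_def[symmetric] L_def[symmetric] h0_def by auto
    have h1pos: "0 < h1" using h1b h0 cpos by (meson less_le_trans mult_pos_pos)
    have h2b: "c * (\<rho> * x) \<le> h2" "h2 \<le> c' * (\<rho> * x)"
      using h2 unfolding same_order_def z_def[symmetric] L_def[symmetric] ids(3)[folded z_def] by auto
    have h2pos: "0 < h2" using h2b x pos cpos by (meson less_le_trans mult_pos_pos)
    have h3eq: "h3 = h0" using h3 unfolding z_def[symmetric] L_def[symmetric] ids(4)[folded z_def] .
    have g0L: "g0 * L \<le> y"
      using dense_regime_lower_bound[OF pos cpos(3)] dense
      unfolding g0_def y_def x_def h0_def d_def degree_threshold_def z_def[symmetric] L_def[symmetric]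
          by simp
    have y: "0 < y" using pos x by (simp add: y_def)
    have ws1: "weight_system (nat \<lfloor>\<beta>\<rfloor>) m (T m) h1 (lp_weight K l m (T m) h1) B W"
      unfolding B_def W_def l_def[symmetric]
      by (rule lp_weight_system[OF LP1(1)[folded l_def] nm(3) lam0 LP3 h1pos _ LP2(2,1) times cw])
          (use nm in auto)
    have ws3: "weight_system (nat \<lfloor>\<beta>\<rfloor>) m (T m) h3 (lp_weight K l m (T m) h3) (cw / (real m * h3)) W"
      unfolding W_def l_def[symmetric]
      by (rule lp_weight_system[OF LP1(2)[folded l_def] nm(3) lam0 LP3 _ _ LP2(2,1) times cw])
          (use nm h0 h3eq in auto)
    have mh: "1 \<le> 2 * (real m * h1)" by (rule lp_bandwidth_ge[OF LP1(1) nm(3) lam0 LP3 h1pos])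
    \<comment> \<open>The upper bound comes from the covering argument:
      \<open>1 \<le> 2 * (m * h1)\<close> and \<open>h1 \<le> c' * h0\<close>.\<close>
    have u: "0 \<le> u" "u \<le> 2 * c'"
    proof -
      show "0 \<le> u" using h0 by (simp add: u_def)
      have "2 * (real m * h1) \<le> 2 * (real m * (c' * h0))" using h1b(2) by (intro mult_left_mono) auto
      then have "1 \<le> 2 * c' * (real m * h0)" using mh by (simp add: mult_ac)
      then show "u \<le> 2 * c'" unfolding u_def using pos h0 by (subst pos_divide_le_eq) auto
    qed
    have Lu: "L * u = y * x"
    proof -
      have "L * u = \<rho>\<^sup>2 * real n * real m * h0 * x\<^sup>2 * u" unfolding ids(1) ..
      also have "\<dots> = y * x" using pos h0 by (simp add: u_def y_def power2_eq_square)
      finally show ?thesis .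
    qed
    have B: "0 \<le> B" "B \<le> k * u"
    proof -
      show "0 \<le> B" using cw h1pos by (simp add: B_def)
      have "B \<le> cw / (real m * (c * h0))"
        unfolding B_def using cw pos h0 h1b cpos h1pos
            by (intro divide_left_mono mult_left_mono mult_pos_pos) auto
      then show "B \<le> k * u" by (simp add: k_def u_def mult_ac)
    qed
    note rates = neighborhood_rates[OF \<rho>(1) less_imp_le[OF \<rho>(2)] x x1 pos(1) L1' u y_def Lu g0 g0L k B W E_def]
    have nG: "real n * G = Gc * y" by (simp add: G_def y_def mult_ac)
    have yG: "kk * y \<le> real n * G" if "kk \<le> Gc" for kk
      unfolding nG using that y by (intro mult_right_mono) auto
    have \<rho>\<rho>: "\<rho> * (\<rho> * x) \<le> \<rho> * x" using \<rho> x by (intro mult_left_le_one_le) auto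
    \<comment> \<open>The squared bias is of order \<open>(\<rho> * x)\<^sup>2\<close> and thus
      dominated by the scale \<open>\<rho>\<^sup>2 * x\<close> of the row products.\<close>
    have sqx: "(\<rho> * x)\<^sup>2 \<le> \<rho>\<^sup>2 * x" using x x1 \<rho>
        by (simp add: power_mult_distrib power2_eq_square mult_left_le)
    have Gbound: "kk * (\<rho>\<^sup>2 * x) \<le> G" if "kk \<le> Gc" for kk
      unfolding G_def using that x by (intro mult_right_mono) auto
    have r: "0 < r" "r \<le> \<delta>" "16 * L \<le> real n * r"
    proof -
      show "0 < r" using rc pos x by (simp add: r_def)
      have "\<rho> * x = \<rho> powr (1 / d) * (L / z) powr (\<beta> / d)" using ids(3) by (simp add: z_def)
      also have "\<dots> \<le> 1 * (L / z) powr (\<beta> / d)"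
        using \<rho> d powr_mono2[of "1 / d" \<rho> 1] by (intro mult_right_mono) auto
      also have "\<dots> \<le> \<delta> / rc" using z0[OF z(3)] by (simp add: L_def)
      finally show "r \<le> \<delta>" using rc by (simp add: r_def field_simps)
      have "16 * L \<le> 16 / g0 * y" using g0L g0 by (simp add: field_simps)
      also have "\<dots> \<le> rc * y" using rc y by (intro mult_right_mono) auto
      also have "\<dots> = real n * rc * (\<rho> * (\<rho> * x))" by (simp add: y_def power2_eq_square)
      also have "\<dots> \<le> real n * rc * (\<rho> * x)" by (rule mult_left_mono[OF \<rho>\<rho>]) (use rc in simp)
      finally show "16 * L \<le> real n * r" by (simp add: r_def mult_ac)
    qed
    obtain H where H: "{\<omega> \<in> space M. H \<omega>} \<in> sets S.latent"
      "S.prob {\<omega> \<in> space M. \<not> H \<omega>} \<le> real J * (1 / r + 1) * exp (- (real n * r / 4))"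
      "\<And>\<omega> i. \<omega> \<in> space M \<Longrightarrow> H \<omega> \<Longrightarrow> i \<in> {1..n} \<Longrightarrow> \<exists>S\<subseteq>{1..n}. real n * r / 4 \<le> real (card S) \<and>
        (\<forall>i'\<in>S. \<forall>j\<in>{1..n}. \<forall>t\<in>{0..1}.
          \<bar>edge_prob f \<rho> \<xi> \<omega> t i j - edge_prob f \<rho> \<xi> \<omega> t i' j\<bar> \<le> \<rho> * (L2 * r))"
      using S.latent_cells[OF lipschitz(3,2) r(1,2) graphon \<rho>(1)] by blast
    define rate where "rate = C * \<rho> powr ((2 * \<beta> + 2) / d) * (L / z) powr (\<beta> / d)"
    have rate: "(210 * W\<^sup>2 + 2) * G \<le> rate"
    proof -
      have "(210 * W\<^sup>2 + 2) * G = C0 * (\<rho>\<^sup>2 * x)" by (simp add: C0_def G_def)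
      also have "\<dots> \<le> C * (\<rho>\<^sup>2 * x)" using C x by (intro mult_right_mono) auto
      also have "\<dots> = rate" unfolding rate_def ids(2)[folded z_def, symmetric] by simp
      finally show ?thesis .
    qed
    define \<epsilon> where "\<epsilon> = real m * real n * real n * (5 * exp (- (4 * L)))"
    have bound: "bern_pr (S.sprob \<omega>) S.slots (\<lambda>a. \<not> sup_error n
        (three_stage_estimator K l n m (T m) h1 (Some h2) h3 (adjacency a)) (edge_prob f \<rho> \<xi> \<omega>) \<le> ereal rate) \<le> \<epsilon>"
      if \<omega>: "\<omega> \<in> space M" "H \<omega>" for \<omega>
      unfolding \<epsilon>_def
    proof (rule S.neighborhood_regime[OF graphon \<rho> times _ holder ws1 ws3 _ _ h2pos E_def])
      show "2 * sqrt (\<rho> * (B * W) * (real n * (\<rho> * W)\<^sup>2) * (4 * L)) + 2 * (B * (\<rho> * W)) * (4 * L) \<le>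
          real n * G"
        by (rule order_trans[OF rates(1)[folded k1_def] yG[OF Gc(1)]])
      show "2 * sqrt (\<rho> * (B * W) * E * (4 * L)) + 2 * (B * W) * (4 * L) + 2 * W\<^sup>2 \<le> real n * G"
        by (rule order_trans[OF rates(2)[folded k2_def] yG[OF Gc(2)]])
      show "E \<le> real n * G * (h2 * real n)"
      proof -
        have "E * \<rho> \<le> c * k3 * y\<^sup>2" using rates(3) cpos by (simp add: k3_def)
        also have "\<dots> \<le> c * Gc * y\<^sup>2" using Gc(3) cpos by (intro mult_left_mono mult_right_mono) auto
        also have "\<dots> = (real n * G) * (real n * (c * (\<rho> * x))) * \<rho>" unfolding nG
            by (simp add: y_def power2_eq_square)
        finally have "E \<le> (real n * G) * (real n * (c * (\<rho> * x)))"
          by (rule mult_right_le_imp_le) (rule \<rho>(1))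
        also have "\<dots> \<le> (real n * G) * (real n * h2)"
          using h2b(1) Gc y unfolding nG by (intro mult_left_mono) auto
        finally show ?thesis by (simp add: mult_ac)
      qed
      show "h2 * real n \<le> real n * r / 4"
      proof -
        have "4 * c' * (\<rho> * x) \<le> r" unfolding r_def using rc \<rho> x by (intro mult_right_mono) auto
        then have "4 * h2 \<le> r" using h2b(2) by linarith
        then have "real n * (4 * h2) \<le> real n * r" by (intro mult_left_mono) auto
        then show ?thesis by (simp add: mult_ac)
      qed
      show "3 \<le> real n * r / 4" using r(3) L1' by linarith
      show "W * (\<rho> * (L2 * r)) * (\<rho> * W) \<le> G"
      proof -
        have "W * (\<rho> * (L2 * r)) * (\<rho> * W) = k4 * (\<rho>\<^sup>2 * (\<rho> * x))"
            by (simp add: k4_def r_def power2_eq_square)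
        also have "\<dots> \<le> k4 * (\<rho>\<^sup>2 * x)" using ks \<rho> x by (intro mult_left_mono) auto
        finally show ?thesis using Gbound[OF Gc(4)] by linarith
      qed
      show "(\<rho> * (L1 * h1 powr \<beta> * W))\<^sup>2 \<le> G"
      proof -
        have "h1 powr \<beta> \<le> (c' * h0) powr \<beta>" using h1b h1pos holder by (intro powr_mono2) auto
        also have "\<dots> = c' powr \<beta> * x" by (simp add: x_def powr_mult)
        finally have "(\<rho> * (L1 * h1 powr \<beta> * W))\<^sup>2 \<le> (\<rho> * (L1 * (c' powr \<beta> * x) * W))\<^sup>2"
          using \<rho> holder W by (intro power_mono mult_left_mono mult_right_mono) auto
        also have "\<dots> = k5 * (\<rho> * x)\<^sup>2" by (simp add: k5_def power_mult_distrib mult_ac)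
        also have "\<dots> \<le> k5 * (\<rho>\<^sup>2 * x)" using sqx ks by (intro mult_left_mono) auto
        finally show ?thesis using Gbound[OF Gc(5)] by linarith
      qed
      show "(\<rho> * (L1 * h3 powr \<beta> * W))\<^sup>2 \<le> G"
      proof -
        have "(\<rho> * (L1 * h3 powr \<beta> * W))\<^sup>2 = k6 * (\<rho> * x)\<^sup>2"
          by (simp add: k6_def h3eq x_def power_mult_distrib mult_ac)
        also have "\<dots> \<le> k6 * (\<rho>\<^sup>2 * x)" using sqx ks by (intro mult_left_mono) auto
        finally show ?thesis using Gbound[OF Gc(6)] by linarith
      qed
      show "(210 * W\<^sup>2 + 2) * G \<le> rate" by (rule rate)
      show "0 \<le> G" using Gc x by (simp add: G_def)
    qed (use nm L1' \<omega> H(3) in auto)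
    have "1 - (\<epsilon> + real J * (1 / r + 1) * exp (- (real n * r / 4))) \<le> S.prob {\<omega> \<in> space M.
      sup_error n (three_stage_estimator K l n m (T m) h1 (Some h2) h3 (\<lambda>k i j. A k i j \<omega>)) (edge_prob f \<rho> \<xi> \<omega>) \<le> ereal rate}"
      by (rule S.prob_sup_error_ge[OF graphon \<rho> times _ _ H(1,2) bound])
        (use nm holder_in_time_continuous[OF holder(1) less_imp_le[OF holder(2)] holder(3)] in \<open>auto simp: \<epsilon>_def\<close>)
    moreover have "\<epsilon> \<le> 1 / z" unfolding \<epsilon>_def L_def z_def
      by (rule union_bound_small) (use nm z in \<open>auto simp: z_def\<close>)
    moreover have "real J * (1 / r + 1) * exp (- (real n * r / 4)) \<le> 1 / z" unfolding z_def
      by (rule cell_bound_small) (use nm z L1' r(3) in \<open>auto simp: z_def L_def\<close>)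
    moreover have "2 / z = 1 / z + 1 / z" by simp
    ultimately show "1 - 2 / (real n * real m) \<le> measure M {\<omega> \<in> space M.
        sup_error n
          (three_stage_estimator K (nat \<lfloor>\<beta>\<rfloor>) n m (T m) h1 (Some h2) h3 (\<lambda>k i j. A k i j \<omega>))
          (edge_prob f \<rho> \<xi> \<omega>)
        \<le> ereal (C * \<rho> powr ((2 * \<beta> + 2) / d) * (ln (real n * real m) / (real n * real m)) powr (\<beta> / d))}"
      unfolding rate_def L_def z_def l_def by linarith
  qed
qed

text \<open>Without averaging over nodes each entry is controlled separately, so no event on the
  latent positions is required and only the number of snapshots enters the rate.\<close>

lemma sparse_regime_estimate:
  fixes f :: "real \<Rightarrow> real \<Rightarrow> real \<Rightarrow> real" and K :: "real \<Rightarrow> real" and T :: "nat \<Rightarrow> nat \<Rightarrow> real"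
    and \<beta> L1 lam0 a0 Kmax c c' :: real and m0 :: nat
  defines "d \<equiv> 2 * \<beta> + 1"
  assumes graphon: "time_varying_graphon f"
    and holder: "0 < \<beta>" "0 < L1" "holder_in_time \<beta> L1 f"
    and observed: "\<forall>m. \<forall>k\<in>{1..m}. T m k \<in> {0..1}"
    and lam0: "0 < lam0" and LP2: "0 < a0" "LP2 a0 T" and LP3: "LP3 Kmax K"
    and cpos: "0 < c" "0 < c'"
  shows "\<exists>C0>0. \<exists>N. \<forall>C\<ge>C0. \<forall>n\<ge>N. \<forall>m\<ge>N. \<forall>\<rho> h1 h3 (M :: 'a measure) \<xi> A.
      0 < \<rho> \<longrightarrow> \<rho> < 1 \<longrightarrow>
      sparse_graphon_sample M n m f \<rho> (T m) \<xi> A \<longrightarrow>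
      LP1 K (nat \<lfloor>\<beta>\<rfloor>) lam0 m0 m (T m) h1 \<longrightarrow>
      LP1 K (nat \<lfloor>\<beta>\<rfloor>) lam0 m0 m (T m) h3 \<longrightarrow>
      same_order c c' h1 ((ln (real n * real m) / (\<rho> * real m)) powr (1 / d)) \<longrightarrow>
      h3 = \<rho> powr (- 2 / d) * (ln (real n * real m) / real m) powr (2 / d) \<longrightarrow>
      1 - 2 / (real n * real m) \<le> measure M {\<omega> \<in> space M.
        sup_error n
          (three_stage_estimator K (nat \<lfloor>\<beta>\<rfloor>) n m (T m) h1 None h3 (\<lambda>k i j. A k i j \<omega>))
          (edge_prob f \<rho> \<xi> \<omega>)
        \<le> ereal (C * \<rho> powr ((2 * \<beta> + 2) / d) * (ln (real n * real m) / real m) powr (2 * \<beta> / d))}"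
proof -
  note times = observed[rule_format]
  define l where "l = nat \<lfloor>\<beta>\<rfloor>"
  define cw where "cw = Kmax * real (Suc l) / lam0 + 1"
  define W where "W = 2 * a0 * cw"
  define k where "k = cw / c"
  \<comment> \<open>\<open>LP1\<close> bounds \<open>h1\<close>, hence \<open>h0\<close>, and
    \<open>X\<close> is the resulting bound on \<open>x\<close>. It replaces one factor of
    \<open>x\<^sup>2\<close> in the linear term of Bernstein's inequality and in the bias of the
    third stage.\<close>
  define X where "X = (Kmax / lam0 / c) powr \<beta>"
  define \<kappa>c where "\<kappa>c = 1 + (4 * sqrt (W * k) + 8 * k * X) + L1 * c' powr \<beta> * W + L1 * X * W"
  have "0 \<le> Kmax" using LP3 order_trans[OF abs_ge_zero] unfolding LP3_def by blast
  then have cw: "0 < cw" "Kmax * real (Suc l) / lam0 \<le> cw"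
    using lam0 by (auto simp: cw_def intro!: add_nonneg_pos)
  have W: "0 < W" using LP2 cw by (simp add: W_def)
  have k: "0 < k" using cw cpos by (simp add: k_def)
  have d: "0 < d" using holder by (auto simp: d_def)
  have X: "0 \<le> X" by (simp add: X_def)
  have ks: "0 \<le> 4 * sqrt (W * k) + 8 * k * X" "0 \<le> L1 * c' powr \<beta> * W" "0 \<le> L1 * X * W"
    using W k X holder by (auto intro!: add_nonneg_nonneg)
  then have \<kappa>c: "4 * sqrt (W * k) + 8 * k * X \<le> \<kappa>c" "L1 * c' powr \<beta> * W \<le> \<kappa>c" "L1 * X * W \<le> \<kappa>c" "0 < \<kappa>c"
    unfolding \<kappa>c_def by linarith+
  define N where "N = 5 + m0"
  define C0 where "C0 = (8 * W\<^sup>2 + 2) * \<kappa>c\<^sup>2"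
  have C0: "0 < C0" using \<kappa>c by (auto simp: C0_def intro!: mult_pos_pos add_nonneg_pos)
  show ?thesis
  proof (intro exI[of _ C0] conjI C0 exI[of _ N] allI impI)
    fix C n m \<rho> h1 h3 and M :: "'a measure" and \<xi> A
    assume C: "C0 \<le> C" and nN: "N \<le> n" and mN: "N \<le> m" and \<rho>: "0 < \<rho>" "\<rho> < 1"
      and sample: "sparse_graphon_sample M n m f \<rho> (T m) \<xi> A"
      and LP1: "LP1 K (nat \<lfloor>\<beta>\<rfloor>) lam0 m0 m (T m) h1" "LP1 K (nat \<lfloor>\<beta>\<rfloor>) lam0 m0 m (T m) h3"
      and h1: "same_order c c' h1 ((ln (real n * real m) / (\<rho> * real m)) powr (1 / d))"
      and h3: "h3 = \<rho> powr (- 2 / d) * (ln (real n * real m) / real m) powr (2 / d)"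
    interpret S: sparse_graphon_sample M n m f \<rho> "T m" \<xi> A by (rule sample)
    define z where "z = real n * real m"
    define L where "L = ln z"
    define h0 where "h0 = (L / (\<rho> * real m)) powr (1 / d)"
    define x where "x = h0 powr \<beta>"
    define B where "B = cw / (real m * h1)"
    define \<kappa> where "\<kappa> = \<kappa>c * (\<rho> * x)"
    have nm: "5 \<le> n" "5 \<le> m" "m0 \<le> m" using nN mN by (auto simp: N_def)
    have z: "5 \<le> z"
    proof -
      have "5 * 1 \<le> real n * real m" using nm by (intro mult_mono) auto
      then show ?thesis by (simp add: z_def)
    qed
    have "0 < L" using z by (simp add: L_def)
    then have pos: "0 < real m" "0 < \<rho>" "0 < \<beta>" "0 < L" using nm \<rho> holder by auto
    note ids = one_node_bandwidth_identities[OF pos, folded d_def, folded h0_def, folded x_def]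
    have h0: "0 < h0" using pos by (simp add: h0_def)
    have x: "0 < x" using h0 by (simp add: x_def)
    have h1b: "c * h0 \<le> h1" "h1 \<le> c' * h0"
      using h1 unfolding same_order_def z_def[symmetric] L_def[symmetric] h0_def by auto
    have h1pos: "0 < h1" using h1b h0 cpos by (meson less_le_trans mult_pos_pos)
    have h3eq: "h3 = h0\<^sup>2" using h3 unfolding z_def[symmetric] L_def[symmetric] ids(3) .
    have ws1: "weight_system (nat \<lfloor>\<beta>\<rfloor>) m (T m) h1 (lp_weight K l m (T m) h1) B W"
      unfolding B_def W_def l_def[symmetric]
      by (rule lp_weight_system[OF LP1(1)[folded l_def] nm(3) lam0 LP3 h1pos _ LP2(2,1) times cw])
          (use nm in auto)
    have ws3: "weight_system (nat \<lfloor>\<beta>\<rfloor>) m (T m) h3 (lp_weight K l m (T m) h3) (cw / (real m * h3)) W"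
      unfolding W_def l_def[symmetric]
      by (rule lp_weight_system[OF LP1(2)[folded l_def] nm(3) lam0 LP3 _ _ LP2(2,1) times cw])
          (use nm h0 h3eq in auto)
    have "h1 \<le> Kmax / lam0" by (rule lp_bandwidth_le[OF LP1(1) nm(3) _ lam0 LP3 h1pos]) (use nm in simp)
    then have "c * h0 \<le> Kmax / lam0" using h1b(1) by linarith
    then have "h0 * c \<le> Kmax / lam0" by (simp add: mult.commute)
    then have "h0 \<le> Kmax / lam0 / c" by (rule pos_le_divide_eq[OF cpos(1), THEN iffD2])
    then have xX: "x \<le> X" unfolding x_def X_def using h0 holder by (intro powr_mono2) auto
    have BL: "B * L \<le> k * (\<rho> * x\<^sup>2)"
    proof -
      have "B \<le> cw / (real m * (c * h0))"
        unfolding B_def using cw pos h0 h1b cpos h1pos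
            by (intro divide_left_mono mult_left_mono mult_pos_pos) auto
      then have "B * L \<le> cw / (real m * (c * h0)) * L" using pos by (intro mult_right_mono) auto
      also have "\<dots> = cw / (real m * (c * h0)) * (\<rho> * real m * h0 * x\<^sup>2)" unfolding ids(1) ..
      also have "\<dots> = k * (\<rho> * x\<^sup>2)" using pos h0 cpos by (simp add: k_def)
      finally show ?thesis .
    qed
    have \<rho>x: "0 < \<rho> * x" using pos x by simp
    have \<kappa>bound: "kk * (\<rho> * x) \<le> \<kappa>" if "kk \<le> \<kappa>c" for kk
      unfolding \<kappa>_def using that \<rho>x by (intro mult_right_mono) auto
    have \<kappa>1: "2 * sqrt (\<rho> * (B * W) * (4 * L)) + 2 * B * (4 * L) \<le> \<kappa>"
    proof -
      have "\<rho> * (B * W) * (4 * L) = 4 * W * \<rho> * (B * L)" by simp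
      also have "\<dots> \<le> 4 * W * \<rho> * (k * (\<rho> * x\<^sup>2))" using BL W pos by (intro mult_left_mono) auto
      also have "\<dots> = 4 * (W * k) * (\<rho> * x)\<^sup>2" by (simp add: power2_eq_square)
      finally have "sqrt (\<rho> * (B * W) * (4 * L)) \<le> sqrt (4 * (W * k) * (\<rho> * x)\<^sup>2)"
          by (rule real_sqrt_le_mono)
      also have "\<dots> = 2 * sqrt (W * k) * (\<rho> * x)"
        unfolding real_sqrt_mult[of "4 * (W * k)"] real_sqrt_mult[of 4] using \<rho>x by simp
      finally have 1: "2 * sqrt (\<rho> * (B * W) * (4 * L)) \<le> 4 * sqrt (W * k) * (\<rho> * x)" by linarith
      have "B * L \<le> k * (\<rho> * (X * x))"
        using BL xX x k pos
            by (simp add: power2_eq_square) (smt (verit, best) mult_left_mono mult_right_mono)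
      then have 2: "2 * B * (4 * L) \<le> 8 * k * X * (\<rho> * x)" by (simp add: mult_ac)
      have "(4 * sqrt (W * k) + 8 * k * X) * (\<rho> * x) = 4 * sqrt (W * k) * (\<rho> * x) + 8 * k * X * (\<rho> * x)"
        by (simp only: distrib_right)
      then show ?thesis using 1 2 \<kappa>bound[OF \<kappa>c(1)] by linarith
    qed
    have \<kappa>2: "\<rho> * (L1 * h1 powr \<beta> * W) \<le> \<kappa>"
    proof -
      have "h1 powr \<beta> \<le> (c' * h0) powr \<beta>" using h1b h1pos holder by (intro powr_mono2) auto
      also have "\<dots> = c' powr \<beta> * x" by (simp add: x_def powr_mult)
      finally have "\<rho> * (L1 * h1 powr \<beta> * W) \<le> \<rho> * (L1 * (c' powr \<beta> * x) * W)"
        using \<rho> holder W by (intro mult_left_mono mult_right_mono) auto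
      also have "\<dots> = (L1 * c' powr \<beta> * W) * (\<rho> * x)" by simp
      finally show ?thesis using \<kappa>bound[OF \<kappa>c(2)] by linarith
    qed
    have \<kappa>3: "\<rho> * (L1 * h3 powr \<beta> * W) \<le> \<kappa>"
    proof -
      have "h3 powr \<beta> = x * x" unfolding h3eq x_def power2_eq_square by (simp add: powr_mult)
      also have "\<dots> \<le> X * x" using xX x by (intro mult_right_mono) auto
      finally have "\<rho> * (L1 * h3 powr \<beta> * W) \<le> \<rho> * (L1 * (X * x) * W)"
        using \<rho> holder W by (intro mult_left_mono mult_right_mono) auto
      also have "\<dots> = (L1 * X * W) * (\<rho> * x)" by simp
      finally show ?thesis using \<kappa>bound[OF \<kappa>c(3)] by linarith
    qed
    define rate where "rate = C * \<rho> powr ((2 * \<beta> + 2) / d) * (L / real m) powr (2 * \<beta> / d)"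
    have rate: "(8 * W\<^sup>2 + 2) * \<kappa>\<^sup>2 \<le> rate"
    proof -
      have "(8 * W\<^sup>2 + 2) * \<kappa>\<^sup>2 = C0 * (\<rho> * x)\<^sup>2" by (simp add: C0_def \<kappa>_def power_mult_distrib)
      also have "\<dots> \<le> C * (\<rho> * x)\<^sup>2" using C by (intro mult_right_mono) auto
      also have "\<dots> = rate" unfolding rate_def ids(2)[symmetric] by simp
      finally show ?thesis .
    qed
    \<comment> \<open>The factor 5, instead of the 2 of this regime, lets one arithmetic lemma serve
      both union bounds.\<close>
    define \<epsilon> where "\<epsilon> = real m * real n * real n * (5 * exp (- (4 * L)))"
    have bound: "bern_pr (S.sprob \<omega>) S.slots (\<lambda>a. \<not> sup_error n
        (three_stage_estimator K l n m (T m) h1 None h3 (adjacency a)) (edge_prob f \<rho> \<xi> \<omega>) \<le> ereal rate) \<le> \<epsilon>"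
      if \<omega>: "\<omega> \<in> space M" for \<omega>
      unfolding \<epsilon>_def
      by (rule S.one_node_regime[OF graphon \<rho> times _ holder ws1 ws3 _ \<kappa>1 \<kappa>2 \<kappa>3 \<omega> rate, THEN order_trans])
        (use nm pos in auto)
    have "{\<omega> \<in> space M. True} \<in> sets S.latent"
      using sets.top[of S.latent] by (simp add: S.space_latent)
    then have "1 - (\<epsilon> + 0) \<le> S.prob {\<omega> \<in> space M.
      sup_error n (three_stage_estimator K l n m (T m) h1 None h3 (\<lambda>k i j. A k i j \<omega>)) (edge_prob f \<rho> \<xi> \<omega>) \<le> ereal rate}"
      using nm holder_in_time_continuous[OF holder(1) less_imp_le[OF holder(2)] holder(3)] times
      by (intro S.prob_sup_error_ge[where H = "\<lambda>_. True"] graphon \<rho> bound) (auto simp: \<epsilon>_def)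
    moreover have "\<epsilon> \<le> 1 / z" unfolding \<epsilon>_def L_def z_def
      by (rule union_bound_small) (use nm z in \<open>auto simp: z_def\<close>)
    moreover have "2 / z = 1 / z + 1 / z" by simp
    moreover have "0 \<le> 1 / z" using z by simp
    ultimately show "1 - 2 / (real n * real m) \<le> measure M {\<omega> \<in> space M.
        sup_error n
          (three_stage_estimator K (nat \<lfloor>\<beta>\<rfloor>) n m (T m) h1 None h3 (\<lambda>k i j. A k i j \<omega>))
          (edge_prob f \<rho> \<xi> \<omega>)
        \<le> ereal (C * \<rho> powr ((2 * \<beta> + 2) / d) * (ln (real n * real m) / real m) powr (2 * \<beta> / d))}"
      unfolding rate_def L_def z_def l_def by linarith
  qed
qed

theorem theorem2:
  fixes f :: "real \<Rightarrow> real \<Rightarrow> real \<Rightarrow> real"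
    and K :: "real \<Rightarrow> real"
    and T :: "nat \<Rightarrow> nat \<Rightarrow> real"
    and \<beta> L1 L2 \<delta> lam0 a0 Kmax c c' b b' :: real
    and J m0 :: nat
  assumes graphon: "time_varying_graphon f"
    and holder: "0 < \<beta>" "0 < L1" "holder_in_time \<beta> L1 f"
    and lipschitz: "0 < \<delta>" "1 \<le> J" "piecewise_lipschitz \<delta> J L2 f"
    and times: "\<And>m k. k \<in> {1..m} \<Longrightarrow> T m k \<in> {0..1}"
    and LP1_consts: "0 < lam0" "0 < m0"
    and LP2: "0 < a0" "LP2 a0 T"
    and LP3: "LP3 Kmax K"
    and bandwidth_consts: "0 < c" "0 < c'"
    and regime_consts: "0 < b" "0 < b'"
  shows "\<exists>C>0. \<exists>C'>0. \<exists>\<gamma>>0. \<exists>N. \<forall>n\<ge>N. \<forall>m\<ge>N.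
    \<forall>\<rho> h1 h3 (M :: 'a measure) \<xi> A.
      0 < \<rho> \<longrightarrow> \<rho> < 1 \<longrightarrow>
      sqrt (ln (real n * real m) / (real n * real m)) \<le> \<rho> \<longrightarrow>
      sparse_graphon_sample M n m f \<rho> (T m) \<xi> A \<longrightarrow>
      LP1 K (nat \<lfloor>\<beta>\<rfloor>) lam0 m0 m (T m) h1 \<longrightarrow>
      LP1 K (nat \<lfloor>\<beta>\<rfloor>) lam0 m0 m (T m) h3 \<longrightarrow>
      (\<forall>h2.
        real n * \<rho> \<ge> b * degree_threshold \<beta> n m \<longrightarrow>
        same_order c c' h1
          ((ln (real n * real m) / (\<rho>\<^sup>2 * real n * real m)) powr (1 / (2 * \<beta> + 1))) \<longrightarrow>
        same_order c c' h2
          (\<rho> powr (1 / (2 * \<beta> + 1)) *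
           (ln (real n * real m) / (real n * real m)) powr (\<beta> / (2 * \<beta> + 1))) \<longrightarrow>
        h3 = \<rho> powr (- 2 / (2 * \<beta> + 1)) *
          (ln (real n * real m) / (real n * real m)) powr (1 / (2 * \<beta> + 1)) \<longrightarrow>
        measure M {\<omega> \<in> space M.
          sup_error n
            (three_stage_estimator K (nat \<lfloor>\<beta>\<rfloor>) n m (T m) h1 (Some h2) h3 (\<lambda>k i j. A k i j \<omega>))
            (edge_prob f \<rho> \<xi> \<omega>)
          \<le> ereal (C * \<rho> powr ((2 * \<beta> + 2) / (2 * \<beta> + 1)) *
               (ln (real n * real m) / (real n * real m)) powr (\<beta> / (2 * \<beta> + 1)))}
        \<ge> 1 - 2 * (real n * real m) powr (- (C' + \<gamma>))) \<and>
      (real n * \<rho> \<le> b' * degree_threshold \<beta> n m \<longrightarrow>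
        same_order c c' h1
          ((ln (real n * real m) / (\<rho> * real m)) powr (1 / (2 * \<beta> + 1))) \<longrightarrow>
        h3 = \<rho> powr (- 2 / (2 * \<beta> + 1)) *
          (ln (real n * real m) / real m) powr (2 / (2 * \<beta> + 1)) \<longrightarrow>
        measure M {\<omega> \<in> space M.
          sup_error n
            (three_stage_estimator K (nat \<lfloor>\<beta>\<rfloor>) n m (T m) h1 None h3 (\<lambda>k i j. A k i j \<omega>))
            (edge_prob f \<rho> \<xi> \<omega>)
          \<le> ereal (C * \<rho> powr ((2 * \<beta> + 2) / (2 * \<beta> + 1)) *
               (ln (real n * real m) / real m) powr (2 * \<beta> / (2 * \<beta> + 1)))}
        \<ge> 1 - 2 * (real n * real m) powr (- (C' + \<gamma>)))"
proof -
  have observed: "\<forall>m. \<forall>k\<in>{1..m}. T m k \<in> {0..1}" by (intro allI ballI times)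
  obtain C1 N1 where C1: "0 < C1" and R1: "\<forall>C\<ge>C1. \<forall>n\<ge>N1. \<forall>m\<ge>N1. \<forall>\<rho> h1 h2 h3 (M :: 'a measure) \<xi> A.
      0 < \<rho> \<longrightarrow> \<rho> < 1 \<longrightarrow>
      sqrt (ln (real n * real m) / (real n * real m)) \<le> \<rho> \<longrightarrow>
      sparse_graphon_sample M n m f \<rho> (T m) \<xi> A \<longrightarrow>
      LP1 K (nat \<lfloor>\<beta>\<rfloor>) lam0 m0 m (T m) h1 \<longrightarrow>
      LP1 K (nat \<lfloor>\<beta>\<rfloor>) lam0 m0 m (T m) h3 \<longrightarrow>
      b * degree_threshold \<beta> n m \<le> real n * \<rho> \<longrightarrow>
      same_order c c' h1 ((ln (real n * real m) / (\<rho>\<^sup>2 * real n * real m)) powr (1 / (2 * \<beta> + 1))) \<longrightarrow>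
      same_order c c' h2 (\<rho> powr (1 / (2 * \<beta> + 1)) *
        (ln (real n * real m) / (real n * real m)) powr (\<beta> / (2 * \<beta> + 1))) \<longrightarrow>
      h3 = \<rho> powr (- 2 / (2 * \<beta> + 1)) * (ln (real n * real m) / (real n * real m)) powr (1 / (2 * \<beta> + 1)) \<longrightarrow>
      1 - 2 / (real n * real m) \<le> measure M {\<omega> \<in> space M.
        sup_error n
          (three_stage_estimator K (nat \<lfloor>\<beta>\<rfloor>) n m (T m) h1 (Some h2) h3 (\<lambda>k i j. A k i j \<omega>))
          (edge_prob f \<rho> \<xi> \<omega>)
        \<le> ereal (C * \<rho> powr ((2 * \<beta> + 2) / (2 * \<beta> + 1)) *
            (ln (real n * real m) / (real n * real m)) powr (\<beta> / (2 * \<beta> + 1)))}"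
    using dense_regime_estimate[OF graphon holder lipschitz observed LP1_consts(1) LP2 LP3 bandwidth_consts regime_consts(1),
      where ?m0.0 = m0 and 'a = 'a] by (elim exE conjE) (rule that)
  obtain C2 N2 where C2: "0 < C2" and R2: "\<forall>C\<ge>C2. \<forall>n\<ge>N2. \<forall>m\<ge>N2. \<forall>\<rho> h1 h3 (M :: 'a measure) \<xi> A.
      0 < \<rho> \<longrightarrow> \<rho> < 1 \<longrightarrow>
      sparse_graphon_sample M n m f \<rho> (T m) \<xi> A \<longrightarrow>
      LP1 K (nat \<lfloor>\<beta>\<rfloor>) lam0 m0 m (T m) h1 \<longrightarrow>
      LP1 K (nat \<lfloor>\<beta>\<rfloor>) lam0 m0 m (T m) h3 \<longrightarrow>
      same_order c c' h1 ((ln (real n * real m) / (\<rho> * real m)) powr (1 / (2 * \<beta> + 1))) \<longrightarrow>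
      h3 = \<rho> powr (- 2 / (2 * \<beta> + 1)) * (ln (real n * real m) / real m) powr (2 / (2 * \<beta> + 1)) \<longrightarrow>
      1 - 2 / (real n * real m) \<le> measure M {\<omega> \<in> space M.
        sup_error n
          (three_stage_estimator K (nat \<lfloor>\<beta>\<rfloor>) n m (T m) h1 None h3 (\<lambda>k i j. A k i j \<omega>))
          (edge_prob f \<rho> \<xi> \<omega>)
        \<le> ereal (C * \<rho> powr ((2 * \<beta> + 2) / (2 * \<beta> + 1)) *
            (ln (real n * real m) / real m) powr (2 * \<beta> / (2 * \<beta> + 1)))}"
    using sparse_regime_estimate[OF graphon holder observed LP1_consts(1) LP2 LP3 bandwidth_consts,
      where ?m0.0 = m0 and 'a = 'a] by (elim exE conjE) (rule that)
  \<comment> \<open>Both estimates hold with probability at least \<open>1 - 2 / (n * m)\<close>, so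
    the two exponents of the claim only have to add up to 1; they are taken equal.\<close>
  have level: "1 - 2 * (real n * real m) powr (- (1 / 2 + 1 / 2)) = 1 - 2 / (real n * real m)" for n m :: nat
  proof -
    have "(1 / 2 + 1 / 2 :: real) = 1" by simp
    then have "(real n * real m) powr (- (1 / 2 + 1 / 2)) = 1 / (real n * real m) powr 1"
      by (simp only: powr_minus_divide)
    then show ?thesis by simp
  qed
  show ?thesis
  proof (rule exI[of _ "max C1 C2"], rule conjI[rotated], rule exI[of _ "1 / 2"], rule conjI[rotated],
      rule exI[of _ "1 / 2"], rule conjI[rotated], rule exI[of _ "max N1 N2"], intro allI impI conjI)
    fix n m \<rho> h1 h3 and M :: "'a measure" and \<xi> A h2
    assume a: "max N1 N2 \<le> n" "max N1 N2 \<le> m" "0 < \<rho>" "\<rho> < 1"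
      "sqrt (ln (real n * real m) / (real n * real m)) \<le> \<rho>"
      "sparse_graphon_sample M n m f \<rho> (T m) \<xi> A"
      "LP1 K (nat \<lfloor>\<beta>\<rfloor>) lam0 m0 m (T m) h1" "LP1 K (nat \<lfloor>\<beta>\<rfloor>) lam0 m0 m (T m) h3"
      "b * degree_threshold \<beta> n m \<le> real n * \<rho>"
      "same_order c c' h1 ((ln (real n * real m) / (\<rho>\<^sup>2 * real n * real m)) powr (1 / (2 * \<beta> + 1)))"
      "same_order c c' h2 (\<rho> powr (1 / (2 * \<beta> + 1)) *
        (ln (real n * real m) / (real n * real m)) powr (\<beta> / (2 * \<beta> + 1)))"
      "h3 = \<rho> powr (- 2 / (2 * \<beta> + 1)) * (ln (real n * real m) / (real n * real m)) powr (1 / (2 * \<beta> + 1))"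
    show "1 - 2 * (real n * real m) powr (- (1 / 2 + 1 / 2)) \<le> measure M {\<omega> \<in> space M.
        sup_error n
          (three_stage_estimator K (nat \<lfloor>\<beta>\<rfloor>) n m (T m) h1 (Some h2) h3 (\<lambda>k i j. A k i j \<omega>))
          (edge_prob f \<rho> \<xi> \<omega>)
        \<le> ereal (max C1 C2 * \<rho> powr ((2 * \<beta> + 2) / (2 * \<beta> + 1)) *
            (ln (real n * real m) / (real n * real m)) powr (\<beta> / (2 * \<beta> + 1)))}"
      unfolding level by (rule R1[rule_format, OF _ _ _ a(3-12)]) (use a(1,2) in simp_all)
  next
    fix n m \<rho> h1 h3 and M :: "'a measure" and \<xi> A
    assume a: "max N1 N2 \<le> n" "max N1 N2 \<le> m" "0 < \<rho>" "\<rho> < 1"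
      "sparse_graphon_sample M n m f \<rho> (T m) \<xi> A"
      "LP1 K (nat \<lfloor>\<beta>\<rfloor>) lam0 m0 m (T m) h1" "LP1 K (nat \<lfloor>\<beta>\<rfloor>) lam0 m0 m (T m) h3"
      "same_order c c' h1 ((ln (real n * real m) / (\<rho> * real m)) powr (1 / (2 * \<beta> + 1)))"
      "h3 = \<rho> powr (- 2 / (2 * \<beta> + 1)) * (ln (real n * real m) / real m) powr (2 / (2 * \<beta> + 1))"
    show "1 - 2 * (real n * real m) powr (- (1 / 2 + 1 / 2)) \<le> measure M {\<omega> \<in> space M.
        sup_error n
          (three_stage_estimator K (nat \<lfloor>\<beta>\<rfloor>) n m (T m) h1 None h3 (\<lambda>k i j. A k i j \<omega>))
          (edge_prob f \<rho> \<xi> \<omega>)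
        \<le> ereal (max C1 C2 * \<rho> powr ((2 * \<beta> + 2) / (2 * \<beta> + 1)) *
            (ln (real n * real m) / real m) powr (2 * \<beta> / (2 * \<beta> + 1)))}"
      unfolding level by (rule R2[rule_format, OF _ _ _ a(3-9)]) (use a(1,2) in simp_all)
  qed (use C1 in simp_all)
qed

end
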